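(* Let $d\ge 1$ and $m\ge 1$ be integers. The map $(A,s)\mapsto P(A,s)$, where $P(A,s)$ is the SVF topological pressure, is continuous on $(\mathrm{GL}_d(\mathbb{R}))^m\times[0,+\infty)$.
   Context: $(\mathrm{GL}_d(\mathbb{R}))^m$ carries the topology induced from $(\mathbb{R}^{d\times d})^m$. For $B\in\mathrm{GL}_d(\mathbb{R})$ let $\alpha_1(B)\ge\cdots\ge\alpha_d(B)>0$ be its singular values. The singular value function (SVF) is defined as follows: for $0\le s<d$, with $k=\lfloor s\rfloor$, put $\phi^s(B)=\alpha_1(B)\cdots\alpha_k(B)\,\alpha_{k+1}(B)^{s-k}$; for $s\ge d$, put $\phi^s(B)=|\det B|^{s/d}$. Let $I=\{1,\ldots,m\}$. For $A=(A_1,\ldots,A_m)\in(\mathrm{GL}_d(\mathbb{R}))^m$ and a word $\mathtt{i}=(i_1\cdots i_n)\in I^n$, put $A(\mathtt{i})=A_{i_n}\cdots A_{i_1}$. The SVF topological pressure is $P(A,s)=\lim_{n\to\infty}\frac1n\log\sum_{\mathtt{i}\in I^n}\phi^s(A(\mathtt{i}))$ for $s\ge 0$ (the limit exists and is finite). *)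

theory Defs
  imports "HOL-Analysis.Analysis" "HOL-Computational_Algebra.Computational_Algebra"
begin

definition charpoly :: "real^'d^'d \<Rightarrow> real poly" where
  "charpoly M = det ((\<chi> i j. (if i = j then [:0, 1:] else 0) - [:M $ i $ j:]) :: real poly^'d^'d)"

text \<open>The singular values are the square roots of the eigenvalues of \<open>B\<^sup>T B\<close>, with multiplicity,
  in nonincreasing order.\<close>

definition singular_values :: "real^'d^'d \<Rightarrow> real list" where
  "singular_values B =
     rev (sorted_list_of_multiset (image_mset sqrt (proots (charpoly (transpose B ** B)))))"

text \<open>Indexed from 1: \<open>singular_value B 1\<close> is the largest singular value of \<open>B\<close>.\<close>

definition singular_value :: "real^'d^'d \<Rightarrow> nat \<Rightarrow> real" where
  "singular_value B k = singular_values B ! (k - 1)"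

text \<open>Intended for invertible \<open>B\<close>, where all singular values are positive; in particular the last
  factor is 1 when \<open>s\<close> is an integer.\<close>

definition svf :: "real \<Rightarrow> real^'d^'d \<Rightarrow> real" where
  "svf s B =
     (if s < real CARD('d)
      then (let k = nat \<lfloor>s\<rfloor> in
              (\<Prod>i = 1..k. singular_value B i) * singular_value B (k + 1) powr (s - real k))
      else \<bar>det B\<bar> powr (s / real CARD('d)))"

text \<open>The word \<open>[i\<^sub>1, \<dots>, i\<^sub>n]\<close> is sent to \<open>A $ i\<^sub>n ** \<dots> ** A $ i\<^sub>1\<close>, the first letter acting first.\<close>

fun word_prod :: "real^'d^'d^'m \<Rightarrow> 'm list \<Rightarrow> real^'d^'d" where
  "word_prod A [] = mat 1"
| "word_prod A (i # w) = word_prod A w ** A $ i"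

definition pressure :: "real^'d^'d^'m \<Rightarrow> real \<Rightarrow> real" where
  "pressure A s =
     lim (\<lambda>n. (1 / real n) * ln (\<Sum>w\<in>{w :: 'm list. length w = n}. svf s (word_prod A w)))"

definition GL_tuples :: "(real^'d^'d^'m) set" where
  "GL_tuples = {A. \<forall>i. invertible (A $ i)}"

end

theory Submission
  imports Defs
begin

text \<open>
  Write \<open>A(w)\<close> for the product of the matrices \<open>A $ i\<close> along a word \<open>w\<close>. Up to a constant factor
  \<open>\<alpha>\<^sub>1 \<dots> \<alpha>\<^sub>k\<close> is the norm of the \<open>k\<close>-th exterior power, here the sum \<open>wedge_norm k\<close> of the absolute
  values of the minors of order \<open>k\<close>. Hence for \<open>s = k + t\<close> with \<open>0 \<le> t \<le> 1\<close> and \<open>k < d\<close> the singular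
  value function is comparable with \<open>wedge_norm k\<^sup>1\<^sup>-\<^sup>t \<cdot> wedge_norm (k+1)\<^sup>t\<close>, which is submultiplicative.
  Constant factors do not change exponential growth rates, so the pressure is the limit, and the
  infimum, of \<open>(1/n) ln S\<^sub>n\<close>, where \<open>S\<^sub>n\<close> sums this quantity over the words of length \<open>n\<close>. As an
  infimum of continuous functions it is upper semicontinuous; the difficulty is lower semicontinuity.

  For the pressure of a power \<open>p > 0\<close> of a norm of \<open>D \<times> D\<close> matrices, lower semicontinuity comes from
  an inequality of Bochi and Morris (lemma \<open>block_inequality\<close>). With \<open>T\<^sub>n\<close> the sum of \<open>\<parallel>M(w)\<parallel>\<^sup>p\<close> over
  the words of length \<open>n\<close>, there is a constant \<open>C\<close> that depends only on \<open>p\<close> and on the index set of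
  the matrices, such that \<open>T\<^sub>D \<le> C T\<^sub>L\<^sup>1\<^sup>/\<^sup>L T\<^sub>1\<^sup>D\<^sup>-\<^sup>1\<close> for every finite family \<open>M\<close> and every \<open>L \<ge> 1\<close> with
  \<open>T\<^sub>L > 0\<close>. Applied to the family of all products of length \<open>n\<close>, and with \<open>L\<close> tending to infinity, it
  bounds \<open>n P\<close> from below by \<open>ln T\<^sub>n\<^sub>D - (D-1) ln T\<^sub>n - ln C\<close>. This is continuous in the matrices, and
  after division by \<open>n\<close> it converges to \<open>D P - (D-1) P = P\<close>.

  The inequality itself is proved in an adapted basis. From the growth of the products one builds a
  function \<open>F\<close>, homogeneous of degree \<open>p\<close>, with \<open>\<Sum>\<^sub>i F(M\<^sub>i v) \<le> 2 \<mu> F(v)\<close>, \<open>\<mu> = T\<^sub>L\<^sup>1\<^sup>/\<^sup>L\<close>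
  (\<open>growth_functional\<close>). Greedy minimisation of \<open>F\<close> with pivoting gives a basis \<open>u\<^sub>0, \<dots>, u\<^sub>D\<^sub>-\<^sub>1\<close> of bounded
  distortion for which \<open>F(u\<^sub>k)\<close> is almost increasing and every coordinate \<open>c\<^sub>k\<close> satisfies
  \<open>\<bar>c\<^sub>k(v)\<bar>\<^sup>p F(u\<^sub>k) \<le> C F(v)\<close> (\<open>adapted_frame_exists\<close>). In this basis the entries \<open>(m, j)\<close> of the \<open>M\<^sub>i\<close> with
  \<open>j \<le> m\<close> have \<open>p\<close>-th powers summing to \<open>O(\<mu>)\<close>. A product of \<open>D\<close> matrices expands over paths of
  \<open>D + 1\<close> indices in a set of size \<open>D\<close>; such a path cannot be strictly decreasing, so it uses one of
  these small entries (\<open>triangular_gain\<close>).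

  If \<open>t = b/N\<close> is rational, \<open>wedge_norm k\<^sup>1\<^sup>-\<^sup>t \<cdot> wedge_norm (k+1)\<^sup>t\<close> is exactly the \<open>1/N\<close>-th power of the
  entry sum of a Kronecker product of \<open>N\<close> compound matrices, so the pressure is continuous in \<open>A\<close>
  (\<open>pressure_continuous_rational\<close>). It is also Lipschitz in \<open>t\<close>, with a constant continuous in \<open>A\<close>
  (\<open>pressure_strip_Lipschitz\<close>), and both facts give joint continuity on each strip \<open>k \<le> s \<le> k + 1\<close>.
  For \<open>s \<ge> d\<close> the sums over words factorise and the pressure is an explicit function of the
  determinants. Finitely many relatively closed pieces are glued at the end.
\<close>

(* Formal power series use the same infix symbol as finite Cartesian products. *)
no_notation fps_nth (infixl "$" 75)

section \<open>Auxiliary inequalities and limits\<close>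

lemma powr_add_le:
  fixes a b p :: real
  assumes "a \<ge> 0" "b \<ge> 0" "p > 0"
  shows "(a + b) powr p \<le> 2 powr p * (a powr p + b powr p)"
proof -
  have "(a + b) powr p \<le> (2 * max a b) powr p"
    using assms by (intro powr_mono2) auto
  also have "\<dots> = 2 powr p * max a b powr p"
    using assms by (simp add: powr_mult)
  also have "max a b powr p \<le> a powr p + b powr p"
    by (simp add: max_def)
  finally show ?thesis by simp
qed

lemma powr_sum_le:
  fixes f :: "'a \<Rightarrow> real"
  assumes "finite X" "p > 0" and nn: "\<And>x. x \<in> X \<Longrightarrow> f x \<ge> 0"
  shows "(\<Sum>x\<in>X. f x) powr p \<le> real (card X) powr p * (\<Sum>x\<in>X. f x powr p)"
proof (cases "X = {}")
  case True
  then show ?thesis using assms by simp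
next
  case False
  define m where "m = Max (f ` X)"
  have "m \<in> f ` X" unfolding m_def using False assms by (intro Max_in) auto
  then obtain y where y: "y \<in> X" "m = f y" by auto
  have le: "f x \<le> m" if "x \<in> X" for x unfolding m_def using that assms by auto
  have "(\<Sum>x\<in>X. f x) \<le> real (card X) * m"
    using sum_bounded_above[of X f m] le by auto
  then have "(\<Sum>x\<in>X. f x) powr p \<le> (real (card X) * m) powr p"
    using assms by (intro powr_mono2 sum_nonneg) auto
  also have "\<dots> = real (card X) powr p * f y powr p"
    using y nn by (simp add: powr_mult)
  also have "f y powr p \<le> (\<Sum>x\<in>X. f x powr p)"
    using y assms by (intro member_le_sum) auto
  finally show ?thesis by (simp add: mult_left_mono)
qed

text \<open>Fekete's lemma: for a subadditive sequence \<open>a n / n\<close> tends to its infimum.\<close>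

lemma fekete:
  fixes a :: "nat \<Rightarrow> real"
  assumes sub: "\<And>m n. m \<ge> 1 \<Longrightarrow> n \<ge> 1 \<Longrightarrow> a (m + n) \<le> a m + a n"
    and low: "\<And>n. n \<ge> 1 \<Longrightarrow> - B * real n \<le> a n"
  obtains l where "(\<lambda>n. a n / real n) \<longlonglongrightarrow> l" "\<And>n. n \<ge> 1 \<Longrightarrow> l \<le> a n / real n"
proof -
  define S where "S = (\<lambda>n. a n / real n) ` {1..}"
  define l where "l = Inf S"
  have bdd: "bdd_below S"
    unfolding S_def using low by (intro bdd_belowI[of _ "- B"]) (auto simp: field_simps)
  have le: "l \<le> a n / real n" if "n \<ge> 1" for n
    unfolding l_def S_def using bdd that by (intro cInf_lower) (auto simp: S_def)
  have "(\<lambda>n. a n / real n) \<longlonglongrightarrow> l"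
  proof (rule order_tendstoI)
    fix y assume "y < l"
    then show "\<forall>\<^sub>F n in sequentially. y < a n / real n"
      using le by (intro eventually_sequentiallyI[of 1]) force
  next
    fix y assume y: "l < y"
    have "S \<noteq> {}" by (auto simp: S_def)
    with y obtain m where m: "m \<ge> 1" "a m / real m < y"
      unfolding l_def using cInf_lessD[of S y] by (auto simp: S_def)
    define c where "c = Max ((\<lambda>r. \<bar>a r\<bar>) ` {1..m})"
    have c: "\<bar>a r\<bar> \<le> c" if "r \<in> {1..m}" for r unfolding c_def using that by (intro Max_ge) auto
    have ind: "a (q * m + r) \<le> real q * a m + a r" if "r \<ge> 1" for q r
    proof (induction q)
      case (Suc q)
      have "a (Suc q * m + r) = a (m + (q * m + r))" by (simp add: algebra_simps)
      also have "\<dots> \<le> a m + a (q * m + r)" using m that by (intro sub) auto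
      finally show ?case using Suc by (simp add: algebra_simps)
    qed simp
    have bound: "a n / real n \<le> a m / real m + (\<bar>a m\<bar> + c) / real n" if n: "n \<ge> 1" for n
    proof -
      \<comment> \<open>Dividing \<open>n - 1\<close> keeps the remainder \<open>r\<close> positive, as subadditivity is only assumed for positive indices.\<close>
      define q where "q = (n - 1) div m"
      define r where "r = (n - 1) mod m + 1"
      have nq: "n = q * m + r" using n by (simp add: q_def r_def)
      have r: "r \<in> {1..m}" using m by (auto simp: r_def Suc_le_eq)
      have "a n \<le> real q * a m + c" using ind[of r q] c[OF r] r nq by force
      moreover have "real q * a m = (a m / real m) * real n - (a m / real m) * real r"
        using m by (simp add: nq field_simps)
      moreover have "- (a m / real m) * real r \<le> \<bar>a m / real m\<bar> * real m"
        using r abs_ge_minus_self[of "a m / real m"] by (intro mult_mono) (auto simp del: abs_divide)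
      moreover have "\<bar>a m / real m\<bar> * real m = \<bar>a m\<bar>" using m by simp
      ultimately have "a n \<le> (a m / real m) * real n + (\<bar>a m\<bar> + c)" by simp
      then show ?thesis using n by (simp add: field_simps)
    qed
    have "(\<lambda>n. a m / real m + (\<bar>a m\<bar> + c) / real n) \<longlonglongrightarrow> a m / real m + 0"
      by (intro tendsto_add tendsto_const lim_const_over_n)
    then have "\<forall>\<^sub>F n in sequentially. a m / real m + (\<bar>a m\<bar> + c) / real n < y"
      using m(2) by (simp add: order_tendstoD)
    then show "\<forall>\<^sub>F n in sequentially. a n / real n < y"
      using eventually_ge_at_top[of 1] by eventually_elim (use bound in force)
  qed
  then show thesis using le that by blast
qed

text \<open>A function that is squeezed pointwise between two sequences of continuous functions converging to
  it: the lower sequence gives lower semicontinuity, the upper one upper semicontinuity.\<close>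

lemma continuous_on_sandwich:
  fixes f :: "'a :: topological_space \<Rightarrow> real"
  assumes gh: "\<And>n. n \<ge> 1 \<Longrightarrow> continuous_on X (g n)" "\<And>n. n \<ge> 1 \<Longrightarrow> continuous_on X (h n)"
    and le: "\<And>n x. n \<ge> 1 \<Longrightarrow> x \<in> X \<Longrightarrow> h n x \<le> f x" "\<And>n x. n \<ge> 1 \<Longrightarrow> x \<in> X \<Longrightarrow> f x \<le> g n x"
    and lim: "\<And>x. x \<in> X \<Longrightarrow> (\<lambda>n. g n x) \<longlonglongrightarrow> f x" "\<And>x. x \<in> X \<Longrightarrow> (\<lambda>n. h n x) \<longlonglongrightarrow> f x"
  shows "continuous_on X f"
  unfolding continuous_on_def
proof (intro ballI order_tendstoI)
  fix x a assume x: "x \<in> X" and "a < f x"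
  then have "\<forall>\<^sub>F n in sequentially. n \<ge> 1 \<and> a < h n x"
    using order_tendstoD(1)[OF lim(2)[OF x]] eventually_ge_at_top[of 1] by (auto intro: eventually_conj)
  then obtain n where n: "n \<ge> 1" "a < h n x" by (auto simp: eventually_sequentially)
  have "\<forall>\<^sub>F y in at x within X. a < h n y"
    using gh(2)[OF n(1)] n(2) x by (auto simp: continuous_on_def dest: order_tendstoD)
  moreover have "\<forall>\<^sub>F y in at x within X. y \<in> X" by (simp add: eventually_at_filter)
  ultimately show "\<forall>\<^sub>F y in at x within X. a < f y"
    by eventually_elim (use le(1)[OF n(1)] in force)
next
  fix x a assume x: "x \<in> X" and "f x < a"
  then have "\<forall>\<^sub>F n in sequentially. n \<ge> 1 \<and> g n x < a"
    using order_tendstoD(2)[OF lim(1)[OF x]] eventually_ge_at_top[of 1] by (auto intro: eventually_conj)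
  then obtain n where n: "n \<ge> 1" "g n x < a" by (auto simp: eventually_sequentially)
  have "\<forall>\<^sub>F y in at x within X. g n y < a"
    using gh(1)[OF n(1)] n(2) x by (auto simp: continuous_on_def dest: order_tendstoD)
  moreover have "\<forall>\<^sub>F y in at x within X. y \<in> X" by (simp add: eventually_at_filter)
  ultimately show "\<forall>\<^sub>F y in at x within X. f y < a"
    by eventually_elim (use le(2)[OF n(1)] in force)
qed

text \<open>Continuity in \<open>x\<close> for a dense set of parameters is enough for joint continuity, because a uniform
  Lipschitz bound near \<open>x\<close> transfers the estimate from a good parameter \<open>r\<close> to all nearby \<open>t\<close>.\<close>

lemma continuous_on_Times_Lipschitz:
  fixes f :: "'a :: topological_space \<Rightarrow> real \<Rightarrow> real"
  assumes K: "continuous_on X K" "\<And>x. x \<in> X \<Longrightarrow> K x \<ge> 0"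
    and lip: "\<And>x s t. x \<in> X \<Longrightarrow> s \<in> T \<Longrightarrow> t \<in> T \<Longrightarrow> \<bar>f x s - f x t\<bar> \<le> K x * \<bar>s - t\<bar>"
    and dense: "\<And>t e. t \<in> T \<Longrightarrow> e > 0 \<Longrightarrow> \<exists>r\<in>T. \<bar>t - r\<bar> < e \<and> continuous_on X (\<lambda>x. f x r)"
  shows "continuous_on (X \<times> T) (\<lambda>(x, t). f x t)"
  unfolding continuous_on_def
proof (intro ballI tendstoI)
  fix z :: "'a \<times> real" and e :: real assume z: "z \<in> X \<times> T" and e: "e > 0"
  obtain x t where xt: "z = (x, t)" "x \<in> X" "t \<in> T" using z by auto
  define k where "k = K x + 1"
  have k: "k > 0" using K(2)[OF xt(2)] by (simp add: k_def)
  \<comment> \<open>With \<open>k\<close> bounding the Lipschitz constant near \<open>x\<close>, the errors are at most \<open>2kd = e/4\<close>, \<open>e/2\<close> and \<open>kd = e/8\<close>.\<close>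
  define d where "d = e / (8 * k)"
  have d: "d > 0" using e k by (simp add: d_def)
  obtain r where r: "r \<in> T" "\<bar>t - r\<bar> < d" "continuous_on X (\<lambda>x. f x r)"
    using dense[OF xt(3) d] by blast
  let ?F = "at z within X \<times> T"
  have lim: "(fst \<longlongrightarrow> x) ?F" "(snd \<longlongrightarrow> t) ?F"
    using tendsto_fst[OF tendsto_ident_at, of z "X \<times> T"] tendsto_snd[OF tendsto_ident_at, of z "X \<times> T"]
    by (auto simp: xt)
  have "continuous_on (X \<times> T) (\<lambda>y. K (fst y))" "continuous_on (X \<times> T) (\<lambda>y. f (fst y) r)"
    using r K by (auto intro!: continuous_on_compose2[of X _ _ fst] continuous_intros)
  then have Kf: "((\<lambda>y. K (fst y)) \<longlongrightarrow> K x) ?F" "((\<lambda>y. f (fst y) r) \<longlongrightarrow> f x r) ?F"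
    using z by (auto simp: continuous_on_def xt)
  have 1: "\<forall>\<^sub>F y in ?F. K (fst y) < k" using Kf(1) by (rule order_tendstoD) (simp add: k_def)
  have 2: "\<forall>\<^sub>F y in ?F. dist (f (fst y) r) (f x r) < e / 2" using Kf(2) by (rule tendstoD) (simp add: e)
  have 3: "\<forall>\<^sub>F y in ?F. dist (snd y) t < d" using lim(2) d by (rule tendstoD)
  have 4: "\<forall>\<^sub>F y in ?F. y \<in> X \<times> T" by (simp add: eventually_at_filter)
  show "\<forall>\<^sub>F y in ?F. dist (case y of (x, t) \<Rightarrow> f x t) (case z of (x, t) \<Rightarrow> f x t) < e"
    using 1 2 3 4
  proof eventually_elim
    case (elim y)
    obtain x' t' where y: "y = (x', t')" "x' \<in> X" "t' \<in> T" using elim by auto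
    have "\<bar>f x' t' - f x' r\<bar> \<le> K x' * \<bar>t' - r\<bar>" using lip y r by blast
    also have "\<dots> \<le> k * (2 * d)"
      using elim y K(2)[OF y(2)] r(2) by (intro mult_mono) (auto simp: dist_real_def)
    finally have a: "\<bar>f x' t' - f x' r\<bar> \<le> e / 4" using k by (simp add: d_def)
    have "\<bar>f x t - f x r\<bar> \<le> K x * \<bar>t - r\<bar>" using lip xt r by blast
    also have "\<dots> \<le> k * d"
      using K(2)[OF xt(2)] r(2) by (intro mult_mono) (auto simp: k_def)
    finally have b: "\<bar>f x t - f x r\<bar> \<le> e / 8" using k by (simp add: d_def)
    have c: "\<bar>f x' r - f x r\<bar> < e / 2" using elim y by (simp add: dist_real_def)
    show ?case unfolding xt y dist_real_def prod.case using a b c e by linarith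
  qed
qed

section \<open>Bases adapted to a gauge\<close>

text \<open>Among the vectors of maximum norm 1 on \<open>X\<close>, take one that minimises \<open>F\<close> up to a factor 2; the
  infimum is positive because \<open>F\<close> dominates \<open>\<bar>v x\<bar>\<^sup>p\<close>. A discontinuous
  \<open>F\<close> may have no exact minimiser. By homogeneity, \<open>F u\<close> controls every coordinate of every vector.\<close>

lemma near_minimizer:
  fixes F :: "('j \<Rightarrow> real) \<Rightarrow> real"
  assumes p: "p > 0" and X: "finite X" "X \<noteq> {}"
    and hom: "\<And>a v. F (\<lambda>x. a * v x) = \<bar>a\<bar> powr p * F v"
    and low: "\<And>v x. x \<in> X \<Longrightarrow> \<bar>v x\<bar> powr p \<le> F v"
  obtains u x0 where "\<And>x. x \<notin> X \<Longrightarrow> u x = 0" "\<And>x. \<bar>u x\<bar> \<le> 1" "x0 \<in> X" "\<bar>u x0\<bar> = 1" "F u > 0"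
    "\<And>v x. (\<And>z. z \<notin> X \<Longrightarrow> v z = 0) \<Longrightarrow> x \<in> X \<Longrightarrow> \<bar>v x\<bar> powr p * F u \<le> 2 * F v"
proof -
  define U where "U = {v. (\<forall>x. x \<notin> X \<longrightarrow> v x = 0) \<and> (\<forall>x. \<bar>v x\<bar> \<le> 1) \<and> (\<exists>x\<in>X. \<bar>v x\<bar> = (1::real))}"
  obtain x1 where x1: "x1 \<in> X" using X by auto
  have "(\<lambda>x. if x = x1 then 1 else 0) \<in> U" using x1 by (auto simp: U_def)
  then have ne: "F ` U \<noteq> {}" by auto
  have ge1: "F v \<ge> 1" if "v \<in> U" for v
  proof -
    from that obtain x where "x \<in> X" "\<bar>v x\<bar> = 1" by (auto simp: U_def)
    with low[of x v] show ?thesis by simp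
  qed
  have bdd: "bdd_below (F ` U)" using ge1 by (intro bdd_belowI[of _ 1]) auto
  define m where "m = Inf (F ` U)"
  have m1: "m \<ge> 1" unfolding m_def using ne ge1 by (intro cInf_greatest) auto
  have "m < 2 * m" using m1 by simp
  then obtain u where u: "u \<in> U" "F u < 2 * m"
    using cInf_lessD[OF ne, of "2 * m"] unfolding m_def by auto
  have Fv: "\<bar>v x\<bar> powr p * F u \<le> 2 * F v" if v: "\<And>z. z \<notin> X \<Longrightarrow> v z = 0" and x: "x \<in> X" for v x
  proof (cases "v x = 0")
    case True
    have "0 \<le> F v" using low[OF x, of v] by (meson order_trans powr_ge_zero)
    then show ?thesis using True p by simp
  next
    case False
    define s where "s = Max ((\<lambda>x. \<bar>v x\<bar>) ` X)"
    have "s \<in> (\<lambda>x. \<bar>v x\<bar>) ` X" unfolding s_def using X by (intro Max_in) auto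
    then obtain y where y: "y \<in> X" "s = \<bar>v y\<bar>" by auto
    have le: "\<bar>v z\<bar> \<le> s" if "z \<in> X" for z unfolding s_def using that X by auto
    have s0: "s > 0" using le[OF x] False by auto
    have "(\<lambda>z. (1/s) * v z) \<in> U"
      unfolding U_def
    proof (intro CollectI conjI allI impI)
      fix z
      show "\<bar>1 / s * v z\<bar> \<le> 1"
        using s0 v[of z] le[of z] by (cases "z \<in> X") (auto simp: abs_mult)
      show "\<exists>x\<in>X. \<bar>1 / s * v x\<bar> = 1"
        using y s0 by (intro bexI[of _ y]) (auto simp: abs_mult)
    qed (simp add: v)
    then have "m \<le> F (\<lambda>z. (1/s) * v z)" unfolding m_def using bdd by (intro cInf_lower) auto
    also have "\<dots> = F v / s powr p" using s0 unfolding hom by (simp add: powr_divide)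
    finally have "m * s powr p \<le> F v" using s0 by (simp add: field_simps)
    moreover have "\<bar>v x\<bar> powr p * F u \<le> s powr p * (2 * m)"
      using le[OF x] u p m1 ge1[OF u(1)] by (intro mult_mono powr_mono2) auto
    ultimately show ?thesis by (simp add: mult_ac)
  qed
  from u(1) obtain x0 where "x0 \<in> X" "\<bar>u x0\<bar> = 1" by (auto simp: U_def)
  with that[of u x0] u(1) ge1[OF u(1)] Fv show thesis by (force simp: U_def)
qed

text \<open>Such an \<open>F\<close> is the \<open>p\<close>-th power of a quasi-norm that dominates the coordinates in \<open>X\<close>. The factor
  \<open>2\<^sup>p\<close> treats all \<open>p > 0\<close> alike: for the functions arising below, \<open>F\<close> itself is subadditive in general only
  if \<open>p \<le> 1\<close>, and its \<open>p\<close>-th root only if \<open>p \<ge> 1\<close>.\<close>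

definition gauge_on :: "real \<Rightarrow> 'j set \<Rightarrow> (('j \<Rightarrow> real) \<Rightarrow> real) \<Rightarrow> bool" where
  "gauge_on p X F \<longleftrightarrow>
     (\<forall>a v. F (\<lambda>x. a * v x) = \<bar>a\<bar> powr p * F v) \<and>
     (\<forall>v w. F (\<lambda>x. v x + w x) \<le> 2 powr p * (F v + F w)) \<and>
     (\<forall>v. \<forall>x\<in>X. \<bar>v x\<bar> powr p \<le> F v)"

text \<open>The vectors \<open>u k\<close> form a basis of the space of vectors supported in \<open>X\<close>, with coordinate functionals
  \<open>c k\<close>: the third condition says that the matrix with columns \<open>u k\<close> times the one with rows \<open>c k\<close> is the
  identity. The bounds on \<open>u\<close> and \<open>c\<close> limit the distortion of the change of basis. The fourth condition
  bounds \<open>F\<close> on each component \<open>c\<^sub>k(v) u\<^sub>k\<close> of \<open>v\<close> by \<open>C \<cdot> F v\<close>.\<close>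

definition adapted_frame ::
  "real \<Rightarrow> real \<Rightarrow> 'j set \<Rightarrow> (('j \<Rightarrow> real) \<Rightarrow> real) \<Rightarrow> (nat \<Rightarrow> 'j \<Rightarrow> real) \<Rightarrow> (nat \<Rightarrow> 'j \<Rightarrow> real) \<Rightarrow> bool" where
  "adapted_frame p C X F u c \<longleftrightarrow>
     (\<forall>k<card X. (\<forall>x. x \<notin> X \<longrightarrow> u k x = 0) \<and> (\<forall>x. \<bar>u k x\<bar> \<le> 1) \<and> (\<exists>x\<in>X. \<bar>u k x\<bar> = 1)) \<and>
     (\<forall>k<card X. \<forall>y\<in>X. \<bar>c k y\<bar> \<le> C) \<and>
     (\<forall>x\<in>X. \<forall>y\<in>X. (\<Sum>k<card X. u k x * c k y) = (if x = y then 1 else 0)) \<and>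
     (\<forall>k<card X. \<forall>v. (\<forall>z. z \<notin> X \<longrightarrow> v z = 0) \<longrightarrow>
        \<bar>\<Sum>y\<in>X. c k y * v y\<bar> powr p * F (u k) \<le> C * F v) \<and>
     (\<forall>k<card X. \<forall>j\<le>k. F (u j) \<le> 2 * F (u k))"

text \<open>Gaussian elimination with pivoting governed by \<open>F\<close>: take a near minimiser \<open>u\<^sub>0\<close> of \<open>F\<close>, eliminate a
  coordinate \<open>x\<^sub>0\<close> at which \<open>\<bar>u\<^sub>0 x\<^sub>0\<bar> = 1\<close>, and continue with the vectors vanishing at \<open>x\<^sub>0\<close>. Minimality of
  \<open>F u\<^sub>0\<close> makes the elimination step \<open>v \<mapsto> v - (v x\<^sub>0 / u\<^sub>0 x\<^sub>0) u\<^sub>0\<close> bounded with respect to \<open>F\<close>. The constant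
  depends only on \<open>p\<close> and the dimension, not on \<open>F\<close>; this uniformity is what the later limits rely on.\<close>

lemma adapted_frame_exists:
  fixes p :: real
  assumes p: "p > 0"
  shows "\<exists>C\<ge>1. \<forall>(X :: 'j set) F. finite X \<longrightarrow> card X = n \<longrightarrow> gauge_on p X F \<longrightarrow>
           (\<exists>u c. adapted_frame p C X F u c)"
proof (induction n)
  case 0
  then show ?case by (intro exI[of _ 1]) (auto simp: adapted_frame_def)
next
  case (Suc n)
  obtain C where C1: "C \<ge> 1" and IH: "\<And>(X :: 'j set) F. finite X \<Longrightarrow> card X = n \<Longrightarrow> gauge_on p X F \<Longrightarrow>
     (\<exists>u c. adapted_frame p C X F u c)"
    using Suc.IH by blast
  \<comment> \<open>The summand \<open>n\<close> bounds the new coefficients at the pivot, \<open>3 \<cdot> 2\<^sup>p\<close> the effect of one elimination step on \<open>F\<close>.\<close>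
  define C' where "C' = C * (real n + 2 + 3 * 2 powr p)"
  have CC': "C * real n \<le> C'" "C \<le> C'" "C * (3 * 2 powr p) \<le> C'" "2 \<le> C'"
    and C'1: "1 \<le> C'"
  proof -
    show "C * real n \<le> C'" "C * (3 * 2 powr p) \<le> C'" unfolding C'_def
      using C1 by (auto intro!: mult_left_mono)
    have "C * 1 \<le> C'" unfolding C'_def
      using C1 by (intro mult_left_mono) (auto intro: add_nonneg_nonneg)
    then show "C \<le> C'" by simp
    then show "1 \<le> C'" using C1 by simp
    have "1 * 2 \<le> C'" unfolding C'_def
      using C1 by (intro mult_mono) (auto intro: add_nonneg_nonneg)
    then show "2 \<le> C'" by simp
  qed
  show ?case
  proof (intro exI[of _ C'] conjI C'1 allI impI)
    fix X :: "'j set" and F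
    assume X: "finite X" "card X = Suc n" and gauge: "gauge_on p X F"
    have hom: "\<forall>a v. F (\<lambda>x. a * v x) = \<bar>a\<bar> powr p * F v"
      and tri: "\<forall>v w. F (\<lambda>x. v x + w x) \<le> 2 powr p * (F v + F w)"
      and low: "\<forall>v. \<forall>x\<in>X. \<bar>v x\<bar> powr p \<le> F v"
      using gauge by (auto simp: gauge_on_def)
    have ne: "X \<noteq> {}" using X by auto
    obtain u0 x0 where u0: "\<And>x. x \<notin> X \<Longrightarrow> u0 x = 0" "\<And>x. \<bar>u0 x\<bar> \<le> 1" "x0 \<in> X" "\<bar>u0 x0\<bar> = 1" "F u0 > 0"
      and min: "\<And>v x. (\<And>z. z \<notin> X \<Longrightarrow> v z = 0) \<Longrightarrow> x \<in> X \<Longrightarrow> \<bar>v x\<bar> powr p * F u0 \<le> 2 * F v"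
      using near_minimizer[OF p X(1) ne, of F] hom low by metis
    define Y where "Y = X - {x0}"
    have Y: "finite Y" "card Y = n" "x0 \<notin> Y" "X = insert x0 Y" "Y \<subseteq> X"
      using X u0(3) by (auto simp: Y_def)
    have "gauge_on p Y F" using gauge Y(5) by (auto simp: gauge_on_def)
    then obtain u c where frame: "adapted_frame p C Y F u c"
      using IH Y(1,2) by blast
    note fr = frame[unfolded adapted_frame_def Y(2)]
    have u: "u k x = 0" if "k < n" "x \<notin> Y" for k x using conjunct1[OF fr] that by simp
    have u1: "\<bar>u k x\<bar> \<le> 1" if "k < n" for k x using conjunct1[OF fr] that by simp
    have c: "\<bar>c k y\<bar> \<le> C" if "k < n" "y \<in> Y" for k y using fr that by simp
    have uc: "(\<Sum>k<n. u k x * c k y) = (if x = y then 1 else 0)" if "x \<in> Y" "y \<in> Y" for x y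
      using fr that by simp
    have cF: "\<bar>\<Sum>y\<in>Y. c k y * v y\<bar> powr p * F (u k) \<le> C * F v"
      if "k < n" "\<And>z. z \<notin> Y \<Longrightarrow> v z = 0" for k and v :: "'j \<Rightarrow> real"
      using fr that by simp
    have mono: "F (u j) \<le> 2 * F (u k)" if "k < n" "j \<le> k" for k j
      using fr that by simp
    have u2: "\<exists>x\<in>Y. \<bar>u k x\<bar> = 1" if "k < n" for k using conjunct1[OF fr] that by simp
    define g where "g = u0 x0"
    have g: "g \<noteq> 0" "\<bar>g\<bar> = 1" using u0(4) by (auto simp: g_def)
    define u' where "u' = (\<lambda>k. case k of 0 \<Rightarrow> u0 | Suc k \<Rightarrow> u k)"
    \<comment> \<open>Coefficients of the old functional \<open>c k\<close> precomposed with the elimination step.\<close>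
    define d where "d = (\<lambda>k y. if y = x0 then - (1/g) * (\<Sum>z\<in>Y. c k z * u0 z) else c k y)"
    define c' where "c' = (\<lambda>k y. case k of 0 \<Rightarrow> if y = x0 then 1/g else 0 | Suc k \<Rightarrow> d k y)"
    have A1: "\<forall>k<Suc n. (\<forall>x. x \<notin> X \<longrightarrow> u' k x = 0) \<and> (\<forall>x. \<bar>u' k x\<bar> \<le> 1) \<and> (\<exists>x\<in>X. \<bar>u' k x\<bar> = 1)"
    proof (intro allI impI)
      fix k assume "k < Suc n"
      then show "(\<forall>x. x \<notin> X \<longrightarrow> u' k x = 0) \<and> (\<forall>x. \<bar>u' k x\<bar> \<le> 1) \<and> (\<exists>x\<in>X. \<bar>u' k x\<bar> = 1)"
      proof (cases k)
        case 0
        then show ?thesis using u0 by (auto simp: u'_def)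
      next
        case (Suc l)
        then have "l < n" "u' k = u l" using \<open>k < Suc n\<close> by (auto simp: u'_def)
        then show ?thesis using u[of l] u1[of l] u2[of l] Y(5) by (metis subsetD)
      qed
    qed
    have dbd: "\<bar>d k y\<bar> \<le> C'" if "k < n" "y \<in> X" for k y
    proof (cases "y = x0")
      case True
      have "\<bar>d k y\<bar> = \<bar>\<Sum>z\<in>Y. c k z * u0 z\<bar>" using True g by (simp add: d_def abs_mult)
      also have "\<dots> \<le> (\<Sum>z\<in>Y. \<bar>c k z * u0 z\<bar>)" by (rule sum_abs)
      also have "\<dots> \<le> (\<Sum>z\<in>Y. C)"
      proof (rule sum_mono)
        fix z assume "z \<in> Y"
        then have "\<bar>c k z\<bar> * \<bar>u0 z\<bar> \<le> C * 1" using c that u0(2) C1 by (intro mult_mono) auto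
        then show "\<bar>c k z * u0 z\<bar> \<le> C" by (simp add: abs_mult)
      qed
      also have "\<dots> \<le> C'" using CC' Y by (simp add: mult.commute)
      finally show ?thesis .
    next
      case False
      then show ?thesis using that c[of k y] CC' Y by (auto simp: d_def)
    qed
    have A2: "\<forall>k<Suc n. \<forall>y\<in>X. \<bar>c' k y\<bar> \<le> C'"
    proof (intro allI impI ballI)
      fix k y assume "k < Suc n" "y \<in> X"
      then show "\<bar>c' k y\<bar> \<le> C'" using dbd C'1 g by (cases k) (auto simp: c'_def)
    qed
    have A3: "\<forall>x\<in>X. \<forall>y\<in>X. (\<Sum>k<Suc n. u' k x * c' k y) = (if x = y then 1 else 0)"
    proof (intro ballI)
      fix x y assume xy: "x \<in> X" "y \<in> X"
      have eq: "(\<Sum>k<Suc n. u' k x * c' k y) = u0 x * (if y = x0 then 1/g else 0) + (\<Sum>k<n. u k x * d k y)"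
        unfolding sum.lessThan_Suc_shift by (simp add: u'_def c'_def)
      show "(\<Sum>k<Suc n. u' k x * c' k y) = (if x = y then 1 else 0)"
      proof (cases "y = x0")
        case True
        have "(\<Sum>k<n. u k x * d k y) = - (1/g) * (\<Sum>k<n. \<Sum>z\<in>Y. u0 z * (u k x * c k z))"
          using True by (simp add: d_def sum_distrib_left mult_ac sum_negf)
        also have "(\<Sum>k<n. \<Sum>z\<in>Y. u0 z * (u k x * c k z)) = (\<Sum>z\<in>Y. u0 z * (\<Sum>k<n. u k x * c k z))"
          by (subst sum.swap) (simp add: sum_distrib_left)
        also have "\<dots> = (if x = x0 then 0 else u0 x)"
        proof (cases "x = x0")
          case True
          then show ?thesis using u Y(3) by simp
        next
          case False
          then have "x \<in> Y" using xy Y by auto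
          then have "(\<Sum>z\<in>Y. u0 z * (\<Sum>k<n. u k x * c k z)) = (\<Sum>z\<in>Y. if x = z then u0 z else 0)"
            by (intro sum.cong) (auto simp: uc)
          then show ?thesis using False \<open>x \<in> Y\<close> Y(1) by simp
        qed
        finally show ?thesis unfolding eq using True g by (auto simp: g_def)
      next
        case False
        then have y: "y \<in> Y" using xy Y by auto
        show ?thesis
        proof (cases "x = x0")
          case True
          then show ?thesis unfolding eq using False u Y(3) by (simp add: d_def)
        next
          case xF: False
          then have "x \<in> Y" using xy Y by auto
          then show ?thesis unfolding eq using False y uc[of x y] by (simp add: d_def)
        qed
      qed
    qed
    have A4: "\<forall>k<Suc n. \<forall>v. (\<forall>z. z \<notin> X \<longrightarrow> v z = 0) \<longrightarrow>
                \<bar>\<Sum>y\<in>X. c' k y * v y\<bar> powr p * F (u' k) \<le> C' * F v"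
    proof (intro allI impI)
      fix k and v :: "'j \<Rightarrow> real" assume k: "k < Suc n" and v: "\<forall>z. z \<notin> X \<longrightarrow> v z = 0"
      have Fv0: "F v \<ge> 0" using low u0(3) by (meson order_trans powr_ge_zero)
      have base: "\<bar>v x0\<bar> powr p * F u0 \<le> 2 * F v" using min[of v x0] v u0(3) by auto
      show "\<bar>\<Sum>y\<in>X. c' k y * v y\<bar> powr p * F (u' k) \<le> C' * F v"
      proof (cases k)
        case 0
        have "(\<Sum>y\<in>X. c' k y * v y) = (\<Sum>y\<in>X. if y = x0 then v y / g else 0)"
          using 0 by (intro sum.cong) (auto simp: c'_def)
        also have "\<dots> = v x0 / g" using X(1) u0(3) by simp
        finally have "\<bar>\<Sum>y\<in>X. c' k y * v y\<bar> = \<bar>v x0\<bar>" using g by simp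
        moreover have "2 * F v \<le> C' * F v" using Fv0 CC' by (intro mult_right_mono) auto
        ultimately show ?thesis using base 0 by (simp add: u'_def)
      next
        case (Suc l)
        then have l: "l < n" using k by simp
        define w where "w = (\<lambda>y. v y + (- (v x0 / g)) * u0 y)"
        have w0: "w z = 0" if "z \<notin> Y" for z
          using that v u0(1) Y(4) g by (cases "z = x0") (auto simp: w_def g_def)
        have "(\<Sum>y\<in>X. c' k y * v y) = d l x0 * v x0 + (\<Sum>y\<in>Y. d l y * v y)"
          using Suc Y by (simp add: c'_def)
        also have "(\<Sum>y\<in>Y. d l y * v y) = (\<Sum>y\<in>Y. c l y * v y)"
          using Y by (intro sum.cong) (auto simp: d_def)
        also have "d l x0 * v x0 + \<dots> = (\<Sum>y\<in>Y. c l y * w y)"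
          by (simp add: d_def w_def sum_distrib_left algebra_simps sum.distrib sum_subtractf sum_negf)
        finally have eq: "(\<Sum>y\<in>X. c' k y * v y) = (\<Sum>y\<in>Y. c l y * w y)" .
        have "F w \<le> 2 powr p * (F v + F (\<lambda>y. (- (v x0 / g)) * u0 y))"
          unfolding w_def by (rule tri[rule_format])
        also have "F (\<lambda>y. (- (v x0 / g)) * u0 y) = \<bar>v x0\<bar> powr p * F u0"
          using hom[rule_format, of "- (v x0 / g)" u0] g by simp
        also have "2 powr p * (F v + \<bar>v x0\<bar> powr p * F u0) \<le> 2 powr p * (F v + 2 * F v)"
          using base by (intro mult_left_mono) auto
        finally have Fw: "F w \<le> 3 * 2 powr p * F v" by (simp add: algebra_simps)
        have "\<bar>\<Sum>y\<in>X. c' k y * v y\<bar> powr p * F (u' k) = \<bar>\<Sum>y\<in>Y. c l y * w y\<bar> powr p * F (u l)"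
          unfolding eq by (simp add: Suc u'_def)
        also have "\<dots> \<le> C * F w" using cF[OF l w0] .
        also have "\<dots> \<le> C * (3 * 2 powr p * F v)" using Fw C1 by (intro mult_left_mono) auto
        also have "\<dots> \<le> C' * F v"
          using mult_right_mono[OF CC'(3) Fv0] by (simp add: mult_ac)
        finally show ?thesis .
      qed
    qed
    have A5: "\<forall>k<Suc n. \<forall>j\<le>k. F (u' j) \<le> 2 * F (u' k)"
    proof (intro allI impI)
      fix k j assume k: "k < Suc n" and jk: "j \<le> k"
      show "F (u' j) \<le> 2 * F (u' k)"
      proof (cases j)
        case 0
        obtain x where x: "x \<in> X" "\<bar>u' k x\<bar> = 1" using A1 k by blast
        have "\<bar>u' k x\<bar> powr p * F u0 \<le> 2 * F (u' k)" using A1 k x by (intro min) auto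
        then show ?thesis using x 0 by (simp add: u'_def)
      next
        case (Suc i)
        then show ?thesis using k jk mono[of "k - 1" i] by (cases k) (auto simp: u'_def)
      qed
    qed
    have "adapted_frame p C' X F u' c'"
      unfolding adapted_frame_def X(2) by (intro conjI A1 A2 A3 A4 A5)
    then show "\<exists>u c. adapted_frame p C' X F u c" by blast
  qed
qed

section \<open>Matrix products along words\<close>

definition words :: "'i set \<Rightarrow> nat \<Rightarrow> 'i list set" where
  "words I n = {w. set w \<subseteq> I \<and> length w = n}"

definition matmul_on :: "'j set \<Rightarrow> ('j \<Rightarrow> 'j \<Rightarrow> real) \<Rightarrow> ('j \<Rightarrow> 'j \<Rightarrow> real) \<Rightarrow> 'j \<Rightarrow> 'j \<Rightarrow> real" where
  "matmul_on J A B x y = (\<Sum>z\<in>J. A x z * B z y)"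

text \<open>As for \<open>word_prod\<close>, the first letter acts first. Only entries with both indices in \<open>J\<close> are meaningful.\<close>

fun word_mat :: "'j set \<Rightarrow> ('i \<Rightarrow> 'j \<Rightarrow> 'j \<Rightarrow> real) \<Rightarrow> 'i list \<Rightarrow> 'j \<Rightarrow> 'j \<Rightarrow> real" where
  "word_mat J M [] = (\<lambda>x y. if x = y then 1 else 0)"
| "word_mat J M (i # w) = matmul_on J (word_mat J M w) (M i)"

definition entry_sum :: "'j set \<Rightarrow> ('j \<Rightarrow> 'j \<Rightarrow> real) \<Rightarrow> real" where
  "entry_sum J A = (\<Sum>x\<in>J. \<Sum>y\<in>J. \<bar>A x y\<bar>)"

definition word_sum :: "'j set \<Rightarrow> ('i \<Rightarrow> 'j \<Rightarrow> 'j \<Rightarrow> real) \<Rightarrow> 'i set \<Rightarrow> real \<Rightarrow> nat \<Rightarrow> real" where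
  "word_sum J M I p n = (\<Sum>w\<in>words I n. entry_sum J (word_mat J M w) powr p)"

text \<open>The result is set to 0 outside \<open>J\<close> because frames speak about vectors supported in \<open>J\<close>.\<close>

definition app_on :: "'j set \<Rightarrow> ('j \<Rightarrow> 'j \<Rightarrow> real) \<Rightarrow> ('j \<Rightarrow> real) \<Rightarrow> 'j \<Rightarrow> real" where
  "app_on J A v x = (if x \<in> J then \<Sum>y\<in>J. A x y * v y else 0)"

lemma finite_words [simp]: "finite I \<Longrightarrow> finite (words I n)"
  unfolding words_def using finite_lists_length_eq[of I n] by simp

lemma words_0 [simp]: "words I 0 = {[]}"
  by (auto simp: words_def)

lemma sum_words_Suc:
  assumes "finite I"
  shows "(\<Sum>w\<in>words I (Suc n). f w) = (\<Sum>i\<in>I. \<Sum>w\<in>words I n. f (i # w))"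
proof -
  have "(\<Sum>w\<in>words I (Suc n). f w) = (\<Sum>(i, w)\<in>I \<times> words I n. f (i # w))"
    by (rule sum.reindex_bij_witness[of _ "\<lambda>(i, w). i # w" "\<lambda>w. (hd w, tl w)"])
       (auto simp: words_def length_Suc_conv)
  then show ?thesis by (simp add: sum.cartesian_product)
qed

lemma sum_words_add:
  assumes "finite I"
  shows "(\<Sum>w\<in>words I (m + n). f w) = (\<Sum>u\<in>words I m. \<Sum>v\<in>words I n. f (u @ v))"
proof (induction m arbitrary: f)
  case (Suc m)
  then show ?case using assms by (simp add: sum_words_Suc)
qed simp

lemma entry_sum_nonneg: "entry_sum J A \<ge> 0"
  unfolding entry_sum_def by (intro sum_nonneg) auto

lemma entry_sum_cong:
  "(\<And>x y. x \<in> J \<Longrightarrow> y \<in> J \<Longrightarrow> A x y = B x y) \<Longrightarrow> entry_sum J A = entry_sum J B"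
  unfolding entry_sum_def by simp

lemma matmul_on_assoc: "matmul_on J (matmul_on J A B) C x y = matmul_on J A (matmul_on J B C) x y"
  unfolding matmul_on_def sum_distrib_left sum_distrib_right
  by (subst sum.swap) (simp add: mult_ac)

lemma matmul_on_cong:
  "(\<And>z. z \<in> J \<Longrightarrow> A x z = A' x z) \<Longrightarrow> (\<And>z. z \<in> J \<Longrightarrow> B z y = B' z y) \<Longrightarrow>
   matmul_on J A B x y = matmul_on J A' B' x y"
  unfolding matmul_on_def by simp

lemma entry_sum_matmul_on_le:
  assumes "finite J"
  shows "entry_sum J (matmul_on J A B) \<le> entry_sum J A * entry_sum J B"
proof -
  have "entry_sum J (matmul_on J A B) \<le> (\<Sum>x\<in>J. \<Sum>y\<in>J. \<Sum>z\<in>J. \<bar>A x z\<bar> * \<bar>B z y\<bar>)"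
    unfolding entry_sum_def matmul_on_def abs_mult[symmetric] by (intro sum_mono sum_abs)
  also have "\<dots> = (\<Sum>x\<in>J. \<Sum>z\<in>J. \<bar>A x z\<bar> * (\<Sum>y\<in>J. \<bar>B z y\<bar>))"
    unfolding sum_distrib_left by (intro sum.cong refl sum.swap)
  also have "\<dots> \<le> (\<Sum>x\<in>J. \<Sum>z\<in>J. \<bar>A x z\<bar> * entry_sum J B)"
    unfolding entry_sum_def using assms
    by (intro sum_mono mult_left_mono member_le_sum) (auto intro: sum_nonneg)
  also have "\<dots> = entry_sum J A * entry_sum J B" by (simp add: entry_sum_def sum_distrib_right)
  finally show ?thesis .
qed

lemma word_mat_append:
  assumes "finite J" "x \<in> J" "y \<in> J"
  shows "word_mat J M (u @ v) x y = matmul_on J (word_mat J M v) (word_mat J M u) x y"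
  using assms(2,3)
proof (induction u arbitrary: x y)
  case Nil
  then show ?case using assms(1)
    by (simp add: matmul_on_def if_distrib[of "\<lambda>a. _ * a"] cong: if_cong)
next
  case (Cons i u)
  have "word_mat J M ((i # u) @ v) x y = matmul_on J (matmul_on J (word_mat J M v) (word_mat J M u)) (M i) x y"
    unfolding append_Cons word_mat.simps using Cons by (intro matmul_on_cong) auto
  then show ?case by (simp add: matmul_on_assoc)
qed

lemma word_sum_submult:
  assumes J: "finite J" and I: "finite I" and p: "p > 0"
  shows "word_sum J M I p (m + n) \<le> word_sum J M I p m * word_sum J M I p n"
proof -
  have "entry_sum J (word_mat J M (u @ v)) powr p
      \<le> entry_sum J (word_mat J M u) powr p * entry_sum J (word_mat J M v) powr p" for u v
  proof -
    have "entry_sum J (word_mat J M (u @ v)) = entry_sum J (matmul_on J (word_mat J M v) (word_mat J M u))"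
      using J by (intro entry_sum_cong word_mat_append)
    also have "\<dots> \<le> entry_sum J (word_mat J M u) * entry_sum J (word_mat J M v)"
      using entry_sum_matmul_on_le[OF J, of "word_mat J M v" "word_mat J M u"] by (simp add: mult.commute)
    finally show ?thesis
      using p powr_mono2[of p] entry_sum_nonneg[of J] by (simp add: powr_mult[symmetric])
  qed
  then show ?thesis
    using I unfolding word_sum_def sum_words_add[OF I] sum_product by (intro sum_mono)
qed

text \<open>Reading a word of length \<open>l * n\<close> as a word of \<open>l\<close> blocks allows the block inequality to be applied
  to the family of all products of length \<open>n\<close>.\<close>

lemma word_sum_blocks:
  fixes M :: "'i \<Rightarrow> 'j \<Rightarrow> 'j \<Rightarrow> real"
  assumes J: "finite J" and I: "finite I"
  shows "word_sum J (word_mat J M) (words I n) p l = word_sum J M I p (l * n)"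
proof -
  have mat: "word_mat J (word_mat J M) ws x y = word_mat J M (concat ws) x y" if "x \<in> J" "y \<in> J" for ws x y
    using that
  proof (induction ws arbitrary: x y)
    case (Cons w ws)
    have "word_mat J (word_mat J M) (w # ws) x y = matmul_on J (word_mat J M (concat ws)) (word_mat J M w) x y"
      unfolding word_mat.simps using Cons by (intro matmul_on_cong) auto
    then show ?case by (simp add: word_mat_append[OF J Cons.prems])
  qed simp
  have "(\<Sum>ws\<in>words (words I n) l. f (concat ws)) = (\<Sum>w\<in>words I (l * n). f w)" for f :: "'i list \<Rightarrow> real"
  proof (induction l arbitrary: f)
    case (Suc l)
    show ?case
      using Suc.IH[of "\<lambda>v. f (_ @ v)"] I by (simp add: sum_words_Suc sum_words_add)
  qed simp
  from this[of "\<lambda>w. entry_sum J (word_mat J M w) powr p"] show ?thesis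
    unfolding word_sum_def using mat by (simp cong: entry_sum_cong)
qed

section \<open>The block inequality\<close>

text \<open>The function is \<open>F v = \<Sum>\<^sub>l\<^sub><\<^sub>L \<mu>\<^sup>-\<^sup>l \<Sum>\<^bsub>\<bar>w\<bar> = l\<^esub> \<parallel>M(w) v\<parallel>\<^sup>p\<close>. Applying the matrices \<open>M i\<close> shifts the sum by one
  index and gains a factor \<open>\<mu>\<close>; the hypothesis on words of length \<open>L\<close> bounds the new last term by the
  old first one, so that nothing worse than a factor 2 is lost by truncating the series.\<close>

lemma growth_functional:
  fixes M :: "'i \<Rightarrow> 'j \<Rightarrow> 'j \<Rightarrow> real" and p \<mu> :: real
  assumes J: "finite J" and I: "finite I" and p: "p > 0" and mu: "\<mu> > 0" and L: "L \<ge> 1"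
    and wL: "word_sum J M I p L \<le> \<mu> ^ L"
  obtains F :: "('j \<Rightarrow> real) \<Rightarrow> real" where
    "\<And>a v. F (\<lambda>x. a * v x) = \<bar>a\<bar> powr p * F v"
    "\<And>v w. F (\<lambda>x. v x + w x) \<le> 2 powr p * (F v + F w)"
    "\<And>v x. x \<in> J \<Longrightarrow> \<bar>v x\<bar> powr p \<le> F v"
    "\<And>v. (\<Sum>i\<in>I. F (app_on J (M i) v)) \<le> 2 * \<mu> * F v"
proof -
  define N :: "('j \<Rightarrow> real) \<Rightarrow> real" where "N v = (\<Sum>x\<in>J. \<bar>v x\<bar>)" for v
  define G where "G l v = (\<Sum>w\<in>words I l. N (app_on J (word_mat J M w) v) powr p)" for l v
  define F where "F v = (\<Sum>l<L. G l v / \<mu> ^ l)" for v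
  have N0: "N v \<ge> 0" for v unfolding N_def by (intro sum_nonneg) auto
  have G0: "G l v \<ge> 0" for l v unfolding G_def by (intro sum_nonneg) auto
  have Ghom: "G l (\<lambda>x. a * v x) = \<bar>a\<bar> powr p * G l v" for l a v
  proof -
    have "app_on J A (\<lambda>x. a * v x) = (\<lambda>x. a * app_on J A v x)" for A
      by (auto simp: app_on_def fun_eq_iff sum_distrib_left mult_ac)
    moreover have "N (\<lambda>x. a * v x) = \<bar>a\<bar> * N v" for v
      by (simp add: N_def abs_mult sum_distrib_left)
    ultimately show ?thesis
      unfolding G_def by (simp add: powr_mult N0 sum_distrib_left)
  qed
  have 1: "F (\<lambda>x. a * v x) = \<bar>a\<bar> powr p * F v" for a v
    unfolding F_def Ghom by (simp add: sum_distrib_left)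
  have Gtri: "G l (\<lambda>x. v x + w x) \<le> 2 powr p * (G l v + G l w)" for l v w
  proof -
    have "app_on J A (\<lambda>x. v x + w x) = (\<lambda>x. app_on J A v x + app_on J A w x)" for A
      by (auto simp: app_on_def fun_eq_iff sum.distrib algebra_simps)
    moreover have "N (\<lambda>x. v x + w x) powr p \<le> 2 powr p * (N v powr p + N w powr p)" for v w
    proof -
      have "N (\<lambda>x. v x + w x) \<le> N v + N w"
        unfolding N_def sum.distrib[symmetric] by (intro sum_mono) auto
      then have "N (\<lambda>x. v x + w x) powr p \<le> (N v + N w) powr p"
        using p N0 by (intro powr_mono2) auto
      also have "\<dots> \<le> 2 powr p * (N v powr p + N w powr p)"
        using p N0 by (intro powr_add_le) auto
      finally show ?thesis .
    qed
    ultimately have "N (app_on J A (\<lambda>x. v x + w x)) powr p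
        \<le> 2 powr p * (N (app_on J A v) powr p + N (app_on J A w) powr p)" for A by simp
    then show ?thesis
      unfolding G_def sum.distrib[symmetric] sum_distrib_left by (intro sum_mono) auto
  qed
  have 2: "F (\<lambda>x. v x + w x) \<le> 2 powr p * (F v + F w)" for v w
    unfolding F_def sum.distrib[symmetric] sum_distrib_left
  proof (rule sum_mono)
    fix l
    show "G l (\<lambda>x. v x + w x) / \<mu> ^ l \<le> 2 powr p * (G l v / \<mu> ^ l + G l w / \<mu> ^ l)"
      using divide_right_mono[OF Gtri[of l v w], of "\<mu> ^ l"] mu
      by (simp add: add_divide_distrib distrib_left)
  qed
  have app_id: "N (app_on J (\<lambda>x y. if x = y then 1 else 0) v) = N v" for v
    unfolding N_def app_on_def using J
    by (intro sum.cong) (auto simp: if_distrib[of "\<lambda>a. a * _"] cong: if_cong)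
  have Gz: "G 0 v = N v powr p" for v by (simp add: G_def app_id)
  have FG0: "N v powr p \<le> F v" for v
  proof -
    have "G 0 v / \<mu> ^ 0 \<le> F v" unfolding F_def using L G0 mu
      by (intro member_le_sum) auto
    then show ?thesis by (simp add: Gz)
  qed
  have 3: "\<bar>v x\<bar> powr p \<le> F v" if "x \<in> J" for v x
  proof -
    have "\<bar>v x\<bar> \<le> N v" unfolding N_def using J that by (intro member_le_sum) auto
    then have "\<bar>v x\<bar> powr p \<le> N v powr p" using p by (intro powr_mono2) auto
    then show ?thesis using FG0[of v] by simp
  qed
  have step: "(\<Sum>i\<in>I. G l (app_on J (M i) v)) = G (Suc l) v" for l v
  proof -
    have "app_on J A (app_on J B v) = app_on J (matmul_on J A B) v" for A B
    proof
      fix x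
      have "(\<Sum>y\<in>J. A x y * (\<Sum>z\<in>J. B y z * v z)) = (\<Sum>y\<in>J. \<Sum>z\<in>J. A x y * B y z * v z)"
        by (simp add: sum_distrib_left mult_ac)
      also have "\<dots> = (\<Sum>z\<in>J. (\<Sum>y\<in>J. A x y * B y z) * v z)"
        by (subst sum.swap) (simp add: sum_distrib_right)
      finally show "app_on J A (app_on J B v) x = app_on J (matmul_on J A B) v x"
        by (simp add: app_on_def matmul_on_def)
    qed
    then show ?thesis using I by (simp add: G_def sum_words_Suc)
  qed
  have GL: "G L v \<le> \<mu> ^ L * N v powr p" for v
  proof -
    have "N (app_on J A v) \<le> entry_sum J A * N v" for A
    proof -
      have "N (app_on J A v) \<le> (\<Sum>x\<in>J. \<Sum>y\<in>J. \<bar>A x y\<bar> * N v)"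
        unfolding N_def
      proof (rule sum_mono)
        fix x assume "x \<in> J"
        then have "\<bar>app_on J A v x\<bar> \<le> (\<Sum>y\<in>J. \<bar>A x y * v y\<bar>)"
          by (simp add: app_on_def sum_abs)
        also have "\<dots> \<le> (\<Sum>y\<in>J. \<bar>A x y\<bar> * (\<Sum>x\<in>J. \<bar>v x\<bar>))"
          unfolding abs_mult using J by (intro sum_mono mult_left_mono member_le_sum) auto
        finally show "\<bar>app_on J A v x\<bar> \<le> \<dots>" .
      qed
      then show ?thesis by (simp add: entry_sum_def sum_distrib_right)
    qed
    then have "N (app_on J A v) powr p \<le> entry_sum J A powr p * N v powr p" for A
      using p N0 entry_sum_nonneg by (metis powr_mono2 powr_mult less_imp_le)
    then have "G L v \<le> word_sum J M I p L * N v powr p"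
      unfolding G_def word_sum_def sum_distrib_right by (intro sum_mono)
    also have "\<dots> \<le> \<mu> ^ L * N v powr p" using wL by (intro mult_right_mono) auto
    finally show ?thesis .
  qed
  have 4: "(\<Sum>i\<in>I. F (app_on J (M i) v)) \<le> 2 * \<mu> * F v" for v
  proof -
    have "(\<Sum>i\<in>I. F (app_on J (M i) v)) = (\<Sum>l<L. G (Suc l) v / \<mu> ^ l)"
      unfolding F_def by (subst sum.swap) (simp add: step[symmetric] sum_divide_distrib)
    also have "\<dots> = \<mu> * (\<Sum>l<L. G (Suc l) v / \<mu> ^ Suc l)"
      using mu by (simp add: sum_distrib_left)
    also have "(\<Sum>l<L. G (Suc l) v / \<mu> ^ Suc l) \<le> 2 * F v"
    proof -
      have "(\<Sum>l<L. G (Suc l) v / \<mu> ^ Suc l) \<le> (\<Sum>l<Suc L. G l v / \<mu> ^ l)"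
        unfolding sum.lessThan_Suc_shift using G0[of 0 v] by simp
      also have "\<dots> = F v + G L v / \<mu> ^ L" by (simp add: F_def)
      also have "G L v / \<mu> ^ L \<le> F v"
      proof -
        have "G L v / \<mu> ^ L \<le> N v powr p" using GL[of v] mu by (simp add: field_simps)
        then show ?thesis using FG0[of v] by simp
      qed
      finally show ?thesis by simp
    qed
    finally show ?thesis using mu by (simp add: mult_ac)
  qed
  show thesis using that 1 2 3 4 by blast
qed

text \<open>The entries of \<open>E\<close> on and below the diagonal gain \<open>\<mu>\<close> over the general bound \<open>T\<close>. An entry \<open>(k, j)\<close> of
  an \<open>l\<close>-fold product can miss this gain only if all steps are strictly above the diagonal, which
  forces \<open>k + l \<le> j\<close>. For \<open>l = D\<close> this is impossible with indices below \<open>D\<close>.\<close>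

lemma triangular_gain:
  fixes E :: "nat \<Rightarrow> nat \<Rightarrow> real" and B :: "nat \<Rightarrow> nat \<Rightarrow> nat \<Rightarrow> real"
  assumes nn: "K \<ge> 0" "T \<ge> 0" "\<mu> \<ge> 0" "Q \<ge> 0"
    and E0: "\<And>m j. E m j \<ge> 0"
    and E1: "\<And>m j. m < D \<Longrightarrow> j < D \<Longrightarrow> E m j \<le> K * T"
    and E2: "\<And>m j. m < D \<Longrightarrow> j \<le> m \<Longrightarrow> E m j \<le> K * \<mu>"
    and B1: "\<And>k j. k < D \<Longrightarrow> j < D \<Longrightarrow> B (Suc 0) k j = E k j"
    and Bs: "\<And>l k j. k < D \<Longrightarrow> j < D \<Longrightarrow> B (Suc (Suc l)) k j \<le> Q * (\<Sum>m<D. B (Suc l) k m * E m j)"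
    and kj: "k < D" "j < D"
  shows "B (Suc l) k j \<le> (Q * D * K) ^ l * K * T ^ Suc l \<and>
         (j \<le> k + l \<longrightarrow> B (Suc l) k j \<le> (Q * D * K) ^ l * K * \<mu> * T ^ l)"
  using kj
proof (induction l arbitrary: j)
  case 0
  then show ?case using E1 E2 B1 by auto
next
  case (Suc l)
  let ?q = "(Q * D * K) ^ l * K"
  have q0: "?q \<ge> 0" using nn by auto
  have "B (Suc (Suc l)) k j \<le> Q * (\<Sum>m<D. B (Suc l) k m * E m j)"
    using Suc.prems by (rule Bs)
  also have "\<dots> \<le> Q * (\<Sum>m<D. (?q * T ^ Suc l) * (K * T))"
  proof (intro mult_left_mono sum_mono nn)
    fix m assume "m \<in> {..<D}"
    then have m: "m < D" by simp
    show "B (Suc l) k m * E m j \<le> (?q * T ^ Suc l) * (K * T)"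
      using Suc.IH[OF Suc.prems(1) m] E1[OF m Suc.prems(2)] E0 q0 nn
      by (meson mult_mono mult_nonneg_nonneg zero_le_power)
  qed
  also have "\<dots> = (Q * D * K) ^ Suc l * K * T ^ Suc (Suc l)" by simp
  finally have a: "B (Suc (Suc l)) k j \<le> (Q * D * K) ^ Suc l * K * T ^ Suc (Suc l)" .
  have b: "B (Suc (Suc l)) k j \<le> (Q * D * K) ^ Suc l * K * \<mu> * T ^ Suc l" if jk: "j \<le> k + Suc l"
  proof -
    have "B (Suc (Suc l)) k j \<le> Q * (\<Sum>m<D. B (Suc l) k m * E m j)"
      using Suc.prems by (rule Bs)
    also have "\<dots> \<le> Q * (\<Sum>m<D. ?q * K * \<mu> * T ^ Suc l)"
    proof (intro mult_left_mono sum_mono nn)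
      fix m assume "m \<in> {..<D}"
      then have m: "m < D" by simp
      note ih = Suc.IH[OF Suc.prems(1) m]
      show "B (Suc l) k m * E m j \<le> ?q * K * \<mu> * T ^ Suc l"
      proof (cases "j \<le> m")
        case True
        have "B (Suc l) k m * E m j \<le> (?q * T ^ Suc l) * (K * \<mu>)"
          using ih E2[OF m True] E0 q0 nn
          by (meson mult_mono mult_nonneg_nonneg zero_le_power)
        then show ?thesis by (simp add: mult_ac)
      next
        case False
        then have "m \<le> k + l" using jk by simp
        then have "B (Suc l) k m * E m j \<le> (?q * \<mu> * T ^ l) * (K * T)"
          using ih E1[OF m Suc.prems(2)] E0 q0 nn
          by (meson mult_mono mult_nonneg_nonneg zero_le_power)
        then show ?thesis by (simp add: mult_ac)
      qed
    qed
    also have "\<dots> = (Q * D * K) ^ Suc l * K * \<mu> * T ^ Suc l" by simp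
    finally show ?thesis .
  qed
  show ?case using a b by blast
qed

lemma word_sum_1:
  assumes J: "finite J" and I: "finite I"
  shows "word_sum J M I p (Suc 0) = (\<Sum>i\<in>I. entry_sum J (M i) powr p)"
proof -
  have "entry_sum J (matmul_on J (word_mat J M []) (M i)) = entry_sum J (M i)" for i
    unfolding entry_sum_def matmul_on_def using J
    by (intro sum.cong) (auto simp: if_distrib[of "\<lambda>a. a * _"] cong: if_cong)
  then show ?thesis using I by (simp add: word_sum_def sum_words_Suc)
qed

lemma word_sum_nonneg: "word_sum J M I p n \<ge> 0"
  unfolding word_sum_def by (intro sum_nonneg) auto

lemma bilinear_le_entry_sum:
  assumes J: "finite J" and c: "\<And>x. x \<in> J \<Longrightarrow> \<bar>c x\<bar> \<le> C" and u: "\<And>y. y \<in> J \<Longrightarrow> \<bar>u y\<bar> \<le> U"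
    and C: "C \<ge> 0"
  shows "\<bar>\<Sum>x\<in>J. \<Sum>y\<in>J. c x * A x y * u y\<bar> \<le> C * U * entry_sum J A"
proof -
  have "\<bar>\<Sum>x\<in>J. \<Sum>y\<in>J. c x * A x y * u y\<bar> \<le> (\<Sum>x\<in>J. \<Sum>y\<in>J. \<bar>c x * A x y * u y\<bar>)"
    by (intro order_trans[OF sum_abs] sum_mono sum_abs)
  also have "\<dots> \<le> (\<Sum>x\<in>J. \<Sum>y\<in>J. C * \<bar>A x y\<bar> * U)"
    unfolding abs_mult using c u C by (intro sum_mono mult_mono) auto
  also have "\<dots> = C * U * entry_sum J A"
    by (simp add: entry_sum_def sum_distrib_left mult_ac)
  finally show ?thesis .
qed

text \<open>In the adapted frame the matrix \<open>A\<close> has the entries \<open>co A m j\<close>. For the family \<open>M\<close> the properties of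
  the frame and of \<open>F\<close> give \<open>\<Sum>\<^sub>i \<bar>co (M i) m j\<bar>\<^sup>p F(u\<^sub>m) \<le> 2 C \<mu> F(u\<^sub>j) \<le> 4 C \<mu> F(u\<^sub>m)\<close> for \<open>j \<le> m\<close>, which is
  the hypothesis of \<open>triangular_gain\<close>.\<close>

lemma block_inequality_aux:
  fixes M :: "'i \<Rightarrow> 'j \<Rightarrow> 'j \<Rightarrow> real" and p C \<mu> :: real
  assumes J: "finite J" "card J = D" "D \<ge> 1" and p: "p > 0" and C: "C \<ge> 1" and I: "finite I"
    and mu: "\<mu> > 0"
    and frame: "adapted_frame p C J F u c"
    and low: "\<And>v x. x \<in> J \<Longrightarrow> \<bar>v x\<bar> powr p \<le> F v"
    and contr: "\<And>v. (\<Sum>i\<in>I. F (app_on J (M i) v)) \<le> 2 * \<mu> * F v"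
    and K: "K = 4 * C + C powr p"
    and Q: "Q = real D powr p"
  shows "word_sum J M I p D \<le>
    (real D * real D * C * (real D * real D)) powr p * (real D * real D * ((Q * D * K) ^ (D - 1) * K)) *
      (\<mu> * word_sum J M I p 1 ^ (D - 1))"
proof -
  note fr = frame[unfolded adapted_frame_def J(2)]
  have u1: "\<bar>u k x\<bar> \<le> 1" if "k < D" for k x using conjunct1[OF fr] that by simp
  have u2: "\<exists>x\<in>J. \<bar>u k x\<bar> = 1" if "k < D" for k using conjunct1[OF fr] that by simp
  have c: "\<bar>c k y\<bar> \<le> C" if "k < D" "y \<in> J" for k y using fr that by simp
  have uc: "(\<Sum>k<D. u k x * c k y) = (if x = y then 1 else 0)" if "x \<in> J" "y \<in> J" for x y
    using fr that by simp
  have cF: "\<bar>\<Sum>y\<in>J. c k y * v y\<bar> powr p * F (u k) \<le> C * F v"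
    if "k < D" "\<And>z. z \<notin> J \<Longrightarrow> v z = 0" for k and v :: "'j \<Rightarrow> real"
    using fr that by simp
  have mono: "F (u j) \<le> 2 * F (u k)" if "k < D" "j \<le> k" for k j
    using fr that by simp
  have Fu: "F (u k) > 0" if k: "k < D" for k
  proof -
    obtain x where "x \<in> J" "\<bar>u k x\<bar> = 1" using u2[OF k] by blast
    then show ?thesis using low[of x "u k"] by simp
  qed
  define co where "co A m j = (\<Sum>x\<in>J. \<Sum>y\<in>J. c m x * A x y * u j y)" for A m j
  define E where "E m j = (\<Sum>i\<in>I. \<bar>co (M i) m j\<bar> powr p)" for m j
  define B where "B l k j = (\<Sum>w\<in>words I l. \<bar>co (word_mat J M w) k j\<bar> powr p)" for l k j
  define T where "T = word_sum J M I p 1"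
  have T0: "T \<ge> 0" unfolding T_def by (rule word_sum_nonneg)
  have K0: "K \<ge> 0" "4 * C \<le> K" "C powr p \<le> K" using C by (auto simp: K)
  have Q0: "Q \<ge> 0" by (simp add: Q)
  have E0: "E m j \<ge> 0" for m j unfolding E_def by (intro sum_nonneg) auto
  have E1: "E m j \<le> K * T" if "m < D" "j < D" for m j
  proof -
    have "E m j \<le> (\<Sum>i\<in>I. C powr p * entry_sum J (M i) powr p)"
      unfolding E_def
    proof (rule sum_mono)
      fix i
      have "\<bar>co (M i) m j\<bar> \<le> C * 1 * entry_sum J (M i)"
        unfolding co_def using J c u1 that C by (intro bilinear_le_entry_sum) auto
      then have "\<bar>co (M i) m j\<bar> powr p \<le> (C * entry_sum J (M i)) powr p"
        using p by (intro powr_mono2) auto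
      then show "\<bar>co (M i) m j\<bar> powr p \<le> C powr p * entry_sum J (M i) powr p"
        using C entry_sum_nonneg by (simp add: powr_mult)
    qed
    also have "\<dots> = C powr p * T"
      using J I by (simp add: T_def word_sum_1 sum_distrib_left)
    also have "\<dots> \<le> K * T" using K0 T0 by (intro mult_right_mono) auto
    finally show ?thesis .
  qed
  have E2: "E m j \<le> K * \<mu>" if "m < D" "j \<le> m" for m j
  proof -
    have co_app: "co A m j = (\<Sum>x\<in>J. c m x * app_on J A (u j) x)" for A
      unfolding co_def by (intro sum.cong) (auto simp: app_on_def sum_distrib_left mult_ac)
    have "E m j * F (u m) = (\<Sum>i\<in>I. \<bar>co (M i) m j\<bar> powr p * F (u m))"
      by (simp add: E_def sum_distrib_right)
    also have "\<dots> \<le> (\<Sum>i\<in>I. C * F (app_on J (M i) (u j)))"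
      unfolding co_app by (intro sum_mono cF that) (auto simp: app_on_def)
    also have "\<dots> = C * (\<Sum>i\<in>I. F (app_on J (M i) (u j)))" by (simp add: sum_distrib_left)
    also have "\<dots> \<le> C * (2 * \<mu> * F (u j))" using C contr by (intro mult_left_mono) auto
    also have "\<dots> \<le> C * (2 * \<mu> * (2 * F (u m)))"
      using C mu mono[OF that] by (intro mult_left_mono) auto
    also have "\<dots> = (4 * C * \<mu>) * F (u m)" by simp
    finally have "E m j \<le> 4 * C * \<mu>" using Fu[OF that(1)] by simp
    also have "\<dots> \<le> K * \<mu>" using K0 mu by (intro mult_right_mono) auto
    finally show ?thesis .
  qed
  have B1: "B (Suc 0) k j = E k j" for k j
  proof -
    have "co (matmul_on J (word_mat J M []) (M i)) k j = co (M i) k j" for i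
      unfolding co_def matmul_on_def using J(1)
      by (intro sum.cong) (auto simp: if_distrib[of "\<lambda>a. a * _"] cong: if_cong)
    then show ?thesis using I by (simp add: B_def E_def sum_words_Suc)
  qed
  \<comment> \<open>The functionals are dual to the frame: \<open>\<Sum>\<^sub>m u\<^sub>m z \<cdot> c\<^sub>m z'\<close> is 1 if \<open>z = z'\<close> and 0 otherwise. Inserting this between the factors gives multiplicativity.\<close>
  have insert: "co (matmul_on J A A') k j = (\<Sum>m<D. co A k m * co A' m j)" for A A' k j
  proof -
    have "(\<Sum>m<D. co A k m * co A' m j) =
       (\<Sum>m<D. (\<Sum>x\<in>J. \<Sum>z\<in>J. c k x * A x z * u m z) * (\<Sum>z'\<in>J. \<Sum>y\<in>J. c m z' * A' z' y * u j y))"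
      by (simp add: co_def)
    also have "\<dots> = (\<Sum>m<D. \<Sum>x\<in>J. \<Sum>z\<in>J. \<Sum>z'\<in>J. \<Sum>y\<in>J. (c k x * A x z * u m z) * (c m z' * A' z' y * u j y))"
      by (simp only: sum_distrib_right) (simp only: sum_distrib_left)
    also have "\<dots> = (\<Sum>x\<in>J. \<Sum>z\<in>J. \<Sum>z'\<in>J. \<Sum>y\<in>J. \<Sum>m<D. (c k x * A x z * u m z) * (c m z' * A' z' y * u j y))"
      by (subst sum.swap, intro sum.cong refl, subst sum.swap, intro sum.cong refl,
          subst sum.swap, intro sum.cong refl, subst sum.swap, intro sum.cong refl)
    also have "\<dots> = (\<Sum>x\<in>J. \<Sum>z\<in>J. \<Sum>z'\<in>J. \<Sum>y\<in>J. (c k x * A x z * A' z' y * u j y) * (\<Sum>m<D. u m z * c m z'))"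
      by (simp add: sum_distrib_left mult_ac)
    also have "\<dots> = (\<Sum>x\<in>J. \<Sum>z\<in>J. \<Sum>z'\<in>J. \<Sum>y\<in>J. if z = z' then c k x * A x z * A' z y * u j y else 0)"
      by (intro sum.cong refl) (simp add: uc)
    also have "\<dots> = (\<Sum>x\<in>J. \<Sum>z\<in>J. \<Sum>z'\<in>J. if z = z' then \<Sum>y\<in>J. c k x * A x z * A' z y * u j y else 0)"
      by (intro sum.cong refl) simp
    also have "\<dots> = (\<Sum>x\<in>J. \<Sum>z\<in>J. \<Sum>y\<in>J. c k x * A x z * A' z y * u j y)"
      using J(1) by simp
    also have "\<dots> = (\<Sum>x\<in>J. \<Sum>y\<in>J. \<Sum>z\<in>J. c k x * A x z * A' z y * u j y)"
      by (intro sum.cong refl sum.swap)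
    also have "\<dots> = co (matmul_on J A A') k j"
      by (simp add: co_def matmul_on_def sum_distrib_left sum_distrib_right mult_ac)
    finally show ?thesis ..
  qed
  have Bs: "B (Suc (Suc l)) k j \<le> Q * (\<Sum>m<D. B (Suc l) k m * E m j)" for l k j
  proof -
    have "\<bar>co (word_mat J M (i # w)) k j\<bar> powr p
        \<le> Q * (\<Sum>m<D. \<bar>co (word_mat J M w) k m\<bar> powr p * \<bar>co (M i) m j\<bar> powr p)" for i w
    proof -
      have "\<bar>co (word_mat J M (i # w)) k j\<bar> \<le> (\<Sum>m<D. \<bar>co (word_mat J M w) k m * co (M i) m j\<bar>)"
        by (simp add: insert sum_abs)
      then have "\<bar>co (word_mat J M (i # w)) k j\<bar> powr p \<le>
          (\<Sum>m<D. \<bar>co (word_mat J M w) k m * co (M i) m j\<bar>) powr p"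
        using p by (intro powr_mono2) auto
      also have "\<dots> \<le> Q * (\<Sum>m<D. \<bar>co (word_mat J M w) k m * co (M i) m j\<bar> powr p)"
        using powr_sum_le[of "{..<D}" p "\<lambda>m. \<bar>co (word_mat J M w) k m * co (M i) m j\<bar>"] p by (simp add: Q)
      finally show ?thesis by (simp add: abs_mult powr_mult)
    qed
    then have "B (Suc (Suc l)) k j \<le> (\<Sum>i\<in>I. \<Sum>w\<in>words I (Suc l).
        Q * (\<Sum>m<D. \<bar>co (word_mat J M w) k m\<bar> powr p * \<bar>co (M i) m j\<bar> powr p))"
      unfolding B_def sum_words_Suc[OF I, of _ "Suc l"] by (intro sum_mono)
    also have "\<dots> = Q * (\<Sum>i\<in>I. \<Sum>w\<in>words I (Suc l). \<Sum>m<D. \<bar>co (word_mat J M w) k m\<bar> powr p * \<bar>co (M i) m j\<bar> powr p)"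
      by (simp add: sum_distrib_left)
    also have "(\<Sum>i\<in>I. \<Sum>w\<in>words I (Suc l). \<Sum>m<D. \<bar>co (word_mat J M w) k m\<bar> powr p * \<bar>co (M i) m j\<bar> powr p)
       = (\<Sum>i\<in>I. \<Sum>m<D. \<Sum>w\<in>words I (Suc l). \<bar>co (word_mat J M w) k m\<bar> powr p * \<bar>co (M i) m j\<bar> powr p)"
      by (intro sum.cong refl sum.swap)
    also have "\<dots> = (\<Sum>m<D. \<Sum>i\<in>I. \<Sum>w\<in>words I (Suc l). \<bar>co (word_mat J M w) k m\<bar> powr p * \<bar>co (M i) m j\<bar> powr p)"
      by (rule sum.swap)
    also have "\<dots> = (\<Sum>m<D. B (Suc l) k m * E m j)"
      unfolding B_def E_def sum_product by (intro sum.cong refl sum.swap)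
    finally show ?thesis .
  qed
  define R where "R = (Q * D * K) ^ (D - 1) * K * \<mu> * T ^ (D - 1)"
  have BD: "B D k j \<le> R" if "k < D" "j < D" for k j
    using triangular_gain[of K T \<mu> Q E D B k j "D - 1", OF K0(1) T0 less_imp_le[OF mu] Q0 E0 E1 E2 B1 Bs] that J(3)
    by (simp add: R_def)
  have entry: "entry_sum J (word_mat J M w) powr p \<le>
      (real D * real D * C * (real D * real D)) powr p * (\<Sum>k<D. \<Sum>j<D. \<bar>co (word_mat J M w) k j\<bar> powr p)" for w
  proof -
    define W where "W = word_mat J M w"
    \<comment> \<open>Changing back from the frame to the original coordinates, by inserting the identity on both sides of \<open>W\<close>.\<close>
    have ent: "\<bar>W x y\<bar> \<le> C * (\<Sum>k<D. \<Sum>j<D. \<bar>co W k j\<bar>)" if xy: "x \<in> J" "y \<in> J" for x y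
    proof -
      have "(\<Sum>k<D. \<Sum>j<D. u k x * co W k j * c j y) =
         (\<Sum>k<D. \<Sum>j<D. \<Sum>x'\<in>J. \<Sum>y'\<in>J. u k x * c k x' * W x' y' * (u j y' * c j y))"
        by (simp add: co_def sum_distrib_left sum_distrib_right mult_ac)
      also have "\<dots> = (\<Sum>x'\<in>J. \<Sum>y'\<in>J. \<Sum>k<D. \<Sum>j<D. u k x * c k x' * W x' y' * (u j y' * c j y))"
      proof -
        have "(\<Sum>k<D. \<Sum>j<D. \<Sum>x'\<in>J. \<Sum>y'\<in>J. g k j x' y') = (\<Sum>x'\<in>J. \<Sum>y'\<in>J. \<Sum>k<D. \<Sum>j<D. g k j x' y')"
          for g :: "nat \<Rightarrow> nat \<Rightarrow> 'j \<Rightarrow> 'j \<Rightarrow> real"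
        proof -
          have "(\<Sum>k<D. \<Sum>j<D. \<Sum>x'\<in>J. \<Sum>y'\<in>J. g k j x' y') = (\<Sum>k<D. \<Sum>x'\<in>J. \<Sum>j<D. \<Sum>y'\<in>J. g k j x' y')"
            by (intro sum.cong refl sum.swap)
          also have "\<dots> = (\<Sum>k<D. \<Sum>x'\<in>J. \<Sum>y'\<in>J. \<Sum>j<D. g k j x' y')"
            by (intro sum.cong refl sum.swap)
          also have "\<dots> = (\<Sum>x'\<in>J. \<Sum>k<D. \<Sum>y'\<in>J. \<Sum>j<D. g k j x' y')"
            by (rule sum.swap)
          also have "\<dots> = (\<Sum>x'\<in>J. \<Sum>y'\<in>J. \<Sum>k<D. \<Sum>j<D. g k j x' y')"
            by (intro sum.cong refl sum.swap)
          finally show ?thesis .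
        qed
        then show ?thesis .
      qed
      also have "\<dots> = (\<Sum>x'\<in>J. \<Sum>y'\<in>J. (\<Sum>k<D. u k x * c k x') * W x' y' * (\<Sum>j<D. u j y' * c j y))"
        by (simp add: sum_distrib_left sum_distrib_right mult_ac)
      also have "\<dots> = (\<Sum>x'\<in>J. \<Sum>y'\<in>J. if y' = y then (if x = x' then W x' y' else 0) else 0)"
        by (intro sum.cong refl) (simp add: uc xy)
      also have "\<dots> = W x y" using J(1) xy by simp
      finally have "W x y = (\<Sum>k<D. \<Sum>j<D. u k x * co W k j * c j y)" ..
      then have "\<bar>W x y\<bar> \<le> (\<Sum>k<D. \<Sum>j<D. \<bar>u k x * co W k j * c j y\<bar>)"
        by (simp only:) (intro order_trans[OF sum_abs] sum_mono sum_abs)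
      also have "\<dots> \<le> (\<Sum>k<D. \<Sum>j<D. 1 * \<bar>co W k j\<bar> * C)"
        unfolding abs_mult using u1 c xy C by (intro sum_mono mult_mono) auto
      also have "\<dots> = C * (\<Sum>k<D. \<Sum>j<D. \<bar>co W k j\<bar>)" by (simp add: sum_distrib_left mult_ac)
      finally show ?thesis .
    qed
    have "entry_sum J W \<le> (\<Sum>x\<in>J. \<Sum>y\<in>J. C * (\<Sum>k<D. \<Sum>j<D. \<bar>co W k j\<bar>))"
      unfolding entry_sum_def by (intro sum_mono ent)
    also have "\<dots> = real D * real D * C * (\<Sum>(k, j)\<in>{..<D} \<times> {..<D}. \<bar>co W k j\<bar>)"
      using J(2) by (simp add: sum.cartesian_product)
    finally have "entry_sum J W powr p \<le> (real D * real D * C * (\<Sum>(k, j)\<in>{..<D} \<times> {..<D}. \<bar>co W k j\<bar>)) powr p"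
      using p entry_sum_nonneg by (intro powr_mono2) auto
    also have "\<dots> = (real D * real D * C) powr p * (\<Sum>z\<in>{..<D} \<times> {..<D}. \<bar>co W (fst z) (snd z)\<bar>) powr p"
      using C by (simp add: powr_mult sum_nonneg split_def)
    also have "\<dots> \<le> (real D * real D * C) powr p *
        (real (card ({..<D} \<times> {..<D})) powr p * (\<Sum>z\<in>{..<D} \<times> {..<D}. \<bar>co W (fst z) (snd z)\<bar> powr p))"
      using p by (intro mult_left_mono powr_sum_le) auto
    also have "\<dots> = (real D * real D * C * (real D * real D)) powr p * (\<Sum>k<D. \<Sum>j<D. \<bar>co W k j\<bar> powr p)"
      using C by (simp add: powr_mult sum.cartesian_product split_def card_cartesian_product)
    finally show ?thesis by (simp add: W_def)
  qed
  have "word_sum J M I p D \<le> (\<Sum>w\<in>words I D. (real D * real D * C * (real D * real D)) powr p *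
      (\<Sum>k<D. \<Sum>j<D. \<bar>co (word_mat J M w) k j\<bar> powr p))"
    unfolding word_sum_def by (intro sum_mono entry)
  also have "\<dots> = (real D * real D * C * (real D * real D)) powr p * (\<Sum>k<D. \<Sum>j<D. B D k j)"
  proof -
    have "(\<Sum>w\<in>words I D. \<Sum>k<D. \<Sum>j<D. \<bar>co (word_mat J M w) k j\<bar> powr p) =
        (\<Sum>k<D. \<Sum>w\<in>words I D. \<Sum>j<D. \<bar>co (word_mat J M w) k j\<bar> powr p)"
      by (rule sum.swap)
    also have "\<dots> = (\<Sum>k<D. \<Sum>j<D. B D k j)"
      unfolding B_def by (intro sum.cong refl sum.swap)
    finally show ?thesis by (simp add: sum_distrib_left[symmetric])
  qed
  also have "\<dots> \<le> (real D * real D * C * (real D * real D)) powr p * (\<Sum>k<D. \<Sum>j<D. R)"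
    using BD by (intro mult_left_mono sum_mono) auto
  finally show ?thesis by (simp add: R_def T_def mult_ac)
qed

text \<open>The constant is uniform over all families and all \<open>L\<close>. The choice \<open>\<mu> = T\<^sub>L\<^sup>1\<^sup>/\<^sup>L\<close> is the smallest one that
  \<open>growth_functional\<close> admits.\<close>

lemma block_inequality:
  assumes J: "finite (J :: 'j set)" "J \<noteq> {}" and p: "p > 0"
  shows "\<exists>C>0. \<forall>I (M :: 'i \<Rightarrow> 'j \<Rightarrow> 'j \<Rightarrow> real) L. finite I \<longrightarrow> L \<ge> 1 \<longrightarrow> word_sum J M I p L > 0 \<longrightarrow>
    word_sum J M I p (card J) \<le> C * (word_sum J M I p L powr (1 / real L) * word_sum J M I p 1 ^ (card J - 1))"
proof -
  define D where "D = card J"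
  have D: "D \<ge> 1" using J by (simp add: D_def Suc_le_eq card_gt_0_iff)
  obtain C where C: "C \<ge> 1" and fr: "\<And>(X :: 'j set) F. finite X \<Longrightarrow> card X = D \<Longrightarrow> gauge_on p X F \<Longrightarrow>
     (\<exists>u c. adapted_frame p C X F u c)"
    using adapted_frame_exists[OF p, of D] by blast
  define K where "K = 4 * C + C powr p"
  define Q where "Q = real D powr p"
  define C' where "C' = (real D * real D * C * (real D * real D)) powr p * (real D * real D * ((Q * D * K) ^ (D - 1) * K))"
  have "K > 0" using C by (simp add: K_def add_pos_nonneg)
  then have "C' > 0" using C D by (simp add: C'_def Q_def)
  moreover have "word_sum J M I p D \<le> C' * (word_sum J M I p L powr (1 / real L) * word_sum J M I p 1 ^ (D - 1))"
    if I: "finite I" and L: "L \<ge> 1" and pos: "word_sum J M I p L > 0"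
    for I and M :: "'i \<Rightarrow> 'j \<Rightarrow> 'j \<Rightarrow> real" and L
  proof -
    define \<mu> where "\<mu> = word_sum J M I p L powr (1 / real L)"
    have mu: "\<mu> > 0" using pos by (simp add: \<mu>_def)
    have "\<mu> ^ L = word_sum J M I p L"
      using pos L mu by (simp add: \<mu>_def powr_realpow[symmetric] powr_powr)
    then have le: "word_sum J M I p L \<le> \<mu> ^ L" by simp
    obtain F :: "('j \<Rightarrow> real) \<Rightarrow> real" where F:
      "\<And>a v. F (\<lambda>x. a * v x) = \<bar>a\<bar> powr p * F v"
      "\<And>v w. F (\<lambda>x. v x + w x) \<le> 2 powr p * (F v + F w)"
      "\<And>v x. x \<in> J \<Longrightarrow> \<bar>v x\<bar> powr p \<le> F v"
      "\<And>v. (\<Sum>i\<in>I. F (app_on J (M i) v)) \<le> 2 * \<mu> * F v"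
      by (rule growth_functional[OF J(1) I p mu L le]) (rule that)
    have "gauge_on p J F" using F by (simp add: gauge_on_def)
    then obtain u c where "adapted_frame p C J F u c" using fr J(1) D_def by blast
    from block_inequality_aux[OF J(1) D_def[symmetric] D p C I mu this F(3,4) K_def Q_def]
    show ?thesis unfolding C'_def \<mu>_def .
  qed
  ultimately show ?thesis unfolding D_def by blast
qed

section \<open>Continuity for powers of a matrix norm\<close>

text \<open>Upper bounds \<open>P \<le> (1/n) ln S\<^sub>n\<close> come from submultiplicativity. For the lower bounds, the block
  inequality is applied to the products of length \<open>n\<close>, and \<open>L\<close> tends to infinity: then
  \<open>S\<^sub>n\<^sub>L\<^sup>1\<^sup>/\<^sup>L\<close> tends to \<open>exp (n P)\<close>. Both bounds are continuous and converge to \<open>P\<close>.\<close>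

lemma cocycle_pressure_continuous:
  fixes N :: "'a :: topological_space \<Rightarrow> 'i \<Rightarrow> 'j \<Rightarrow> 'j \<Rightarrow> real"
  assumes J: "finite J" "J \<noteq> {}" and I: "finite I" and p: "p > 0"
    and cont: "\<And>i x y. i \<in> I \<Longrightarrow> x \<in> J \<Longrightarrow> y \<in> J \<Longrightarrow> continuous_on X (\<lambda>A. N A i x y)"
    and low: "\<And>A. A \<in> X \<Longrightarrow> \<exists>B. \<forall>n\<ge>1. exp (- B * real n) \<le> word_sum J (N A) I p n"
    and lim: "\<And>A. A \<in> X \<Longrightarrow> (\<lambda>n. ln (word_sum J (N A) I p n) / real n) \<longlonglongrightarrow> P A"
  shows "continuous_on X P"
proof -
  define S where "S n A = word_sum J (N A) I p n" for n A
  define D where "D = card J"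
  have D: "D \<ge> 1" using J by (simp add: D_def Suc_le_eq card_gt_0_iff)
  have pos: "S n A > 0" if "A \<in> X" "n \<ge> 1" for n A
    using low[OF that(1)] that(2) unfolding S_def by (meson exp_gt_zero less_le_trans)
  have mat_cont: "continuous_on X (\<lambda>A. word_mat J (N A) w x y)" if "set w \<subseteq> I" "x \<in> J" "y \<in> J" for w x y
    using that
  proof (induction w arbitrary: x y)
    case (Cons i w)
    then show ?case by (auto simp: matmul_on_def intro!: continuous_on_sum continuous_on_mult cont)
  qed (auto intro: continuous_on_const)
  have S_cont: "continuous_on X (S n)" for n
    unfolding S_def word_sum_def entry_sum_def
    using p by (intro continuous_on_sum continuous_on_powr' continuous_on_const continuous_on_rabs mat_cont)
      (auto simp: words_def intro: sum_nonneg)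
  have P_le: "P A \<le> ln (S n A) / real n" if A: "A \<in> X" and n: "n \<ge> 1" for A n
  proof -
    obtain B where B: "\<And>n. n \<ge> 1 \<Longrightarrow> exp (- B * real n) \<le> S n A" using low[OF A] unfolding S_def by blast
    have low': "- B * real n \<le> ln (S n A)" if "n \<ge> 1" for n
      using B[OF that] pos[OF A that] by (metis ln_exp ln_le_cancel_iff exp_gt_zero)
    have sub: "ln (S (m + n) A) \<le> ln (S m A) + ln (S n A)" if "m \<ge> 1" "n \<ge> 1" for m n
    proof -
      have "ln (S (m + n) A) \<le> ln (S m A * S n A)"
        using word_sum_submult[OF J(1) I p] pos[OF A] that by (subst ln_le_cancel_iff) (auto simp: S_def)
      then show ?thesis using pos[OF A that(1)] pos[OF A that(2)] by (simp add: ln_mult)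
    qed
    obtain l where l: "(\<lambda>n. ln (S n A) / real n) \<longlonglongrightarrow> l" "\<And>n. n \<ge> 1 \<Longrightarrow> l \<le> ln (S n A) / real n"
      using fekete[of "\<lambda>n. ln (S n A)" B] sub low' by blast
    then have "l = P A" using lim[OF A] LIMSEQ_unique unfolding S_def by blast
    then show ?thesis using l(2) n by blast
  qed
  have lim_mult: "(\<lambda>n. ln (S (c * n) A) / real (c * n)) \<longlonglongrightarrow> P A" if A: "A \<in> X" and c: "c \<ge> 1" for A c
    using LIMSEQ_subseq_LIMSEQ[OF lim[OF A], of "\<lambda>n. c * n"] c by (simp add: S_def o_def strict_mono_def)
  obtain C where C: "C > 0" and block: "\<And>I (M :: 'i list \<Rightarrow> 'j \<Rightarrow> 'j \<Rightarrow> real) L. finite I \<Longrightarrow> L \<ge> 1 \<Longrightarrow>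
      word_sum J M I p L > 0 \<Longrightarrow>
      word_sum J M I p D \<le> C * (word_sum J M I p L powr (1 / real L) * word_sum J M I p 1 ^ (D - 1))"
    using block_inequality[OF J p, where ?'i = "'i list"] unfolding D_def by blast
  define h where "h n A = (ln (S (D * n) A) - ln C - real (D - 1) * ln (S n A)) / real n" for n A
  have h_le: "h n A \<le> P A" if A: "A \<in> X" and n: "n \<ge> 1" for n A
  proof -
    have le: "ln (S (D * n) A) - ln C - real (D - 1) * ln (S n A) \<le> real n * (ln (S (n * L) A) / real (n * L))"
      if L: "L \<ge> 1" for L
    proof -
      have nL: "S (n * L) A > 0" "S n A > 0" "S (D * n) A > 0" using pos[OF A] n L D by auto
      have "S (D * n) A \<le> C * (S (n * L) A powr (1 / real L) * S n A ^ (D - 1))"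
        using block[of "words I n" L "word_mat J (N A)"] I L nL(1)
        by (simp add: word_sum_blocks[OF J(1) I] S_def mult.commute)
      then have "ln (S (D * n) A) \<le> ln (C * (S (n * L) A powr (1 / real L) * S n A ^ (D - 1)))"
        using nL C by (subst ln_le_cancel_iff) auto
      also have "\<dots> = ln C + (1 / real L * ln (S (n * L) A) + real (D - 1) * ln (S n A))"
        using nL C by (simp add: ln_mult ln_powr ln_realpow)
      finally show ?thesis using n L by simp
    qed
    have "(\<lambda>L. real n * (ln (S (n * L) A) / real (n * L))) \<longlonglongrightarrow> real n * P A"
      by (intro tendsto_mult tendsto_const lim_mult A n)
    then have "ln (S (D * n) A) - ln C - real (D - 1) * ln (S n A) \<le> real n * P A"
      by (rule tendsto_lowerbound) (use le in \<open>auto intro: eventually_sequentiallyI[of 1]\<close>)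
    then show ?thesis using n by (simp add: h_def field_simps)
  qed
  have h_lim: "(\<lambda>n. h n A) \<longlonglongrightarrow> P A" if A: "A \<in> X" for A
  proof -
    have "(\<lambda>n. real D * (ln (S (D * n) A) / real (D * n)) - ln C / real n - real (D - 1) * (ln (S n A) / real n))
        \<longlonglongrightarrow> real D * P A - 0 - real (D - 1) * P A"
      using lim[OF A] unfolding S_def[symmetric]
      by (intro tendsto_diff tendsto_mult tendsto_const lim_mult A D lim_const_over_n)
    moreover have "real D * P A - 0 - real (D - 1) * P A = P A" using D by (simp add: algebra_simps of_nat_diff)
    moreover have "real D * (ln (S (D * n) A) / real (D * n)) - ln C / real n - real (D - 1) * (ln (S n A) / real n) = h n A" for n
      using D by (cases "n = 0") (simp_all add: h_def diff_divide_distrib)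
    ultimately show ?thesis by simp
  qed
  show ?thesis
  proof (rule continuous_on_sandwich[of X "\<lambda>n A. ln (S n A) / real n" h P])
    fix n :: nat assume n: "n \<ge> 1"
    have nD: "D * n \<ge> 1" using n D by simp
    show "continuous_on X (\<lambda>A. ln (S n A) / real n)"
      using pos n by (intro continuous_intros S_cont) force+
    show "continuous_on X (h n)"
      unfolding h_def using pos n nD by (intro continuous_intros S_cont ballI less_imp_neq[symmetric]) simp_all
  qed (use h_le P_le h_lim lim in \<open>auto simp: S_def\<close>)
qed

section \<open>Compound matrices and their Kronecker products\<close>

text \<open>Rows \<open>f 0, \<dots>, f (k-1)\<close> and columns \<open>g 0, \<dots>, g (k-1)\<close>, in any order and possibly with repetitions. Using
  all index maps instead of increasing ones costs only factors \<open>k!\<close> and needs no order on the index type.\<close>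

definition minor :: "nat \<Rightarrow> (nat \<Rightarrow> 'd) \<Rightarrow> (nat \<Rightarrow> 'd) \<Rightarrow> real^'d^'d \<Rightarrow> real" where
  "minor k f g B = (\<Sum>\<sigma> | \<sigma> permutes {..<k}. of_int (sign \<sigma>) * (\<Prod>i<k. B $ f i $ g (\<sigma> i)))"

definition index_maps :: "nat \<Rightarrow> (nat \<Rightarrow> 'd) set" where
  "index_maps k = (\<Pi>\<^sub>E i\<in>{..<k}. UNIV)"

lemma finite_index_maps [simp]: "finite (index_maps k :: (nat \<Rightarrow> 'd::finite) set)"
  unfolding index_maps_def by (intro finite_PiE) auto

lemma index_maps_nonempty [simp]: "index_maps k \<noteq> {}"
  by (simp add: index_maps_def PiE_eq_empty_iff)

lemma finite_permutes [simp]: "finite {\<sigma>. \<sigma> permutes {..<k::nat}}"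
  by (simp add: finite_permutations)

lemma minor_cong:
  assumes "\<And>i. i < k \<Longrightarrow> f i = f' i" "\<And>i. i < k \<Longrightarrow> g i = g' i"
  shows "minor k f g B = minor k f' g' B"
  unfolding minor_def
proof (intro sum.cong refl arg_cong2[of _ _ _ _ "(*)"] prod.cong)
  fix \<sigma> i assume "\<sigma> \<in> {\<sigma>. \<sigma> permutes {..<k}}" "i \<in> {..<k}"
  then have "i < k" "\<sigma> i < k" using permutes_in_image[of \<sigma> "{..<k}" i] by auto
  then show "B $ f i $ g (\<sigma> i) = B $ f' i $ g' (\<sigma> i)" using assms by simp
qed

lemma minor_permute_rows:
  assumes r: "\<rho> permutes {..<k}"
  shows "minor k (\<lambda>i. f (\<rho> i)) g B = of_int (sign \<rho>) * minor k f g B"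
proof -
  have "minor k (\<lambda>i. f (\<rho> i)) g B =
      (\<Sum>\<sigma> | \<sigma> permutes {..<k}. of_int (sign (\<sigma> \<circ> \<rho>)) * (\<Prod>i<k. B $ f (\<rho> i) $ g ((\<sigma> \<circ> \<rho>) i)))"
    unfolding minor_def by (rule sum_permutations_compose_right[OF r])
  also have "\<dots> = (\<Sum>\<sigma> | \<sigma> permutes {..<k}. of_int (sign \<rho>) * (of_int (sign \<sigma>) * (\<Prod>i<k. B $ f i $ g (\<sigma> i))))"
  proof (intro sum.cong refl)
    fix \<sigma> assume "\<sigma> \<in> {\<sigma>. \<sigma> permutes {..<k}}"
    then have "sign (\<sigma> \<circ> \<rho>) = sign \<sigma> * sign \<rho>"
      using r by (intro sign_compose) (auto intro: permutes_imp_permutation)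
    moreover have "(\<Prod>i<k. B $ f (\<rho> i) $ g ((\<sigma> \<circ> \<rho>) i)) = (\<Prod>i<k. B $ f i $ g (\<sigma> i))"
      using prod.permute[OF r, of "\<lambda>i. B $ f i $ g (\<sigma> i)"] by (simp add: o_def)
    ultimately show "of_int (sign (\<sigma> \<circ> \<rho>)) * (\<Prod>i<k. B $ f (\<rho> i) $ g ((\<sigma> \<circ> \<rho>) i)) =
        of_int (sign \<rho>) * (of_int (sign \<sigma>) * (\<Prod>i<k. B $ f i $ g (\<sigma> i)))" by simp
  qed
  also have "\<dots> = of_int (sign \<rho>) * minor k f g B" by (simp add: minor_def sum_distrib_left)
  finally show ?thesis .
qed

lemma minor_transpose: "minor k f g (transpose B) = minor k g f B"
proof -
  have "minor k f g (transpose B) = (\<Sum>\<sigma> | \<sigma> permutes {..<k}. of_int (sign \<sigma>) * (\<Prod>i<k. B $ g (\<sigma> i) $ f i))"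
    unfolding minor_def transpose_def by simp
  also have "\<dots> =
     (\<Sum>\<sigma> | \<sigma> permutes {..<k}. of_int (sign (inv \<sigma>)) * (\<Prod>i<k. B $ g (inv \<sigma> i) $ f i))"
    by (rule sum_permutations_inverse)
  also have "\<dots> = minor k g f B"
    unfolding minor_def
  proof (intro sum.cong refl)
    fix \<sigma> assume "\<sigma> \<in> {\<sigma>. \<sigma> permutes {..<k}}"
    then have s: "\<sigma> permutes {..<k}" by simp
    have "(\<Prod>i<k. B $ g (inv \<sigma> i) $ f i) = (\<Prod>i<k. B $ g i $ f (\<sigma> i))"
      using prod.permute[OF s, of "\<lambda>i. B $ g (inv \<sigma> i) $ f i"] by (simp add: o_def permutes_inverses[OF s])
    moreover have "sign (inv \<sigma>) = sign \<sigma>"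
      using s by (intro sign_inverse) (auto intro: permutes_imp_permutation)
    ultimately show "of_int (sign (inv \<sigma>)) * (\<Prod>i<k. B $ g (inv \<sigma> i) $ f i) =
        of_int (sign \<sigma>) * (\<Prod>i<k. B $ g i $ f (\<sigma> i))" by simp
  qed
  finally show ?thesis .
qed

lemma minor_not_inj:
  assumes "\<not> inj_on f {..<k}"
  shows "minor k f g B = 0"
proof -
  obtain a b where ab: "a < k" "b < k" "a \<noteq> b" "f a = f b"
    using assms by (auto simp: inj_on_def)
  let ?r = "Transposition.transpose a b"
  have r: "?r permutes {..<k}" using ab by (intro permutes_swap_id) auto
  have "(\<lambda>i. f (?r i)) = f" using ab by (auto simp: fun_eq_iff Transposition.transpose_def)
  then have "minor k f g B = - minor k f g B"
    using minor_permute_rows[OF r, of f g B] ab by (simp add: sign_swap_id)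
  then show ?thesis by simp
qed

text \<open>Expanding the first minor over \<open>\<sigma>\<close> and substituting \<open>g \<circ> \<sigma>\<close> for \<open>g\<close> absorbs the sign into the second minor, so
  each of the \<open>k!\<close> permutations contributes the same sum, which is the minor of the product expanded
  over the inner indices.\<close>

lemma cauchy_binet:
  fixes A B :: "real^'d^'d"
  shows "(\<Sum>g\<in>index_maps k. minor k f g A * minor k g h B) = fact k * minor k f h (A ** B)"
proof -
  have "(\<Sum>g\<in>index_maps k. minor k f g A * minor k g h B) =
     (\<Sum>\<sigma> | \<sigma> permutes {..<k}. \<Sum>g\<in>index_maps k. of_int (sign \<sigma>) * (\<Prod>i<k. A $ f i $ g (\<sigma> i)) * minor k g h B)"
    unfolding minor_def[of k f] sum_distrib_right by (rule sum.swap)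
  also have "\<dots> = (\<Sum>\<sigma> | \<sigma> permutes {..<k}. \<Sum>g\<in>index_maps k. (\<Prod>i<k. A $ f i $ g i) * minor k g h B)"
  proof (rule sum.cong[OF refl])
    fix \<sigma> assume "\<sigma> \<in> {\<sigma>. \<sigma> permutes {..<k}}"
    then have s: "\<sigma> permutes {..<k}" by simp
    have si: "inv \<sigma> permutes {..<k}" using s by (rule permutes_inv)
    have lt: "\<sigma> i < k \<longleftrightarrow> i < k" "inv \<sigma> i < k \<longleftrightarrow> i < k" for i
      using permutes_in_image[OF s, of i] permutes_in_image[OF si, of i] by auto
    define i where "i g = restrict (\<lambda>x. g (inv \<sigma> x)) {..<k}" for g :: "nat \<Rightarrow> 'd"
    define j where "j g = restrict (\<lambda>x. g (\<sigma> x)) {..<k}" for g :: "nat \<Rightarrow> 'd"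
    have ij: "i (j g) = g" "j (i g) = g" if "g \<in> index_maps k" for g
      using that by (auto simp: i_def j_def index_maps_def fun_eq_iff permutes_inverses[OF s] lt PiE_def extensional_def)
    have mem: "i g \<in> index_maps k" "j g \<in> index_maps k" for g
      by (auto simp: i_def j_def index_maps_def)
    have val: "(\<Prod>x<k. A $ f x $ j g x) * minor k (j g) h B
        = of_int (sign \<sigma>) * (\<Prod>x<k. A $ f x $ g (\<sigma> x)) * minor k g h B" for g
    proof -
      have "minor k (j g) h B = minor k (\<lambda>x. g (\<sigma> x)) h B"
        by (intro minor_cong) (auto simp: j_def)
      also have "\<dots> = of_int (sign \<sigma>) * minor k g h B" by (rule minor_permute_rows[OF s])
      finally show ?thesis by (simp add: j_def)
    qed
    show "(\<Sum>g\<in>index_maps k. of_int (sign \<sigma>) * (\<Prod>i<k. A $ f i $ g (\<sigma> i)) * minor k g h B) =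
        (\<Sum>g\<in>index_maps k. (\<Prod>i<k. A $ f i $ g i) * minor k g h B)"
      by (rule sum.reindex_bij_witness[of _ i j]) (simp_all add: ij mem val)
  qed
  also have "\<dots> = fact k * (\<Sum>g\<in>index_maps k. (\<Prod>i<k. A $ f i $ g i) * minor k g h B)"
    by (simp add: card_permutations)
  also have "(\<Sum>g\<in>index_maps k. (\<Prod>i<k. A $ f i $ g i) * minor k g h B) = minor k f h (A ** B)"
  proof -
    have "(\<Sum>g\<in>index_maps k. (\<Prod>i<k. A $ f i $ g i) * minor k g h B) =
      (\<Sum>\<tau> | \<tau> permutes {..<k}. \<Sum>g\<in>index_maps k. of_int (sign \<tau>) * (\<Prod>i<k. A $ f i $ g i * B $ g i $ h (\<tau> i)))"
      unfolding minor_def sum_distrib_left prod.distrib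
      by (subst sum.swap) (simp add: mult_ac)
    also have "\<dots> = (\<Sum>\<tau> | \<tau> permutes {..<k}. of_int (sign \<tau>) * (\<Prod>i<k. \<Sum>l\<in>UNIV. A $ f i $ l * B $ l $ h (\<tau> i)))"
      unfolding index_maps_def sum_distrib_left[symmetric] by (subst prod_sum_PiE) auto
    also have "\<dots> = minor k f h (A ** B)"
      unfolding minor_def by (simp add: matrix_matrix_mult_def)
    finally show ?thesis .
  qed
  finally show ?thesis .
qed

text \<open>The factor \<open>1 / k!\<close> makes the compound multiplicative. With all index maps allowed, the compound of
  the identity is a projection rather than an identity matrix.\<close>

definition compound :: "nat \<Rightarrow> real^'d^'d \<Rightarrow> (nat \<Rightarrow> 'd) \<Rightarrow> (nat \<Rightarrow> 'd) \<Rightarrow> real" where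
  "compound k B f g = minor k f g B / fact k"

lemma compound_mult: "matmul_on (index_maps k) (compound k A) (compound k B) f h = compound k (A ** B) f h"
  using cauchy_binet[of k f A h B]
  by (simp add: matmul_on_def compound_def sum_divide_distrib[symmetric] field_simps)

definition wedge_norm :: "nat \<Rightarrow> real^'d^'d \<Rightarrow> real" where
  "wedge_norm k B = entry_sum (index_maps k) (compound k B)"

lemma wedge_norm_mult_le: "wedge_norm k (A ** B) \<le> wedge_norm k A * wedge_norm k B"
  using entry_sum_matmul_on_le[of "index_maps k" "compound k A" "compound k B"]
  unfolding wedge_norm_def compound_mult[abs_def, symmetric]
  by (simp add: compound_mult)

text \<open>Index set of a Kronecker product of \<open>N\<close> compounds of orders \<open>\<kappa> 0, \<dots>, \<kappa> (N-1)\<close>.\<close>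

definition kron_index :: "nat \<Rightarrow> (nat \<Rightarrow> nat) \<Rightarrow> (nat \<Rightarrow> nat \<Rightarrow> 'd) set" where
  "kron_index N \<kappa> = (\<Pi>\<^sub>E q\<in>{..<N}. index_maps (\<kappa> q))"

definition kron :: "nat \<Rightarrow> (nat \<Rightarrow> nat) \<Rightarrow> real^'d^'d \<Rightarrow> (nat \<Rightarrow> nat \<Rightarrow> 'd) \<Rightarrow> (nat \<Rightarrow> nat \<Rightarrow> 'd) \<Rightarrow> real" where
  "kron N \<kappa> B F G = (\<Prod>q<N. compound (\<kappa> q) B (F q) (G q))"

lemma finite_kron_index [simp]: "finite (kron_index N \<kappa> :: (nat \<Rightarrow> nat \<Rightarrow> 'd::finite) set)"
  unfolding kron_index_def by (intro finite_PiE) auto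

lemma kron_index_nonempty [simp]: "kron_index N \<kappa> \<noteq> {}"
  by (simp add: kron_index_def PiE_eq_empty_iff)

lemma kron_mult: "matmul_on (kron_index N \<kappa>) (kron N \<kappa> A) (kron N \<kappa> B) F H = kron N \<kappa> (A ** B) F H"
proof -
  have "matmul_on (kron_index N \<kappa>) (kron N \<kappa> A) (kron N \<kappa> B) F H =
     (\<Prod>q<N. \<Sum>g\<in>index_maps (\<kappa> q). compound (\<kappa> q) A (F q) g * compound (\<kappa> q) B g (H q))"
    unfolding matmul_on_def kron_def kron_index_def prod.distrib[symmetric]
    by (subst prod_sum_PiE) auto
  then show ?thesis
    by (simp add: kron_def compound_mult[symmetric]) (simp add: matmul_on_def)
qed

text \<open>The entry sum is used as matrix norm because it is exactly multiplicative on Kronecker products.\<close>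

lemma entry_sum_kron: "entry_sum (kron_index N \<kappa>) (kron N \<kappa> B) = (\<Prod>q<N. wedge_norm (\<kappa> q) B)"
proof -
  have "entry_sum (kron_index N \<kappa>) (kron N \<kappa> B) =
      (\<Sum>F\<in>kron_index N \<kappa>. \<Prod>q<N. \<Sum>g\<in>index_maps (\<kappa> q). \<bar>compound (\<kappa> q) B (F q) g\<bar>)"
    unfolding entry_sum_def kron_def kron_index_def abs_prod
    by (subst prod_sum_PiE) auto
  also have "\<dots> = (\<Prod>q<N. wedge_norm (\<kappa> q) B)"
    unfolding wedge_norm_def entry_sum_def kron_index_def by (subst prod_sum_PiE) auto
  finally show ?thesis .
qed

text \<open>The empty word is excluded since compounds do not preserve the identity matrix.\<close>

lemma word_mat_kron:
  assumes "F \<in> kron_index N \<kappa>" "G \<in> kron_index N \<kappa>" "w \<noteq> []"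
  shows "word_mat (kron_index N \<kappa>) (\<lambda>i. kron N \<kappa> (A $ i)) w F G = kron N \<kappa> (word_prod A w) F G"
  using assms
proof (induction w arbitrary: F G)
  case (Cons i w)
  show ?case
  proof (cases "w = []")
    case True
    then show ?thesis using Cons.prems
      by (simp add: matmul_on_def if_distrib[of "\<lambda>a. a * _"] cong: if_cong)
  next
    case False
    have "word_mat (kron_index N \<kappa>) (\<lambda>i. kron N \<kappa> (A $ i)) (i # w) F G =
        matmul_on (kron_index N \<kappa>) (kron N \<kappa> (word_prod A w)) (kron N \<kappa> (A $ i)) F G"
      unfolding word_mat.simps using Cons False by (intro matmul_on_cong) auto
    then show ?thesis by (simp add: kron_mult)
  qed
qed simp

lemma word_sum_kron:
  fixes A :: "real^'d^'d^'m"
  assumes "n \<ge> 1"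
  shows "word_sum (kron_index N \<kappa>) (\<lambda>i. kron N \<kappa> (A $ i)) UNIV p n =
    (\<Sum>w\<in>words UNIV n. (\<Prod>q<N. wedge_norm (\<kappa> q) (word_prod A w)) powr p)"
  unfolding word_sum_def
proof (intro sum.cong refl)
  fix w :: "'m list" assume "w \<in> words UNIV n"
  then have "w \<noteq> []" using assms by (auto simp: words_def)
  then have "entry_sum (kron_index N \<kappa>) (word_mat (kron_index N \<kappa>) (\<lambda>i. kron N \<kappa> (A $ i)) w) =
     entry_sum (kron_index N \<kappa>) (kron N \<kappa> (word_prod A w))"
    by (intro entry_sum_cong word_mat_kron)
  then show "entry_sum (kron_index N \<kappa>) (word_mat (kron_index N \<kappa>) (\<lambda>i. kron N \<kappa> (A $ i)) w) powr p =
    (\<Prod>q<N. wedge_norm (\<kappa> q) (word_prod A w)) powr p"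
    by (simp add: entry_sum_kron)
qed

lemma continuous_on_compound:
  "continuous_on X N \<Longrightarrow> continuous_on X (\<lambda>A. compound k (N A) f g)"
  unfolding compound_def minor_def by (intro continuous_intros) auto

lemma continuous_on_kron:
  "continuous_on X N \<Longrightarrow> continuous_on X (\<lambda>A. kron M \<kappa> (N A) F G)"
  unfolding kron_def by (intro continuous_on_prod continuous_on_compound)

lemma continuous_on_wedge_norm:
  "continuous_on X N \<Longrightarrow> continuous_on X (\<lambda>A. wedge_norm k (N A))"
  unfolding wedge_norm_def entry_sum_def by (intro continuous_on_sum continuous_on_rabs continuous_on_compound)

section \<open>Singular values and the characteristic polynomial of the Gram matrix\<close>

definition principal_minor :: "'n set \<Rightarrow> 'a::comm_ring_1^'n^'n \<Rightarrow> 'a" where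
  "principal_minor S N = (\<Sum>p | p permutes S. of_int (sign p) * (\<Prod>i\<in>S. N $ i $ p i))"

text \<open>The characteristic polynomial at \<open>x\<close>, as a sum over the set \<open>S\<close> of rows in which the entry of \<open>- N\<close> is
  chosen. The remaining rows force the permutation to fix them, so only permutations of \<open>S\<close> remain.\<close>

lemma det_shift_expand:
  fixes N :: "'a::comm_ring_1^'n^'n"
  shows "det ((\<chi> i j. (if i = j then x else 0) - N $ i $ j) :: 'a^'n^'n) =
    (\<Sum>S\<in>UNIV. (-1) ^ card S * principal_minor S N * x ^ (CARD('n) - card S))"
proof -
  have term_eq: "of_int (sign p) * (\<Prod>i\<in>UNIV. (if i = p i then x else 0) - N $ i $ p i) =
      (\<Sum>S\<in>UNIV. if p permutes S then
         (-1) ^ card S * (of_int (sign p) * (\<Prod>i\<in>S. N $ i $ p i)) * x ^ (CARD('n) - card S) else 0)"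
    if p: "p permutes (UNIV :: 'n set)" for p
  proof -
    have perm: "p permutes S \<longleftrightarrow> (\<forall>i\<in>-S. i = p i)" for S
    proof
      assume "p permutes S" then show "\<forall>i\<in>-S. i = p i" by (auto simp: permutes_not_in)
    next
      assume "\<forall>i\<in>-S. i = p i" then show "p permutes S"
        using permutes_superset[OF p, of S] by auto
    qed
    have "(\<Prod>i\<in>UNIV. (if i = p i then x else 0) - N $ i $ p i) =
       (\<Prod>i\<in>UNIV. (- N $ i $ p i) + (if i = p i then x else 0))"
      by (simp add: algebra_simps)
    also have "\<dots> = (\<Sum>S\<in>UNIV. (\<Prod>i\<in>S. - N $ i $ p i) * (\<Prod>i\<in>UNIV-S. if i = p i then x else 0))"
      by (subst prod_add) auto
    also have "\<dots> = (\<Sum>S\<in>UNIV. if p permutes S then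
        (-1) ^ card S * (\<Prod>i\<in>S. N $ i $ p i) * x ^ (CARD('n) - card S) else 0)"
    proof (intro sum.cong refl)
      fix S :: "'n set"
      have "(\<Prod>i\<in>UNIV-S. if i = p i then x else 0) = (if p permutes S then x ^ (CARD('n) - card S) else 0)"
      proof (cases "p permutes S")
        case True
        then have "(\<Prod>i\<in>UNIV-S. if i = p i then x else 0) = (\<Prod>i\<in>UNIV-S. x)"
          unfolding perm by (intro prod.cong) auto
        then show ?thesis using True by (simp add: card_Diff_subset)
      next
        case False
        then obtain i where "i \<in> UNIV - S" "i \<noteq> p i" unfolding perm by auto
        then show ?thesis using False by (simp, intro prod_zero) auto
      qed
      moreover have "(\<Prod>i\<in>S. - N $ i $ p i) = (-1) ^ card S * (\<Prod>i\<in>S. N $ i $ p i)"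
        by (rule prod_uminus)
      ultimately show "(\<Prod>i\<in>S. - N $ i $ p i) * (\<Prod>i\<in>UNIV-S. if i = p i then x else 0) =
         (if p permutes S then (-1) ^ card S * (\<Prod>i\<in>S. N $ i $ p i) * x ^ (CARD('n) - card S) else 0)"
        by simp
    qed
    finally show ?thesis by (simp add: sum_distrib_left if_distrib mult_ac cong: if_cong)
  qed
  have "det ((\<chi> i j. (if i = j then x else 0) - N $ i $ j) :: 'a^'n^'n) =
     (\<Sum>p | p permutes (UNIV::'n set). of_int (sign p) * (\<Prod>i\<in>UNIV. (if i = p i then x else 0) - N $ i $ p i))"
    by (simp add: det_def)
  also have "\<dots> = (\<Sum>p | p permutes (UNIV::'n set). \<Sum>S\<in>UNIV. if p permutes S then
         (-1) ^ card S * (of_int (sign p) * (\<Prod>i\<in>S. N $ i $ p i)) * x ^ (CARD('n) - card S) else 0)"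
    by (intro sum.cong refl term_eq) auto
  also have "\<dots> = (\<Sum>S\<in>UNIV. \<Sum>p | p permutes (UNIV::'n set). if p permutes S then
         (-1) ^ card S * (of_int (sign p) * (\<Prod>i\<in>S. N $ i $ p i)) * x ^ (CARD('n) - card S) else 0)"
    by (rule sum.swap)
  also have "\<dots> = (\<Sum>S\<in>UNIV. (-1) ^ card S * principal_minor S N * x ^ (CARD('n) - card S))"
  proof (intro sum.cong refl)
    fix S :: "'n set"
    have "(\<Sum>p | p permutes (UNIV::'n set). if p permutes S then
         (-1) ^ card S * (of_int (sign p) * (\<Prod>i\<in>S. N $ i $ p i)) * x ^ (CARD('n) - card S) else 0)
      = (\<Sum>p | p permutes S. (-1) ^ card S * (of_int (sign p) * (\<Prod>i\<in>S. N $ i $ p i)) * x ^ (CARD('n) - card S))"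
      by (rule sum.mono_neutral_cong_right) (auto simp: finite_permutations intro: permutes_subset)
    then show "(\<Sum>p | p permutes (UNIV::'n set). if p permutes S then
         (-1) ^ card S * (of_int (sign p) * (\<Prod>i\<in>S. N $ i $ p i)) * x ^ (CARD('n) - card S) else 0)
       = (-1) ^ card S * principal_minor S N * x ^ (CARD('n) - card S)"
      by (simp add: principal_minor_def sum_distrib_left sum_distrib_right)
  qed
  finally show ?thesis .
qed

lemma prod_const_poly: "(\<Prod>i\<in>S. [:f i:]) = [:\<Prod>i\<in>S. f i:]"
  by (induction S rule: infinite_finite_induct) (auto simp: one_pCons mult.commute)

lemma charpoly_coeffs:
  fixes N :: "'a::comm_ring_1^'n^'n"
  shows "det ((\<chi> i j. (if i = j then [:0, 1:] else 0) - [:N $ i $ j:]) :: 'a poly^'n^'n) =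
    (\<Sum>S\<in>UNIV. monom ((-1) ^ card S * principal_minor S N) (CARD('n) - card S))"
proof -
  define N' :: "'a poly^'n^'n" where "N' = (\<chi> i j. [:N $ i $ j:])"
  have pm: "principal_minor S N' = [:principal_minor S N:]" for S
  proof -
    have "(\<Sum>p\<in>T. [:g p:]) = [:\<Sum>p\<in>T. g p:]" for T and g :: "('n \<Rightarrow> 'n) \<Rightarrow> 'a"
      by (induction T rule: infinite_finite_induct) auto
    then show ?thesis
      unfolding principal_minor_def N'_def by (simp add: prod_const_poly of_int_poly mult.commute)
  qed
  have "det ((\<chi> i j. (if i = j then [:0, 1:] else 0) - [:N $ i $ j:]) :: 'a poly^'n^'n) =
     det ((\<chi> i j. (if i = j then [:0, 1:] else 0) - N' $ i $ j) :: 'a poly^'n^'n)"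
    by (simp add: N'_def)
  also have "\<dots> = (\<Sum>S\<in>UNIV. (-1) ^ card S * [:principal_minor S N:] * [:0, 1:] ^ (CARD('n) - card S))"
    by (simp add: det_shift_expand pm)
  also have "\<dots> = (\<Sum>S\<in>UNIV. monom ((-1) ^ card S * principal_minor S N) (CARD('n) - card S))"
  proof (intro sum.cong refl)
    fix S :: "'n set"
    have "(-1) ^ card S * [:principal_minor S N:] = [:(-1) ^ card S * principal_minor S N:]"
      by (cases "even (card S)") auto
    then show "(-1) ^ card S * [:principal_minor S N:] * [:0, 1:] ^ (CARD('n) - card S) =
       monom ((-1) ^ card S * principal_minor S N) (CARD('n) - card S)"
      by (simp add: monom_altdef mult.commute)
  qed
  finally show ?thesis .
qed

text \<open>Extracts an elementary symmetric function: it is applied to the expansion into principal minors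
  and to the expansion of a product of linear factors.\<close>

lemma coeff_sum_monom_card:
  assumes "finite U" "k \<le> card U"
  shows "coeff (\<Sum>S\<in>Pow U. monom (c S) (card U - card S)) (card U - k) = (\<Sum>S | S \<subseteq> U \<and> card S = k. c S)"
proof -
  have "coeff (\<Sum>S\<in>Pow U. monom (c S) (card U - card S)) (card U - k) =
     (\<Sum>S\<in>Pow U. if card U - card S = card U - k then c S else 0)"
    by (simp add: coeff_sum)
  also have "\<dots> = (\<Sum>S | S \<subseteq> U \<and> card S = k. c S)"
  proof (rule sum.mono_neutral_cong_right)
    show "\<forall>S\<in>Pow U - {S. S \<subseteq> U \<and> card S = k}. (if card U - card S = card U - k then c S else 0) = 0"
    proof
      fix S assume S: "S \<in> Pow U - {S. S \<subseteq> U \<and> card S = k}"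
      then have "card S \<le> card U" using assms by (auto intro: card_mono)
      then show "(if card U - card S = card U - k then c S else 0) = 0" using S assms by auto
    qed
  qed (use assms in auto)
  finally show ?thesis .
qed

text \<open>For an eigenvector \<open>v\<close> one has \<open>z \<parallel>v\<parallel>\<^sup>2 = v\<^sup>* B\<^sup>T B v = \<parallel>B v\<parallel>\<^sup>2\<close>.\<close>

lemma gram_eigenvalue_nonneg:
  fixes B :: "real^'d^'d" and z :: complex
  defines "N \<equiv> transpose B ** B"
  assumes det0: "det ((\<chi> i j. (if i = j then z else 0) - complex_of_real (N $ i $ j)) :: complex^'d^'d) = 0"
  shows "z = of_real (Re z) \<and> Re z \<ge> 0"
proof -
  let ?C = "(\<chi> i j. (if i = j then z else 0) - complex_of_real (N $ i $ j)) :: complex^'d^'d"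
  have "\<not> invertible ?C" using det0 by (simp add: invertible_det_nz)
  then obtain v where v: "?C *v v = 0" "v \<noteq> 0"
    by (auto simp: invertible_left_inverse matrix_left_invertible_ker)
  have eig: "(\<Sum>j\<in>UNIV. of_real (N $ i $ j) * v $ j) = z * v $ i" for i
  proof -
    have "0 = (?C *v v) $ i" using v by simp
    also have "\<dots> = (\<Sum>j\<in>UNIV. (if i = j then z * v $ j else 0) - of_real (N $ i $ j) * v $ j)"
      unfolding matrix_vector_mult_def by (simp, intro sum.cong) (auto simp: algebra_simps)
    also have "\<dots> = z * v $ i - (\<Sum>j\<in>UNIV. of_real (N $ i $ j) * v $ j)"
      by (simp add: sum_subtractf)
    finally show ?thesis by simp
  qed
  define w where "w l = (\<Sum>j\<in>UNIV. of_real (B $ l $ j) * v $ j)" for l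
  have "(\<Sum>i\<in>UNIV. cnj (v $ i) * (z * v $ i)) =
     (\<Sum>i\<in>UNIV. cnj (v $ i) * (\<Sum>j\<in>UNIV. (\<Sum>l\<in>UNIV. of_real (B $ l $ i) * of_real (B $ l $ j)) * v $ j))"
    unfolding eig[symmetric] N_def by (simp add: matrix_matrix_mult_def Finite_Cartesian_Product.transpose_def)
  also have "\<dots> = (\<Sum>i\<in>UNIV. \<Sum>j\<in>UNIV. \<Sum>l\<in>UNIV. (of_real (B $ l $ i) * cnj (v $ i)) * (of_real (B $ l $ j) * v $ j))"
    by (simp add: sum_distrib_left sum_distrib_right mult_ac)
  also have "\<dots> = (\<Sum>i\<in>UNIV. \<Sum>l\<in>UNIV. \<Sum>j\<in>UNIV. (of_real (B $ l $ i) * cnj (v $ i)) * (of_real (B $ l $ j) * v $ j))"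
    by (rule sum.cong[OF refl], rule sum.swap)
  also have "\<dots> = (\<Sum>l\<in>UNIV. \<Sum>i\<in>UNIV. \<Sum>j\<in>UNIV. (of_real (B $ l $ i) * cnj (v $ i)) * (of_real (B $ l $ j) * v $ j))"
    by (rule sum.swap)
  also have "\<dots> = (\<Sum>l\<in>UNIV. cnj (w l) * w l)"
    unfolding w_def by (simp add: sum_product)
  also have "\<dots> = of_real (\<Sum>l\<in>UNIV. (cmod (w l))\<^sup>2)"
    unfolding of_real_sum by (intro sum.cong refl) (simp only: complex_norm_square mult.commute)
  also have "(\<Sum>i\<in>UNIV. cnj (v $ i) * (z * v $ i)) = z * of_real (\<Sum>i\<in>UNIV. (cmod (v $ i))\<^sup>2)"
    unfolding of_real_sum sum_distrib_left by (intro sum.cong refl) (simp only: complex_norm_square mult_ac)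
  finally have eq: "z * of_real (\<Sum>i\<in>UNIV. (cmod (v $ i))\<^sup>2) = of_real (\<Sum>l\<in>UNIV. (cmod (w l))\<^sup>2)" .
  define a where "a = (\<Sum>i\<in>UNIV. (cmod (v $ i))\<^sup>2)"
  define b where "b = (\<Sum>l\<in>UNIV. (cmod (w l))\<^sup>2)"
  have b0: "b \<ge> 0" unfolding b_def by (intro sum_nonneg) auto
  obtain i where "v $ i \<noteq> 0" using v(2) by (auto simp: vec_eq_iff)
  then have a0: "a > 0" unfolding a_def by (intro sum_pos2[of _ i]) auto
  have "z = of_real (b / a)" using eq a0 unfolding a_def[symmetric] b_def[symmetric] by (simp add: field_simps)
  then show ?thesis using a0 b0 by simp
qed

lemma proots_prod_linear_factors: "proots (\<Prod>x\<in>#R. [:-x, 1 :: 'a :: idom:]) = R"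
proof (induction R)
  case (add x R)
  have "(\<Prod>x\<in>#R. [:-x, 1 :: 'a:]) \<noteq> 0" by (auto simp: prod_mset_zero_iff)
  then have "proots ([:-x, 1:] * (\<Prod>x\<in>#R. [:-x, 1:])) = proots [:-x, 1:] + proots (\<Prod>x\<in>#R. [:-x, 1:])"
    by (intro proots_mult) auto
  then show ?case using add.IH by (simp del: mult_pCons_left)
qed simp

text \<open>Over the complex numbers the polynomial splits, and its roots are real and nonnegative. Hence the
  product of the corresponding real linear factors agrees with it at all real points. Comparing
  polynomials instead of eigenspaces accounts for multiplicities without diagonalising.\<close>

lemma gram_charpoly_splits:
  fixes B :: "real^'d^'d"
  defines "q \<equiv> charpoly (transpose B ** B)"
  shows "q = (\<Prod>x\<in>#proots q. [:-x, 1:])" "size (proots q) = CARD('d)" "\<And>x. x \<in># proots q \<Longrightarrow> x \<ge> 0"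
proof -
  define N where "N = transpose B ** B"
  define Nc :: "complex^'d^'d" where "Nc = (\<chi> i j. of_real (N $ i $ j))"
  define P :: "complex poly" where
    "P = det ((\<chi> i j. (if i = j then [:0, 1:] else 0) - [:Nc $ i $ j:]) :: complex poly^'d^'d)"
  have P: "P = (\<Sum>S\<in>UNIV. monom ((-1) ^ card S * principal_minor S Nc) (CARD('d) - card S))"
    unfolding P_def by (rule charpoly_coeffs)
  have polyP: "poly P z = det ((\<chi> i j. (if i = j then z else 0) - Nc $ i $ j) :: complex^'d^'d)" for z
    unfolding P det_shift_expand by (simp add: poly_sum poly_monom)
  have pmc: "principal_minor S Nc = of_real (principal_minor S N)" for S
    by (simp add: principal_minor_def Nc_def)
  have polyq: "poly P (of_real t) = of_real (poly q t)" for t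
    unfolding q_def charpoly_def P charpoly_coeffs N_def[symmetric]
    by (simp add: poly_sum poly_monom pmc)
  have lead: "coeff P CARD('d) = 1"
    using coeff_sum_monom_card[of "UNIV :: 'd set" 0 "\<lambda>S. (-1) ^ card S * principal_minor S Nc"]
    by (simp add: P principal_minor_def)
  have degP: "degree P = CARD('d)"
  proof (rule antisym)
    show "degree P \<le> CARD('d)" unfolding P
      by (intro degree_sum_le) (auto intro: order_trans[OF degree_monom_le])
    show "CARD('d) \<le> degree P" using lead by (intro le_degree) simp
  qed
  have P0: "P \<noteq> 0" using lead by auto
  obtain A where "P = (\<Prod>x\<in>#A. [:-x, 1:])"
    using alg_closed_imp_factorization[OF P0] lead degP by auto
  then have Pprod: "P = (\<Prod>x\<in>#proots P. [:-x, 1:])"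
    using proots_prod_linear_factors[of A] by simp
  have root: "x = of_real (Re x) \<and> Re x \<ge> 0" if "x \<in># proots P" for x
    using that P0 polyP[of x] by (intro gram_eigenvalue_nonneg[of x B]) (simp add: Nc_def N_def)
  \<comment> \<open>The candidate for the roots of \<open>q\<close>; the product of the linear factors is compared with \<open>q\<close> at every real point \<open>t\<close>.\<close>
  define R where "R = image_mset Re (proots P)"
  have hom: "complex_of_real (\<Prod>x\<in>#A. g x) = (\<Prod>x\<in>#A. of_real (g x))" for A and g :: "complex \<Rightarrow> real"
    by (induction A) auto
  have "poly q t = poly (\<Prod>x\<in>#R. [:-x, 1:]) t" for t
  proof -
    have "complex_of_real (poly q t) = poly (\<Prod>x\<in>#proots P. [:-x, 1:]) (of_real t)"
      using polyq Pprod by simp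
    also have "\<dots> = (\<Prod>x\<in>#proots P. of_real t - x)"
      by (simp add: poly_prod_mset image_mset.compositionality o_def)
    also have "\<dots> = (\<Prod>x\<in>#proots P. of_real (t - Re x))"
      by (intro arg_cong[of _ _ prod_mset] image_mset_cong) (use root in auto)
    also have "\<dots> = of_real (poly (\<Prod>x\<in>#R. [:-x, 1:]) t)"
      by (simp add: R_def poly_prod_mset image_mset.compositionality o_def hom)
    finally show ?thesis by (simp only: of_real_eq_iff)
  qed
  then have q: "q = (\<Prod>x\<in>#R. [:-x, 1:])" by (intro poly_eq_poly_eq_iff[THEN iffD1] ext)
  have pq: "proots q = R" unfolding q by (rule proots_prod_linear_factors)
  show "q = (\<Prod>x\<in>#proots q. [:-x, 1:])" unfolding pq by (rule q)
  show "size (proots q) = CARD('d)" unfolding pq R_def using size_proots_complex[of P] degP by simp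
  show "x \<ge> 0" if "x \<in># proots q" for x using that root unfolding pq R_def by auto
qed

text \<open>The splitting of the characteristic polynomial guarantees that the list has the full length \<open>d\<close>, so
  that the indices used by the singular value function are never out of range.\<close>

lemma singular_values_basic:
  fixes B :: "real^'d^'d"
  shows "length (singular_values B) = CARD('d)"
    and "\<And>i j. i \<le> j \<Longrightarrow> j < CARD('d) \<Longrightarrow> singular_values B ! j \<le> singular_values B ! i"
    and "\<And>i. i < CARD('d) \<Longrightarrow> singular_values B ! i \<ge> 0"
    and "charpoly (transpose B ** B) = (\<Prod>i<CARD('d). [:- (singular_values B ! i)\<^sup>2, 1:])"
proof -
  define R where "R = proots (charpoly (transpose B ** B))"
  note R = gram_charpoly_splits[where B = B, folded R_def]
  have sv: "mset (singular_values B) = image_mset sqrt R"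
    by (simp add: singular_values_def R_def)
  show len: "length (singular_values B) = CARD('d)"
    using arg_cong[OF sv, of size] R(2) by simp
  have "sorted (rev (singular_values B))" by (simp add: singular_values_def)
  then show "singular_values B ! j \<le> singular_values B ! i" if "i \<le> j" "j < CARD('d)" for i j
    using that len by (simp add: sorted_rev_iff_nth_mono)
  show "singular_values B ! i \<ge> 0" if "i < CARD('d)" for i
  proof -
    have "singular_values B ! i \<in># mset (singular_values B)" using that len by simp
    then show ?thesis unfolding sv using R(3) by auto
  qed
  have "R = image_mset (\<lambda>x. x\<^sup>2) (mset (singular_values B))"
    unfolding sv image_mset.compositionality o_def using R(3) by (simp cong: image_mset_cong)
  then have "charpoly (transpose B ** B) = (\<Prod>x\<in>#mset (singular_values B). [:- x\<^sup>2, 1:])"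
    using R(1) by (simp add: image_mset.compositionality o_def)
  also have "\<dots> = (\<Prod>x\<leftarrow>singular_values B. [:- x\<^sup>2, 1:])"
    by (simp add: prod_mset_prod_list[symmetric])
  also have "\<dots> = (\<Prod>i<CARD('d). [:- (singular_values B ! i)\<^sup>2, 1:])"
    by (simp add: prod.list_conv_set_nth len atLeast0LessThan)
  finally show "charpoly (transpose B ** B) = (\<Prod>i<CARD('d). [:- (singular_values B ! i)\<^sup>2, 1:])" .
qed

text \<open>Both sides are, up to the sign \<open>(-1)\<^sup>k\<close>, the coefficient of degree \<open>d - k\<close> of the characteristic
  polynomial of the Gram matrix.\<close>

lemma principal_minor_sum_eq:
  fixes B :: "real^'d^'d"
  assumes k: "k \<le> CARD('d)"
  shows "(\<Sum>S | card S = k. principal_minor S (transpose B ** B)) =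
    (\<Sum>T | T \<subseteq> {..<CARD('d)} \<and> card T = k. \<Prod>i\<in>T. (singular_values B ! i)\<^sup>2)"
proof -
  define s where "s i = (singular_values B ! i)\<^sup>2" for i
  let ?D = "{..<CARD('d)}"
  have "(\<Prod>i\<in>?D. [:- s i, 1:]) = (\<Prod>i\<in>?D. [:- s i:] + [:0, 1:])" by simp
  also have "\<dots> = (\<Sum>T\<in>Pow ?D. (\<Prod>i\<in>T. [:- s i:]) * (\<Prod>i\<in>?D - T. [:0, 1:]))"
    by (rule prod_add) simp
  also have "\<dots> = (\<Sum>T\<in>Pow ?D. monom ((-1) ^ card T * (\<Prod>i\<in>T. s i)) (card ?D - card T))"
  proof (intro sum.cong refl)
    fix T assume "T \<in> Pow ?D"
    then have "T \<subseteq> ?D" "finite T" by (auto intro: finite_subset)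
    then have "card (?D - T) = card ?D - card T" by (intro card_Diff_subset)
    then show "(\<Prod>i\<in>T. [:- s i:]) * (\<Prod>i\<in>?D - T. [:0, 1:]) = monom ((-1) ^ card T * (\<Prod>i\<in>T. s i)) (card ?D - card T)"
      by (simp add: prod_const_poly monom_altdef prod_uminus)
  qed
  finally have "coeff (charpoly (transpose B ** B)) (CARD('d) - k) = (\<Sum>T | T \<subseteq> ?D \<and> card T = k. (-1) ^ card T * (\<Prod>i\<in>T. s i))"
    using coeff_sum_monom_card[of ?D k "\<lambda>T. (-1) ^ card T * (\<Prod>i\<in>T. s i)"] k
    by (simp add: singular_values_basic(4) s_def)
  also have "\<dots> = (-1) ^ k * (\<Sum>T | T \<subseteq> ?D \<and> card T = k. \<Prod>i\<in>T. s i)"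
    by (simp add: sum_distrib_left)
  finally have 1: "coeff (charpoly (transpose B ** B)) (CARD('d) - k) = (-1) ^ k * (\<Sum>T | T \<subseteq> ?D \<and> card T = k. \<Prod>i\<in>T. s i)" .
  have "coeff (charpoly (transpose B ** B)) (CARD('d) - k) = (\<Sum>S | S \<subseteq> (UNIV :: 'd set) \<and> card S = k. (-1) ^ card S * principal_minor S (transpose B ** B))"
    using coeff_sum_monom_card[of "UNIV :: 'd set" k "\<lambda>S. (-1) ^ card S * principal_minor S (transpose B ** B)"] k
    by (simp add: charpoly_def charpoly_coeffs)
  also have "\<dots> = (-1) ^ k * (\<Sum>S | card S = k. principal_minor S (transpose B ** B))"
    by (simp add: sum_distrib_left)
  finally show ?thesis using 1 by (simp add: s_def)
qed

section \<open>Products of singular values and norms of compound matrices\<close>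

text \<open>Transport of permutations along the bijection \<open>f\<close>; signs are preserved.\<close>

lemma minor_eq_principal_minor:
  assumes f: "inj_on f {..<k}"
  shows "minor k f f N = principal_minor (f ` {..<k}) N"
proof -
  let ?S = "f ` {..<k}" and ?m = "map_permutation {..<k} f"
  have bij: "bij_betw f {..<k} ?S" using f by (simp add: bij_betw_def)
  have bij': "bij_betw f' ?S {..<k}" if "f' = inv_into {..<k} f" for f'
    using bij_betw_inv_into[OF bij] that by simp
  have "bij_betw ?m {\<pi>. \<pi> permutes {..<k}} {\<pi>. \<pi> permutes ?S}"
  proof (rule bij_betw_byWitness[of _ "map_permutation ?S (inv_into {..<k} f)"])
    show "\<forall>\<pi>\<in>{\<pi>. \<pi> permutes {..<k}}. map_permutation ?S (inv_into {..<k} f) (?m \<pi>) = \<pi>"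
      using f by (auto intro: map_permutation_compose_inv[OF bij])
    show "\<forall>\<pi>\<in>{\<pi>. \<pi> permutes ?S}. ?m (map_permutation ?S (inv_into {..<k} f) \<pi>) = \<pi>"
    proof
      fix \<pi> assume "\<pi> \<in> {\<pi>. \<pi> permutes ?S}"
      then show "?m (map_permutation ?S (inv_into {..<k} f) \<pi>) = \<pi>"
        by (intro map_permutation_compose_inv[OF bij'[OF refl]]) (simp_all add: f_inv_into_f)
    qed
    show "?m ` {\<pi>. \<pi> permutes {..<k}} \<subseteq> {\<pi>. \<pi> permutes ?S}"
      by (auto intro!: map_permutation_permutes bij)
    show "map_permutation ?S (inv_into {..<k} f) ` {\<pi>. \<pi> permutes ?S} \<subseteq> {\<pi>. \<pi> permutes {..<k}}"
      by (auto intro!: map_permutation_permutes bij')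
  qed
  then have "principal_minor ?S N =
      (\<Sum>\<pi> | \<pi> permutes {..<k}. of_int (sign (?m \<pi>)) * (\<Prod>i\<in>?S. N $ i $ ?m \<pi> i))"
    unfolding principal_minor_def by (rule sum.reindex_bij_betw[symmetric])
  also have "\<dots> = minor k f f N"
    unfolding minor_def
    by (intro sum.cong refl arg_cong2[of _ _ _ _ "(*)"])
      (auto simp: sign_map_permutation f prod.reindex map_permutation_apply)
  finally show ?thesis ..
qed

text \<open>Counting from 0, the \<open>i\<close>-th smallest element of \<open>T\<close> is at least \<open>i\<close>.\<close>

lemma prod_antimono_le:
  fixes a :: "nat \<Rightarrow> real"
  assumes "finite T" and nn: "\<And>i. a i \<ge> 0" and mono: "\<And>i j. i \<le> j \<Longrightarrow> a j \<le> a i"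
  shows "(\<Prod>i\<in>T. a i) \<le> (\<Prod>i<card T. a i)"
  using assms(1)
proof (induction T rule: finite_linorder_max_induct)
  case (insert m T)
  have "T \<subseteq> {..<m}" "m \<notin> T" using insert by auto
  then have "card T \<le> m" using card_mono[of "{..<m}" T] by simp
  then have "(\<Prod>i\<in>T. a i) * a m \<le> (\<Prod>i<card T. a i) * a (card T)"
    using insert nn mono by (intro mult_mono prod_nonneg) auto
  then show ?case using insert \<open>m \<notin> T\<close> by (simp add: mult.commute)
qed simp

definition sv_prod :: "nat \<Rightarrow> real^'d^'d \<Rightarrow> real" where
  "sv_prod k B = (\<Prod>i<k. singular_values B ! i)"

lemma sv_prod_nonneg: "k \<le> CARD('d) \<Longrightarrow> sv_prod k (B :: real^'d^'d) \<ge> 0"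
  unfolding sv_prod_def by (intro prod_nonneg) (auto intro: singular_values_basic(3))

text \<open>The elementary symmetric function of degree \<open>k\<close> in the squares of the singular values has
  \<open>(\<alpha>\<^sub>1 \<dots> \<alpha>\<^sub>k)\<^sup>2\<close> as its largest term and at most \<open>2\<^sup>d\<close> terms.\<close>

lemma principal_minor_sum_bounds:
  fixes B :: "real^'d^'d"
  assumes k: "k \<le> CARD('d)"
  defines "e \<equiv> (\<Sum>S | card S = k. principal_minor S (transpose B ** B))"
  shows "(sv_prod k B)\<^sup>2 \<le> e" "e \<le> 2 ^ CARD('d) * (sv_prod k B)\<^sup>2"
proof -
  define a where "a i = (if i < CARD('d) then (singular_values B ! i)\<^sup>2 else 0)" for i
  have a0: "a i \<ge> 0" for i by (simp add: a_def)
  have amono: "a j \<le> a i" if "i \<le> j" for i j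
    using that singular_values_basic(2)[of i j B] singular_values_basic(3)[of j B]
    by (auto simp: a_def intro!: power_mono)
  let ?T = "{T. T \<subseteq> {..<CARD('d)} \<and> card T = k}"
  have e: "e = (\<Sum>T\<in>?T. \<Prod>i\<in>T. a i)"
    unfolding e_def principal_minor_sum_eq[OF k] by (intro sum.cong prod.cong refl) (auto simp: a_def)
  have sv2: "(sv_prod k B)\<^sup>2 = (\<Prod>i<k. a i)"
    unfolding sv_prod_def prod_power_distrib using k by (intro prod.cong) (auto simp: a_def)
  have fin: "finite ?T" by simp
  show "(sv_prod k B)\<^sup>2 \<le> e"
    unfolding sv2 e using k a0 by (intro member_le_sum) (auto intro: prod_nonneg)
  have "e \<le> (\<Sum>T\<in>?T. (\<Prod>i<k. a i))"
    unfolding e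
  proof (rule sum_mono)
    fix T assume "T \<in> ?T"
    then show "(\<Prod>i\<in>T. a i) \<le> (\<Prod>i<k. a i)"
      using prod_antimono_le[of T a] a0 amono finite_subset[of T "{..<CARD('d)}"] by auto
  qed
  also have "\<dots> = real (card ?T) * (\<Prod>i<k. a i)" by simp
  also have "\<dots> \<le> 2 ^ CARD('d) * (\<Prod>i<k. a i)"
  proof (rule mult_right_mono)
    have "card ?T \<le> card (Pow {..<CARD('d)})" by (intro card_mono) auto
    then have "card ?T \<le> 2 ^ CARD('d)" by (simp add: card_Pow)
    then show "real (card ?T) \<le> 2 ^ CARD('d)" by (metis of_nat_le_iff of_nat_numeral of_nat_power)
  qed (auto intro: prod_nonneg a0)
  finally show "e \<le> 2 ^ CARD('d) * (sv_prod k B)\<^sup>2" unfolding sv2 .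
qed

text \<open>Cauchy--Binet for the Gram matrix. It shows that principal minors of the Gram matrix are
  nonnegative and links them to the minors of \<open>B\<close>.\<close>

lemma sum_minor_squares:
  "fact k * minor k f f (transpose B ** B) = (\<Sum>g\<in>index_maps k. (minor k g f B)\<^sup>2)"
  using cauchy_binet[of k f "transpose B" f B] by (simp add: minor_transpose power2_eq_square)

lemma wedge_norm_eq: "wedge_norm k B = (\<Sum>g\<in>index_maps k. \<Sum>f\<in>index_maps k. \<bar>minor k g f B\<bar>) / fact k"
  by (simp add: wedge_norm_def entry_sum_def compound_def sum_divide_distrib)

lemma wedge_norm_nonneg: "wedge_norm k B \<ge> 0"
  by (simp add: wedge_norm_def entry_sum_nonneg)

lemma minor_gram_nonneg:
  fixes B :: "real^'d^'d"
  shows "minor k f f (transpose B ** B) \<ge> 0"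
proof -
  have "fact k * minor k f f (transpose B ** B) \<ge> 0"
    using sum_minor_squares[of k f B] by (simp add: sum_nonneg)
  then show ?thesis using fact_gt_zero[of k, where 'a = real] by (simp add: zero_le_mult_iff)
qed

lemma sv_prod_le_wedge_norm:
  fixes B :: "real^'d^'d"
  assumes k: "k \<le> CARD('d)"
  shows "sv_prod k B \<le> sqrt (2 ^ CARD('d) * fact k) * wedge_norm k B"
proof -
  define N where "N = transpose B ** B"
  have pm: "principal_minor S N \<le> fact k * (wedge_norm k B)\<^sup>2" if S: "card S = k" for S :: "'d set"
  proof -
    obtain h where h: "bij_betw h {..<k} S"
      using S ex_bij_betw_nat_finite[of S] by (auto simp: atLeast0LessThan)
    define f where "f = restrict h {..<k}"
    have f: "inj_on f {..<k}" "f ` {..<k} = S" "f \<in> index_maps k"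
      using h by (auto simp: f_def bij_betw_def inj_on_def index_maps_def)
    have "principal_minor S N = minor k f f N" using minor_eq_principal_minor[OF f(1)] f(2) by simp
    also have "\<dots> = (\<Sum>g\<in>index_maps k. (minor k g f B)\<^sup>2) / fact k"
      unfolding sum_minor_squares[symmetric] N_def by simp
    also have "\<dots> \<le> (fact k * wedge_norm k B)\<^sup>2 / fact k"
    proof (rule divide_right_mono)
      define c where "c = (\<Sum>g\<in>index_maps k. \<bar>minor k g f B\<bar>)"
      have c0: "c \<ge> 0" unfolding c_def by (intro sum_nonneg) auto
      have "(\<Sum>g\<in>index_maps k. (minor k g f B)\<^sup>2) =
          (\<Sum>g\<in>index_maps k. \<bar>minor k g f B\<bar> * \<bar>minor k g f B\<bar>)"
        by (simp add: power2_eq_square)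
      also have "\<dots> \<le> (\<Sum>g\<in>index_maps k. \<bar>minor k g f B\<bar> * c)"
        unfolding c_def by (intro sum_mono mult_left_mono member_le_sum) auto
      also have "\<dots> = c\<^sup>2" by (simp add: sum_distrib_right[symmetric] c_def power2_eq_square)
      also have "\<dots> \<le> (fact k * wedge_norm k B)\<^sup>2"
      proof (rule power_mono[OF _ c0])
        have "c \<le> (\<Sum>g\<in>index_maps k. \<Sum>f\<in>index_maps k. \<bar>minor k g f B\<bar>)"
          unfolding c_def using f(3) by (intro sum_mono member_le_sum) auto
        then show "c \<le> fact k * wedge_norm k B" by (simp add: wedge_norm_eq)
      qed
      finally show "(\<Sum>g\<in>index_maps k. (minor k g f B)\<^sup>2) \<le> (fact k * wedge_norm k B)\<^sup>2" .
    qed simp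
    also have "\<dots> = fact k * (wedge_norm k B)\<^sup>2"
      by (simp add: power2_eq_square)
    finally show ?thesis .
  qed
  have "(sv_prod k B)\<^sup>2 \<le> (\<Sum>S | card (S :: 'd set) = k. principal_minor S N)"
    using principal_minor_sum_bounds(1)[OF k, of B] by (simp add: N_def)
  also have "\<dots> \<le> (\<Sum>S | card (S :: 'd set) = k. fact k * (wedge_norm k B)\<^sup>2)"
    by (intro sum_mono pm) auto
  also have "\<dots> = real (card {S :: 'd set. card S = k}) * (fact k * (wedge_norm k B)\<^sup>2)" by simp
  also have "\<dots> \<le> 2 ^ CARD('d) * (fact k * (wedge_norm k B)\<^sup>2)"
  proof (rule mult_right_mono)
    have "card {S :: 'd set. card S = k} \<le> card (Pow (UNIV :: 'd set))" by (intro card_mono) auto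
    then have "card {S :: 'd set. card S = k} \<le> 2 ^ CARD('d)" by (simp add: card_Pow)
    then show "real (card {S :: 'd set. card S = k}) \<le> 2 ^ CARD('d)" by (metis of_nat_le_iff of_nat_numeral of_nat_power)
  qed simp
  also have "\<dots> = (sqrt (2 ^ CARD('d) * fact k) * wedge_norm k B)\<^sup>2" by (simp add: power_mult_distrib)
  finally show ?thesis by (rule power2_le_imp_le) (simp add: wedge_norm_nonneg)
qed

lemma wedge_norm_le_sv_prod:
  fixes B :: "real^'d^'d"
  assumes k: "k \<le> CARD('d)"
  shows "wedge_norm k B \<le> (real (card (index_maps k :: (nat \<Rightarrow> 'd) set)))\<^sup>2 * sqrt (2 ^ CARD('d) * fact k) * sv_prod k B"
proof -
  define N where "N = transpose B ** B"
  have pm0: "principal_minor S N \<ge> 0" if S: "card S = k" for S :: "'d set"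
  proof -
    obtain h where h: "bij_betw h {..<k} S"
      using S ex_bij_betw_nat_finite[of S] by (auto simp: atLeast0LessThan)
    then show ?thesis using minor_eq_principal_minor[of h k N] minor_gram_nonneg[of k h B]
      by (simp add: bij_betw_def N_def)
  qed
  have m: "\<bar>minor k g f B\<bar> \<le> sqrt (2 ^ CARD('d) * fact k) * sv_prod k B"
    if g: "g \<in> index_maps k" for g f :: "nat \<Rightarrow> 'd"
  proof -
    have "(minor k g f B)\<^sup>2 \<le> 2 ^ CARD('d) * fact k * (sv_prod k B)\<^sup>2"
    proof (cases "inj_on f {..<k}")
      case False
      then have "minor k f g (transpose B) = 0" by (rule minor_not_inj)
      then show ?thesis by (simp add: minor_transpose)
    next
      case True
      have "(minor k g f B)\<^sup>2 \<le> (\<Sum>g\<in>index_maps k. (minor k g f B)\<^sup>2)"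
        using g by (intro member_le_sum) auto
      also have "\<dots> = fact k * principal_minor (f ` {..<k}) N"
        unfolding sum_minor_squares[symmetric] minor_eq_principal_minor[OF True] N_def ..
      also have "principal_minor (f ` {..<k}) N \<le> (\<Sum>S | card S = k. principal_minor S N)"
        using pm0 True by (intro member_le_sum) (auto simp: card_image)
      also have "\<dots> \<le> 2 ^ CARD('d) * (sv_prod k B)\<^sup>2"
        using principal_minor_sum_bounds(2)[OF k, of B] by (simp add: N_def)
      finally show ?thesis by (simp add: mult_ac)
    qed
    also have "\<dots> = (sqrt (2 ^ CARD('d) * fact k) * sv_prod k B)\<^sup>2" by (simp add: power_mult_distrib)
    finally have "\<bar>minor k g f B\<bar>\<^sup>2 \<le> (sqrt (2 ^ CARD('d) * fact k) * sv_prod k B)\<^sup>2" by simp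
    then show ?thesis by (rule power2_le_imp_le) (simp add: sv_prod_nonneg[OF k])
  qed
  define c where "c = sqrt (2 ^ CARD('d) * fact k) * sv_prod k B"
  have c0: "c \<ge> 0" by (simp add: c_def sv_prod_nonneg[OF k])
  have "wedge_norm k B \<le> (\<Sum>g\<in>index_maps k. \<Sum>f\<in>index_maps k. \<bar>minor k g f B\<bar>) / 1"
    unfolding wedge_norm_eq by (intro divide_left_mono sum_nonneg) auto
  also have "\<dots> \<le> (\<Sum>g\<in>(index_maps k :: (nat \<Rightarrow> 'd) set). \<Sum>f\<in>(index_maps k :: (nat \<Rightarrow> 'd) set). c)"
    using m by (simp add: sum_mono c_def del: sum_constant)
  also have "\<dots> = (real (card (index_maps k :: (nat \<Rightarrow> 'd) set)))\<^sup>2 * c" by (simp add: power2_eq_square)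
  finally show ?thesis by (simp add: c_def mult_ac)
qed

text \<open>Both quantities are comparable with the square root of the sum of the principal minors of order \<open>k\<close>
  of the Gram matrix.\<close>

lemma wedge_norm_sv_prod_comparable:
  assumes k: "k \<le> CARD('d)"
  shows "\<exists>C\<ge>1. \<forall>B :: real^'d^'d. sv_prod k B \<le> C * wedge_norm k B \<and> wedge_norm k B \<le> C * sv_prod k B"
proof -
  define a where "a = sqrt (2 ^ CARD('d) * fact k)"
  define b where "b = (real (card (index_maps k :: (nat \<Rightarrow> 'd) set)))\<^sup>2 * sqrt (2 ^ CARD('d) * fact k)"
  have ab: "a \<ge> 0" "b \<ge> 0" by (simp_all add: a_def b_def)
  have 1: "sv_prod k B \<le> (1 + a + b) * wedge_norm k B" for B :: "real^'d^'d"
  proof -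
    have "sv_prod k B \<le> a * wedge_norm k B" unfolding a_def by (rule sv_prod_le_wedge_norm[OF k])
    also have "\<dots> \<le> (1 + a + b) * wedge_norm k B" using ab by (intro mult_right_mono wedge_norm_nonneg) auto
    finally show ?thesis .
  qed
  have 2: "wedge_norm k B \<le> (1 + a + b) * sv_prod k B" for B :: "real^'d^'d"
  proof -
    have "wedge_norm k B \<le> b * sv_prod k B" unfolding b_def by (rule wedge_norm_le_sv_prod[OF k])
    also have "\<dots> \<le> (1 + a + b) * sv_prod k B" using ab by (intro mult_right_mono sv_prod_nonneg[OF k]) auto
    finally show ?thesis .
  qed
  show ?thesis by (rule exI[of _ "1 + a + b"]) (use ab 1 2 in auto)
qed

lemma sv_prod_card: "sv_prod CARD('d) (B :: real^'d^'d) = \<bar>det B\<bar>"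
proof -
  let ?N = "transpose B ** B"
  have "(\<Sum>S | card S = CARD('d). principal_minor S ?N) = principal_minor UNIV ?N"
  proof -
    have "{S :: 'd set. card S = CARD('d)} = {UNIV}" by (auto dest: card_eq_UNIV_imp_eq_UNIV[rotated])
    then show ?thesis by simp
  qed
  also have "\<dots> = det ?N" by (simp add: principal_minor_def det_def)
  also have "\<dots> = (det B)\<^sup>2" by (simp add: det_mul power2_eq_square)
  finally have 1: "(\<Sum>S | card S = CARD('d). principal_minor S ?N) = (det B)\<^sup>2" .
  have "{T. T \<subseteq> {..<CARD('d)} \<and> card T = CARD('d)} = {{..<CARD('d)}}"
    by (auto dest!: card_subset_eq[rotated])
  then have "(sv_prod CARD('d) B)\<^sup>2 = (det B)\<^sup>2"
    using principal_minor_sum_eq[of "CARD('d)" B] 1 by (simp add: sv_prod_def prod_power_distrib)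
  then show ?thesis using sv_prod_nonneg[of "CARD('d)" B] by (simp add: power2_eq_iff_nonneg abs_if power2_eq_iff) linarith
qed

lemma singular_value_pos:
  fixes B :: "real^'d^'d"
  assumes "invertible B" "i < CARD('d)"
  shows "singular_values B ! i > 0"
proof -
  have "sv_prod CARD('d) B \<noteq> 0" using assms(1) by (simp add: sv_prod_card invertible_det_nz)
  then have "singular_values B ! i \<noteq> 0" using assms(2) by (auto simp: sv_prod_def)
  then show ?thesis using singular_values_basic(3)[OF assms(2), of B] by simp
qed

lemma sv_prod_pos:
  fixes B :: "real^'d^'d"
  assumes "invertible B" "k \<le> CARD('d)"
  shows "sv_prod k B > 0"
  unfolding sv_prod_def using assms by (intro prod_pos) (auto intro: singular_value_pos)

text \<open>Each of the \<open>d - k\<close> remaining singular values is at most the largest one.\<close>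

lemma det_le_sv_prod:
  fixes B :: "real^'d^'d"
  assumes k: "k \<le> CARD('d)"
  shows "\<bar>det B\<bar> \<le> sv_prod k B * sv_prod 1 B ^ (CARD('d) - k)"
proof -
  have "sv_prod CARD('d) B = sv_prod k B * (\<Prod>i=k..<CARD('d). singular_values B ! i)"
    unfolding sv_prod_def using k
    by (metis atLeast0LessThan le0 prod.atLeastLessThan_concat)
  also have "(\<Prod>i=k..<CARD('d). singular_values B ! i) \<le> (\<Prod>i=k..<CARD('d). singular_values B ! 0)"
    by (intro prod_mono) (auto intro: singular_values_basic)
  also have "\<dots> = sv_prod 1 B ^ (CARD('d) - k)" by (simp add: sv_prod_def)
  finally show ?thesis unfolding sv_prod_card using sv_prod_nonneg[OF k] by (simp add: mult_left_mono)
qed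

text \<open>At \<open>t = 1\<close> the definition of the singular value function switches to the next integer, or to the
  determinant if \<open>k + 1 = d\<close>; since all singular values are positive, the same formula persists.\<close>

lemma svf_strip:
  fixes B :: "real^'d^'d"
  assumes B: "invertible B" and k: "k < CARD('d)" and t: "0 \<le> t" "t \<le> 1"
  shows "svf (real k + t) B = sv_prod k B powr (1 - t) * sv_prod (Suc k) B powr t"
proof -
  have P: "(\<Prod>i = 1..n. singular_value B i) = sv_prod n B" for n
    unfolding sv_prod_def singular_value_def
    by (rule prod.reindex_bij_witness[of _ Suc "\<lambda>i. i - 1"]) auto
  have pk: "sv_prod k B > 0" "sv_prod (Suc k) B > 0" using sv_prod_pos[OF B] k by auto
  show ?thesis
  proof (cases "t = 1")
    case False
    then have fl: "nat \<lfloor>real k + t\<rfloor> = k" using t by (simp add: floor_eq_iff nat_eq_iff)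
    have lt: "real k + t < real CARD('d)" using k t False by linarith
    have "svf (real k + t) B =
        (\<Prod>i = 1..k. singular_value B i) * singular_value B (k + 1) powr (real k + t - real k)"
      using lt by (simp only: svf_def fl Let_def if_True)
    also have "\<dots> = sv_prod k B * (singular_values B ! k) powr t"
      by (simp only: P) (simp add: singular_value_def)
    also have "\<dots> = sv_prod k B powr (1 - t) * sv_prod (Suc k) B powr t"
    proof -
      have "sv_prod (Suc k) B powr t = sv_prod k B powr t * (singular_values B ! k) powr t"
        unfolding sv_prod_def using pk singular_values_basic(3)[OF k, of B]
        by (simp add: powr_mult sv_prod_def)
      then show ?thesis using pk by (simp add: powr_add[symmetric] mult.assoc[symmetric])
    qed
    finally show ?thesis .
  next
    case True
    show ?thesis
    proof (cases "Suc k < CARD('d)")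
      case S: True
      have fl: "nat \<lfloor>real k + t\<rfloor> = Suc k" using True by simp
      have "singular_values B ! Suc k > 0" by (rule singular_value_pos[OF B S])
      have lt: "real k + t < real CARD('d)" using S True by simp
      have "svf (real k + t) B =
          (\<Prod>i = 1..Suc k. singular_value B i) * singular_value B (Suc k + 1) powr (real k + t - real (Suc k))"
        using lt by (simp only: svf_def fl Let_def if_True)
      also have "\<dots> = sv_prod (Suc k) B"
        using \<open>singular_values B ! Suc k > 0\<close> True by (simp only: P) (simp add: singular_value_def)
      finally show ?thesis using True pk by simp
    next
      case False
      then have e: "real k + t = real CARD('d)" "Suc k = CARD('d)" using k True by auto
      have "svf (real k + t) B = \<bar>det B\<bar> powr 1" unfolding e(1) svf_def by simp
      then show ?thesis using True pk by (simp add: e(2) sv_prod_card)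
    qed
  qed
qed

section \<open>Growth of the compound norms along words\<close>

lemma wedge_norm_pos:
  fixes B :: "real^'d^'d"
  assumes "invertible B" "k \<le> CARD('d)"
  shows "wedge_norm k B > 0"
proof -
  obtain C where C: "C \<ge> 1" "\<And>B :: real^'d^'d. sv_prod k B \<le> C * wedge_norm k B"
    using wedge_norm_sv_prod_comparable[OF assms(2)] by blast
  have "0 < C * wedge_norm k B" using sv_prod_pos[OF assms] C(2)[of B] by linarith
  then show ?thesis using C(1) by (simp add: zero_less_mult_iff)
qed

lemma det_word_prod: "det (word_prod A w) = (\<Prod>i\<leftarrow>w. det (A $ i))"
  by (induction w) (auto simp: det_mul)

lemma invertible_word_prod: "A \<in> GL_tuples \<Longrightarrow> invertible (word_prod A w)"
  by (auto simp: invertible_det_nz det_word_prod prod_list_zero_iff GL_tuples_def)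

lemma wedge_norm_word_prod_le:
  fixes A :: "real^'d^'d^'m"
  assumes "w \<noteq> []"
  shows "wedge_norm k (word_prod A w) \<le> (\<Sum>i\<in>UNIV. wedge_norm k (A $ i)) ^ length w"
  using assms
proof (induction w)
  case (Cons i w)
  let ?s = "\<Sum>i\<in>UNIV. wedge_norm k (A $ i)"
  have i: "wedge_norm k (A $ i) \<le> ?s" by (intro member_le_sum) (auto simp: wedge_norm_nonneg)
  show ?case
  proof (cases "w = []")
    case True
    then show ?thesis using i by simp
  next
    case False
    have "wedge_norm k (word_prod A (i # w)) \<le> wedge_norm k (word_prod A w) * wedge_norm k (A $ i)"
      by (simp add: wedge_norm_mult_le)
    also have "\<dots> \<le> ?s ^ length w * ?s"
      using Cons.IH[OF False] i wedge_norm_nonneg by (intro mult_mono) (auto intro!: zero_le_power sum_nonneg)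
    finally show ?thesis by (simp add: mult.commute)
  qed
qed simp

text \<open>Every letter satisfies \<open>1 \<le> q \<bar>det (A $ i)\<bar>\<close> with \<open>q\<close> the sum of the reciprocals. A sum is used in place of a
  maximum because it is visibly continuous in the matrices.\<close>

lemma det_word_prod_ge:
  fixes A :: "real^'d^'d^'m"
  assumes "A \<in> GL_tuples"
  shows "1 \<le> (\<Sum>i\<in>UNIV. 1 / \<bar>det (A $ i)\<bar>) ^ length w * \<bar>det (word_prod A w)\<bar>"
proof (induction w)
  case (Cons i w)
  let ?s = "\<Sum>i\<in>UNIV. 1 / \<bar>det (A $ i)\<bar>"
  have d: "\<bar>det (A $ i)\<bar> > 0" using assms by (simp add: GL_tuples_def invertible_det_nz)
  have "1 / \<bar>det (A $ i)\<bar> \<le> ?s" by (intro member_le_sum) auto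
  then have "1 \<le> ?s * \<bar>det (A $ i)\<bar>" using d by (simp add: field_simps)
  then have "1 * 1 \<le> (?s * \<bar>det (A $ i)\<bar>) * (?s ^ length w * \<bar>det (word_prod A w)\<bar>)"
    using Cons.IH by (intro mult_mono) auto
  then show ?case by (simp add: det_mul abs_mult mult_ac)
qed simp

text \<open>An exponential rate bounding \<open>wedge_norm k\<close> of the products along words from above and from below
  (\<open>wedge_norm_growth\<close>). It is a crude rate whose continuity in the matrices is evident.\<close>

definition growth_rate :: "nat \<Rightarrow> real^'d^'d^'m \<Rightarrow> real" where
  "growth_rate k A = \<bar>ln (\<Sum>i\<in>UNIV. wedge_norm k (A $ i))\<bar>
     + real CARD('d) * \<bar>ln (\<Sum>i\<in>UNIV. wedge_norm 1 (A $ i))\<bar> + \<bar>ln (\<Sum>i\<in>UNIV. 1 / \<bar>det (A $ i)\<bar>)\<bar>"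

lemma continuous_on_det: "continuous_on X N \<Longrightarrow> continuous_on X (\<lambda>A. det (N A :: real^'d^'d))"
  unfolding det_def by (intro continuous_intros)

lemma sum_wedge_norm_pos:
  fixes A :: "real^'d^'d^'m"
  assumes "A \<in> GL_tuples" "k \<le> CARD('d)"
  shows "(\<Sum>i\<in>UNIV. wedge_norm k (A $ i)) > 0"
  using assms by (intro sum_pos) (auto simp: GL_tuples_def intro: wedge_norm_pos)

lemma sum_inverse_det_pos:
  fixes A :: "real^'d^'d^'m"
  assumes "A \<in> GL_tuples"
  shows "(\<Sum>i\<in>UNIV. 1 / \<bar>det (A $ i)\<bar>) > 0"
  using assms by (intro sum_pos) (auto simp: GL_tuples_def invertible_det_nz)

lemma continuous_on_growth_rate:
  assumes "k \<le> CARD('d)"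
  shows "continuous_on GL_tuples (growth_rate k :: real^'d^'d^'m \<Rightarrow> real)"
proof -
  have nz: "det (A $ i) \<noteq> 0" if "A \<in> GL_tuples" for A :: "real^'d^'d^'m" and i
    using that by (auto simp: GL_tuples_def invertible_det_nz)
  have 1: "(1 :: nat) \<le> CARD('d)" by (simp add: Suc_le_eq)
  have ln_cont: "continuous_on GL_tuples (\<lambda>A :: real^'d^'d^'m. ln (\<Sum>i\<in>UNIV. wedge_norm j (A $ i)))"
    if "j \<le> CARD('d)" for j
  proof (rule continuous_on_ln)
    show "continuous_on GL_tuples (\<lambda>A :: real^'d^'d^'m. \<Sum>i\<in>UNIV. wedge_norm j (A $ i))"
      by (intro continuous_on_sum continuous_on_wedge_norm continuous_intros)
    show "\<forall>A\<in>GL_tuples. (\<Sum>i\<in>UNIV. wedge_norm j ((A :: real^'d^'d^'m) $ i)) \<noteq> 0"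
      using sum_wedge_norm_pos[OF _ that] by (metis less_irrefl)
  qed
  have ln_cont': "continuous_on GL_tuples (\<lambda>A :: real^'d^'d^'m. ln (\<Sum>i\<in>UNIV. 1 / \<bar>det (A $ i)\<bar>))"
  proof (rule continuous_on_ln)
    show "continuous_on GL_tuples (\<lambda>A :: real^'d^'d^'m. \<Sum>i\<in>UNIV. 1 / \<bar>det (A $ i)\<bar>)"
      by (intro continuous_on_sum continuous_on_divide continuous_on_rabs continuous_on_det continuous_intros)
        (simp add: nz)
    show "\<forall>A\<in>GL_tuples. (\<Sum>i\<in>UNIV. 1 / \<bar>det ((A :: real^'d^'d^'m) $ i)\<bar>) \<noteq> 0"
      using sum_inverse_det_pos by (metis less_irrefl)
  qed
  show ?thesis
    unfolding growth_rate_def[abs_def]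
    by (intro continuous_on_add continuous_on_mult continuous_on_rabs continuous_on_const ln_cont ln_cont' assms 1)
qed

lemma growth_rate_nonneg: "growth_rate k A \<ge> 0"
  by (simp add: growth_rate_def)

text \<open>The upper bound is submultiplicativity. The lower bound combines the lower bound on the determinant
  with \<open>\<bar>det B\<bar> \<le> \<alpha>\<^sub>1 \<dots> \<alpha>\<^sub>k \<cdot> \<alpha>\<^sub>1\<^sup>d\<^sup>-\<^sup>k\<close> and the upper bound on \<open>\<alpha>\<^sub>1\<close>.\<close>

lemma wedge_norm_growth:
  assumes k: "k \<le> CARD('d)"
  shows "\<exists>c\<ge>0. \<forall>(A :: real^'d^'d^'m) w. A \<in> GL_tuples \<longrightarrow> w \<noteq> [] \<longrightarrow>
       \<bar>ln (wedge_norm k (word_prod A w))\<bar> \<le> real (length w) * growth_rate k A + c"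
proof -
  have one: "(1 :: nat) \<le> CARD('d)" by (simp add: Suc_le_eq)
  obtain C where C: "C \<ge> 1" "\<And>B :: real^'d^'d. sv_prod k B \<le> C * wedge_norm k B"
    using wedge_norm_sv_prod_comparable[OF k] by blast
  obtain C1 where C1: "C1 \<ge> 1" "\<And>B :: real^'d^'d. sv_prod 1 B \<le> C1 * wedge_norm 1 B"
    using wedge_norm_sv_prod_comparable[OF one] by blast
  define c where "c = ln C + real CARD('d) * ln C1"
  have c0: "c \<ge> 0" using C(1) C1(1) by (simp add: c_def)
  have "\<bar>ln (wedge_norm k (word_prod A w))\<bar> \<le> real (length w) * growth_rate k A + c"
    if A: "A \<in> GL_tuples" and w: "w \<noteq> []" for A :: "real^'d^'d^'m" and w
  proof -
    define n where "n = length w"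
    define s where "s = (\<Sum>i\<in>UNIV. wedge_norm k (A $ i))"
    define s1 where "s1 = (\<Sum>i\<in>UNIV. wedge_norm 1 (A $ i))"
    define q where "q = (\<Sum>i\<in>UNIV. 1 / \<bar>det (A $ i)\<bar>)"
    define m where "m = CARD('d) - k"
    let ?B = "word_prod A w"
    have inv: "invertible ?B" by (rule invertible_word_prod[OF A])
    have pos: "s > 0" "s1 > 0" "q > 0" "wedge_norm k ?B > 0"
      unfolding s_def s1_def q_def
      using A k one inv by (auto intro: sum_wedge_norm_pos sum_inverse_det_pos wedge_norm_pos)
    have gr: "growth_rate k A = \<bar>ln s\<bar> + real CARD('d) * \<bar>ln s1\<bar> + \<bar>ln q\<bar>"
      by (simp add: growth_rate_def s_def s1_def q_def)
    have "ln (wedge_norm k ?B) \<le> ln (s ^ n)"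
      using pos wedge_norm_word_prod_le[OF w, of k A] by (subst ln_le_cancel_iff) (auto simp: s_def n_def)
    also have "\<dots> = real n * ln s" using pos by (simp add: ln_realpow)
    also have "\<dots> \<le> real n * growth_rate k A"
    proof (rule mult_left_mono)
      have "0 \<le> real CARD('d) * \<bar>ln s1\<bar>" by simp
      then show "ln s \<le> growth_rate k A" unfolding gr by linarith
    qed simp
    finally have up: "ln (wedge_norm k ?B) \<le> real n * growth_rate k A + c" using c0 by simp
    have "1 \<le> q ^ n * \<bar>det ?B\<bar>" using det_word_prod_ge[OF A, of w] by (simp add: q_def n_def)
    also have "\<bar>det ?B\<bar> \<le> sv_prod k ?B * sv_prod 1 ?B ^ m"
      unfolding m_def by (rule det_le_sv_prod[OF k])
    also have "\<dots> \<le> (C * wedge_norm k ?B) * (C1 * s1 ^ n) ^ m"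
    proof (intro mult_mono power_mono C(2))
      have "sv_prod 1 ?B \<le> C1 * wedge_norm 1 ?B" by (rule C1(2))
      also have "\<dots> \<le> C1 * s1 ^ n"
        using C1(1) wedge_norm_word_prod_le[OF w, of 1 A] by (intro mult_left_mono) (auto simp: s1_def n_def)
      finally show "sv_prod 1 ?B \<le> C1 * s1 ^ n" .
    qed (use sv_prod_nonneg[OF one, of ?B] C(1) pos in auto)
    finally have "1 \<le> q ^ n * (C * wedge_norm k ?B * (C1 * s1 ^ n) ^ m)"
      using pos by (simp add: mult_left_mono)
    then have "ln 1 \<le> ln (q ^ n * (C * wedge_norm k ?B * (C1 * s1 ^ n) ^ m))"
      by (subst ln_le_cancel_iff) auto
    also have "\<dots> = real n * ln q + (ln C + ln (wedge_norm k ?B) + real m * (ln C1 + real n * ln s1))"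
      using pos C(1) C1(1) by (simp add: ln_mult ln_realpow)
    finally have "- ln (wedge_norm k ?B) \<le> real n * ln q + ln C + real m * ln C1 + real n * (real m * ln s1)"
      by (simp add: algebra_simps)
    also have "\<dots> \<le> real n * \<bar>ln q\<bar> + ln C + real CARD('d) * ln C1 + real n * (real CARD('d) * \<bar>ln s1\<bar>)"
    proof -
      have m: "real m \<le> real CARD('d)" by (simp add: m_def)
      have "real m * ln C1 \<le> real CARD('d) * ln C1" using m C1(1) by (intro mult_right_mono) auto
      moreover have "real n * ln q \<le> real n * \<bar>ln q\<bar>" by (intro mult_left_mono) auto
      moreover have "real n * (real m * ln s1) \<le> real n * (real m * \<bar>ln s1\<bar>)" by (intro mult_left_mono) auto
      moreover have "real n * (real m * \<bar>ln s1\<bar>) \<le> real n * (real CARD('d) * \<bar>ln s1\<bar>)"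
        using m by (intro mult_left_mono mult_right_mono) auto
      ultimately show ?thesis by linarith
    qed
    also have "\<dots> \<le> real n * growth_rate k A + c"
      unfolding gr c_def by (simp add: algebra_simps)
    finally show ?thesis using up by (simp add: n_def)
  qed
  then show ?thesis using c0 by blast
qed

section \<open>The pressure between consecutive integers\<close>

definition strip_sum :: "nat \<Rightarrow> nat \<Rightarrow> real^'d^'d^'m \<Rightarrow> real \<Rightarrow> real" where
  "strip_sum k n A t = (\<Sum>w\<in>words UNIV n.
     wedge_norm k (word_prod A w) powr (1 - t) * wedge_norm (Suc k) (word_prod A w) powr t)"

lemma word_prod_append: "word_prod A (u @ v) = word_prod A v ** word_prod A u"
  by (induction u) (auto simp: matrix_mul_assoc)

lemma words_UNIV_nonempty: "words (UNIV :: 'm set) n \<noteq> {}"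
proof -
  have "replicate n undefined \<in> words (UNIV :: 'm set) n" by (simp add: words_def)
  then show ?thesis by blast
qed

lemma strip_sum_pos:
  fixes A :: "real^'d^'d^'m"
  assumes "A \<in> GL_tuples" "k < CARD('d)"
  shows "strip_sum k n A t > 0"
  unfolding strip_sum_def
proof (rule sum_pos)
  fix w :: "'m list"
  have "wedge_norm k (word_prod A w) > 0" "wedge_norm (Suc k) (word_prod A w) > 0"
    using assms by (auto intro: wedge_norm_pos invertible_word_prod)
  then show "wedge_norm k (word_prod A w) powr (1 - t) * wedge_norm (Suc k) (word_prod A w) powr t > 0"
    by simp
qed (simp_all add: words_UNIV_nonempty)

lemma strip_sum_submult:
  fixes A :: "real^'d^'d^'m"
  assumes "A \<in> GL_tuples" "k < CARD('d)" "0 \<le> t" "t \<le> 1"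
  shows "strip_sum k (m + n) A t \<le> strip_sum k m A t * strip_sum k n A t"
proof -
  have "wedge_norm k (word_prod A (u @ v)) powr (1 - t) * wedge_norm (Suc k) (word_prod A (u @ v)) powr t \<le>
     (wedge_norm k (word_prod A u) powr (1 - t) * wedge_norm (Suc k) (word_prod A u) powr t) *
     (wedge_norm k (word_prod A v) powr (1 - t) * wedge_norm (Suc k) (word_prod A v) powr t)" for u v
  proof -
    have le: "wedge_norm j (word_prod A (u @ v)) powr r \<le>
       wedge_norm j (word_prod A u) powr r * wedge_norm j (word_prod A v) powr r" if "r \<ge> 0" for j r
    proof -
      have "wedge_norm j (word_prod A (u @ v)) \<le> wedge_norm j (word_prod A v) * wedge_norm j (word_prod A u)"
        unfolding word_prod_append by (rule wedge_norm_mult_le)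
      then have "wedge_norm j (word_prod A (u @ v)) powr r \<le> (wedge_norm j (word_prod A v) * wedge_norm j (word_prod A u)) powr r"
        using that wedge_norm_nonneg by (intro powr_mono2) auto
      then show ?thesis by (simp add: powr_mult wedge_norm_nonneg mult.commute)
    qed
    have "wedge_norm k (word_prod A (u @ v)) powr (1 - t) * wedge_norm (Suc k) (word_prod A (u @ v)) powr t \<le>
      (wedge_norm k (word_prod A u) powr (1 - t) * wedge_norm k (word_prod A v) powr (1 - t)) *
      (wedge_norm (Suc k) (word_prod A u) powr t * wedge_norm (Suc k) (word_prod A v) powr t)"
      using assms by (intro mult_mono le) auto
    then show ?thesis by (simp add: mult_ac)
  qed
  then show ?thesis unfolding strip_sum_def sum_words_add[OF finite] sum_product by (intro sum_mono)
qed

text \<open>Each summand is \<open>exp ((1 - t) a + t b)\<close>, where \<open>a\<close> and \<open>b\<close> are logarithms of compound norms, hence of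
  size \<open>O(n)\<close>. A change of \<open>t\<close> multiplies it by \<open>exp\<close> of the change times \<open>b - a\<close>. The second part keeps
  \<open>(1/n) ln S\<^sub>n\<close> bounded below, as Fekete's lemma requires.\<close>

lemma strip_sum_exponent_change:
  assumes k: "k < CARD('d)"
  shows "\<exists>c\<ge>0. \<forall>(A :: real^'d^'d^'m) n. A \<in> GL_tuples \<longrightarrow> n \<ge> 1 \<longrightarrow>
       (\<forall>s t. ln (strip_sum k n A s) \<le> ln (strip_sum k n A t) +
          \<bar>s - t\<bar> * (real n * (growth_rate k A + growth_rate (Suc k) A) + c)) \<and>
       (\<forall>t\<in>{0..1}. - (growth_rate k A + growth_rate (Suc k) A + c) * real n \<le> ln (strip_sum k n A t))"
proof -
  obtain c0 where c0: "c0 \<ge> 0" "\<And>(A :: real^'d^'d^'m) w. A \<in> GL_tuples \<Longrightarrow> w \<noteq> [] \<Longrightarrow>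
       \<bar>ln (wedge_norm k (word_prod A w))\<bar> \<le> real (length w) * growth_rate k A + c0"
    using wedge_norm_growth[of k, where 'd = 'd and 'm = 'm] k by auto
  obtain c1 where c1: "c1 \<ge> 0" "\<And>(A :: real^'d^'d^'m) w. A \<in> GL_tuples \<Longrightarrow> w \<noteq> [] \<Longrightarrow>
       \<bar>ln (wedge_norm (Suc k) (word_prod A w))\<bar> \<le> real (length w) * growth_rate (Suc k) A + c1"
    using wedge_norm_growth[of "Suc k", where 'd = 'd and 'm = 'm] k by auto
  define c where "c = c0 + c1"
  have c: "c \<ge> 0" using c0 c1 by (simp add: c_def)
  have part: "wedge_norm k (word_prod A w) powr (1 - s) * wedge_norm (Suc k) (word_prod A w) powr s =
      exp ((1 - s) * ln (wedge_norm k (word_prod A w)) + s * ln (wedge_norm (Suc k) (word_prod A w)))"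
    if A: "A \<in> GL_tuples" for A :: "real^'d^'d^'m" and w s
    using wedge_norm_pos[OF invertible_word_prod[OF A], of _ w] k
    by (simp add: powr_def exp_add less_imp_neq[symmetric])
  have 1: "ln (strip_sum k n A s) \<le> ln (strip_sum k n A t) +
         \<bar>s - t\<bar> * (real n * (growth_rate k A + growth_rate (Suc k) A) + c)"
    if A: "A \<in> GL_tuples" and n: "n \<ge> 1" for A :: "real^'d^'d^'m" and n s t
  proof -
    define r where "r = \<bar>s - t\<bar> * (real n * (growth_rate k A + growth_rate (Suc k) A) + c)"
    have "strip_sum k n A s \<le> strip_sum k n A t * exp r"
      unfolding strip_sum_def sum_distrib_right
    proof (rule sum_mono)
      fix w :: "'m list" assume "w \<in> words UNIV n"
      then have w: "w \<noteq> []" "length w = n" using n by (auto simp: words_def)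
      define a where "a = ln (wedge_norm k (word_prod A w))"
      define b where "b = ln (wedge_norm (Suc k) (word_prod A w))"
      have ab: "\<bar>b - a\<bar> \<le> real n * (growth_rate k A + growth_rate (Suc k) A) + c"
        using c0(2)[OF A w(1)] c1(2)[OF A w(1)] by (simp add: a_def b_def c_def w algebra_simps abs_le_iff)
      have "(1 - s) * a + s * b = (1 - t) * a + t * b + (s - t) * (b - a)" by (simp add: algebra_simps)
      also have "(s - t) * (b - a) \<le> r"
      proof -
        have "(s - t) * (b - a) \<le> \<bar>s - t\<bar> * \<bar>b - a\<bar>"
          unfolding abs_mult[symmetric] by (rule abs_ge_self)
        also have "\<dots> \<le> r" unfolding r_def by (intro mult_left_mono ab) auto
        finally show ?thesis .
      qed
      finally have "(1 - s) * a + s * b \<le> ((1 - t) * a + t * b) + r" by simp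
      then show "wedge_norm k (word_prod A w) powr (1 - s) * wedge_norm (Suc k) (word_prod A w) powr s \<le>
        wedge_norm k (word_prod A w) powr (1 - t) * wedge_norm (Suc k) (word_prod A w) powr t * exp r"
        unfolding part[OF A] a_def[symmetric] b_def[symmetric] exp_add[symmetric] by simp
    qed
    then have "ln (strip_sum k n A s) \<le> ln (strip_sum k n A t * exp r)"
      using strip_sum_pos[OF A k] by (subst ln_le_cancel_iff) auto
    also have "\<dots> = ln (strip_sum k n A t) + r"
      using strip_sum_pos[OF A k, of n t] by (simp add: ln_mult)
    finally show ?thesis unfolding r_def .
  qed
  have 2: "- (growth_rate k A + growth_rate (Suc k) A + c) * real n \<le> ln (strip_sum k n A t)"
    if A: "A \<in> GL_tuples" and n: "n \<ge> 1" and t: "0 \<le> t" "t \<le> 1" for A :: "real^'d^'d^'m" and n t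
  proof -
    obtain w where w: "w \<in> words (UNIV :: 'm set) n" using words_UNIV_nonempty by blast
    then have w': "w \<noteq> []" "length w = n" using n by (auto simp: words_def)
    define a where "a = ln (wedge_norm k (word_prod A w))"
    define b where "b = ln (wedge_norm (Suc k) (word_prod A w))"
    have a: "- a \<le> real n * growth_rate k A + c0" and b: "- b \<le> real n * growth_rate (Suc k) A + c1"
      using c0(2)[OF A w'(1)] c1(2)[OF A w'(1)] by (simp_all add: a_def b_def w')
    have nn: "real n * growth_rate k A + c0 \<ge> 0" "real n * growth_rate (Suc k) A + c1 \<ge> 0"
      using c0(1) c1(1) by (simp_all add: growth_rate_nonneg)
    have "(1 - t) * (- a) \<le> (1 - t) * (real n * growth_rate k A + c0)"
      using t by (intro mult_left_mono[OF a]) auto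
    moreover have "(1 - t) * (real n * growth_rate k A + c0) \<le> 1 * (real n * growth_rate k A + c0)"
      using t by (intro mult_right_mono[OF _ nn(1)]) auto
    moreover have "t * (- b) \<le> t * (real n * growth_rate (Suc k) A + c1)"
      using t by (intro mult_left_mono[OF b]) auto
    moreover have "t * (real n * growth_rate (Suc k) A + c1) \<le> 1 * (real n * growth_rate (Suc k) A + c1)"
      using t by (intro mult_right_mono[OF _ nn(2)]) auto
    moreover have "c \<le> real n * c" using n c by (simp add: mult_le_cancel_right1)
    ultimately have "- (growth_rate k A + growth_rate (Suc k) A + c) * real n \<le> (1 - t) * a + t * b"
      by (simp add: c_def algebra_simps)
    also have "\<dots> = ln (wedge_norm k (word_prod A w) powr (1 - t) * wedge_norm (Suc k) (word_prod A w) powr t)"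
      unfolding part[OF A] by (simp add: a_def b_def)
    also have "\<dots> \<le> ln (strip_sum k n A t)"
    proof (subst ln_le_cancel_iff)
      show "0 < wedge_norm k (word_prod A w) powr (1 - t) * wedge_norm (Suc k) (word_prod A w) powr t"
        unfolding part[OF A] by simp
      show "wedge_norm k (word_prod A w) powr (1 - t) * wedge_norm (Suc k) (word_prod A w) powr t \<le> strip_sum k n A t"
        unfolding strip_sum_def using w by (intro member_le_sum) auto
    qed (rule strip_sum_pos[OF A k])
    finally show ?thesis .
  qed
  show ?thesis using c 1 2 by (intro exI[of _ c]) auto
qed

text \<open>The sums of the singular value function and \<open>strip_sum\<close> differ by bounded factors, which disappear
  in the limit.\<close>

lemma strip_pressure_limit:
  fixes A :: "real^'d^'d^'m"
  assumes A: "A \<in> GL_tuples" and k: "k < CARD('d)" and t: "0 \<le> t" "t \<le> 1"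
  shows "(\<lambda>n. ln (strip_sum k n A t) / real n) \<longlonglongrightarrow> pressure A (real k + t)"
proof -
  define S where "S n = strip_sum k n A t" for n
  define Z where "Z n = (\<Sum>w\<in>{w :: 'm list. length w = n}. svf (real k + t) (word_prod A w))" for n
  have pos: "S n > 0" for n unfolding S_def by (rule strip_sum_pos[OF A k])
  obtain c where c: "c \<ge> 0" "\<And>n. n \<ge> 1 \<Longrightarrow> - (growth_rate k A + growth_rate (Suc k) A + c) * real n \<le> ln (S n)"
    using strip_sum_exponent_change[OF k, where 'm = 'm] A t unfolding S_def by (metis atLeastAtMost_iff)
  have sub: "ln (S (m + n)) \<le> ln (S m) + ln (S n)" for m n
  proof -
    have "ln (S (m + n)) \<le> ln (S m * S n)"
      using pos strip_sum_submult[OF A k t] by (subst ln_le_cancel_iff) (auto simp: S_def)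
    then show ?thesis using pos[of m] pos[of n] by (simp add: ln_mult)
  qed
  obtain l where l: "(\<lambda>n. ln (S n) / real n) \<longlonglongrightarrow> l"
    using fekete[of "\<lambda>n. ln (S n)", OF sub c(2)] by blast
  obtain C where C: "C \<ge> 1" "\<And>B :: real^'d^'d. sv_prod k B \<le> C * wedge_norm k B"
    "\<And>B :: real^'d^'d. wedge_norm k B \<le> C * sv_prod k B"
    using wedge_norm_sv_prod_comparable[of k, where 'd = 'd] k by auto
  obtain C' where C': "C' \<ge> 1" "\<And>B :: real^'d^'d. sv_prod (Suc k) B \<le> C' * wedge_norm (Suc k) B"
    "\<And>B :: real^'d^'d. wedge_norm (Suc k) B \<le> C' * sv_prod (Suc k) B"
    using wedge_norm_sv_prod_comparable[of "Suc k", where 'd = 'd] k by auto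
  define c1 where "c1 = C powr (1 - t) * C' powr t"
  have c1: "c1 > 0" using C(1) C'(1) by (simp add: c1_def)
  \<comment> \<open>Two-sided bounds on both factors pass to their weighted geometric mean.\<close>
  have interp: "x powr (1 - t) * y powr t \<le> c1 * (x' powr (1 - t) * y' powr t)"
    if "0 \<le> x" "0 \<le> y" "x \<le> C * x'" "y \<le> C' * y'" "0 \<le> x'" "0 \<le> y'" for x y x' y'
  proof -
    have "x powr (1 - t) * y powr t \<le> (C * x') powr (1 - t) * (C' * y') powr t"
      using that t by (intro mult_mono powr_mono2) auto
    also have "\<dots> = c1 * (x' powr (1 - t) * y' powr t)"
      using that C(1) C'(1) by (simp add: powr_mult c1_def)
    finally show ?thesis .
  qed
  have Zeq: "Z n = (\<Sum>w\<in>words UNIV n. sv_prod k (word_prod A w) powr (1 - t) * sv_prod (Suc k) (word_prod A w) powr t)" for n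
    unfolding Z_def words_def by (intro sum.cong) (auto simp: svf_strip[OF invertible_word_prod[OF A] k t])
  have ZS: "Z n \<le> c1 * S n" and SZ: "S n \<le> c1 * Z n" for n
    unfolding Zeq S_def strip_sum_def sum_distrib_left
    using k by (intro sum_mono interp C C' sv_prod_nonneg wedge_norm_nonneg; simp)+
  have Zpos: "Z n > 0" for n using SZ[of n] pos[of n] c1 by (meson less_le_trans zero_less_mult_pos)
  have upper: "ln (Z n) \<le> ln c1 + ln (S n)" for n
  proof -
    have "ln (Z n) \<le> ln (c1 * S n)" using ZS[of n] pos[of n] Zpos[of n] c1 by (subst ln_le_cancel_iff) auto
    then show ?thesis using c1 pos[of n] by (simp add: ln_mult)
  qed
  have lower: "ln (S n) - ln c1 \<le> ln (Z n)" for n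
  proof -
    have "ln (S n) \<le> ln (c1 * Z n)" using SZ[of n] pos[of n] Zpos[of n] c1 by (subst ln_le_cancel_iff) auto
    then show ?thesis using c1 Zpos[of n] by (simp add: ln_mult)
  qed
  have "(\<lambda>n. ln (Z n) / real n) \<longlonglongrightarrow> l"
  proof (rule tendsto_sandwich)
    show "\<forall>\<^sub>F n in sequentially. ln (S n) / real n - ln c1 / real n \<le> ln (Z n) / real n"
      using lower by (simp add: diff_divide_distrib[symmetric] divide_right_mono)
    show "\<forall>\<^sub>F n in sequentially. ln (Z n) / real n \<le> ln c1 / real n + ln (S n) / real n"
      using upper by (simp add: add_divide_distrib[symmetric] divide_right_mono)
    show "(\<lambda>n. ln (S n) / real n - ln c1 / real n) \<longlonglongrightarrow> l"
      using tendsto_diff[OF l lim_const_over_n[of "ln c1"]] by simp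
    show "(\<lambda>n. ln c1 / real n + ln (S n) / real n) \<longlonglongrightarrow> l"
      using tendsto_add[OF lim_const_over_n[of "ln c1"] l] by simp
  qed
  then have "pressure A (real k + t) = l"
    unfolding pressure_def Z_def by (intro limI) simp
  then show ?thesis using l by (simp add: S_def)
qed

lemma pressure_strip_Lipschitz:
  fixes A :: "real^'d^'d^'m"
  assumes A: "A \<in> GL_tuples" and k: "k < CARD('d)" and st: "s \<in> {0..1}" "t \<in> {0..1}"
  shows "\<bar>pressure A (real k + s) - pressure A (real k + t)\<bar> \<le> (growth_rate k A + growth_rate (Suc k) A) * \<bar>s - t\<bar>"
proof -
  define g where "g = growth_rate k A + growth_rate (Suc k) A"
  obtain c where c: "\<And>n s t. n \<ge> 1 \<Longrightarrow> ln (strip_sum k n A s) \<le> ln (strip_sum k n A t) + \<bar>s - t\<bar> * (real n * g + c)"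
    using strip_sum_exponent_change[OF k, where 'm = 'm] A unfolding g_def by metis
  have le: "pressure A (real k + s) \<le> pressure A (real k + t) + \<bar>s - t\<bar> * g"
    if st: "s \<in> {0..1}" "t \<in> {0..1}" for s t
  proof (rule tendsto_le)
    show "(\<lambda>n. ln (strip_sum k n A s) / real n) \<longlonglongrightarrow> pressure A (real k + s)"
      using st by (intro strip_pressure_limit[OF A k]) auto
    have "(\<lambda>n. ln (strip_sum k n A t) / real n + (\<bar>s - t\<bar> * g + \<bar>s - t\<bar> * c / real n)) \<longlonglongrightarrow>
       pressure A (real k + t) + (\<bar>s - t\<bar> * g + 0)"
      using st by (intro tendsto_add tendsto_const strip_pressure_limit[OF A k] lim_const_over_n) auto
    then show "(\<lambda>n. ln (strip_sum k n A t) / real n + (\<bar>s - t\<bar> * g + \<bar>s - t\<bar> * c / real n)) \<longlonglongrightarrow>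
       pressure A (real k + t) + \<bar>s - t\<bar> * g" by simp
    show "\<forall>\<^sub>F n in sequentially. ln (strip_sum k n A s) / real n \<le>
       ln (strip_sum k n A t) / real n + (\<bar>s - t\<bar> * g + \<bar>s - t\<bar> * c / real n)"
      using eventually_ge_at_top[of 1]
    proof eventually_elim
      case (elim n)
      have "ln (strip_sum k n A s) / real n \<le> (ln (strip_sum k n A t) + \<bar>s - t\<bar> * (real n * g + c)) / real n"
        by (intro divide_right_mono c elim) auto
      also have "\<dots> = ln (strip_sum k n A t) / real n + (\<bar>s - t\<bar> * g + \<bar>s - t\<bar> * c / real n)"
        using elim by (simp add: field_simps)
      finally show ?case .
    qed
  qed simp
  show ?thesis using le[OF st] le[OF st(2,1)] unfolding g_def[symmetric] by (simp add: abs_minus_commute mult.commute abs_le_iff)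
qed

text \<open>For \<open>t = b/N\<close> the summands of \<open>strip_sum\<close> are powers, with exponent \<open>1/N\<close>, of entry sums of the Kronecker product
  of \<open>b\<close> compounds of order \<open>k + 1\<close> and \<open>N - b\<close> compounds of order \<open>k\<close>.\<close>

lemma pressure_continuous_rational:
  fixes k b N :: nat
  assumes k: "k < CARD('d)" and b: "b \<le> N" and N: "N \<ge> 1"
  shows "continuous_on GL_tuples (\<lambda>A :: real^'d^'d^'m. pressure A (real k + real b / real N))"
proof -
  define \<kappa> where "\<kappa> q = (if q < b then Suc k else k)" for q
  define t where "t = real b / real N"
  have t: "0 \<le> t" "t \<le> 1" using b N by (auto simp: t_def)
  have ws: "word_sum (kron_index N \<kappa>) (\<lambda>i. kron N \<kappa> (A $ i)) UNIV (1 / real N) n = strip_sum k n A t"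
    if A: "A \<in> GL_tuples" and n: "n \<ge> 1" for A :: "real^'d^'d^'m" and n
    unfolding word_sum_kron[OF n] strip_sum_def
  proof (rule sum.cong[OF refl])
    fix w :: "'m list"
    define x where "x = wedge_norm k (word_prod A w)"
    define y where "y = wedge_norm (Suc k) (word_prod A w)"
    have xy: "x > 0" "y > 0" unfolding x_def y_def
      using k by (auto intro!: wedge_norm_pos invertible_word_prod[OF A])
    have "(\<Prod>q<N. wedge_norm (\<kappa> q) (word_prod A w)) = (\<Prod>q\<in>{..<N}. if q < b then y else x)"
      by (intro prod.cong) (auto simp: \<kappa>_def x_def y_def)
    also have "\<dots> = y ^ b * x ^ (N - b)"
    proof -
      have "{..<N} \<inter> {q. q < b} = {..<b}" "{..<N} \<inter> - {q. q < b} = {b..<N}" using b by auto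
      then show ?thesis by (simp add: prod.If_cases)
    qed
    finally have eq: "(\<Prod>q<N. wedge_norm (\<kappa> q) (word_prod A w)) = y ^ b * x ^ (N - b)" .
    have "1 - t = real (N - b) / real N" using b N by (simp add: t_def of_nat_diff field_simps)
    then show "(\<Prod>q<N. wedge_norm (\<kappa> q) (word_prod A w)) powr (1 / real N) =
        wedge_norm k (word_prod A w) powr (1 - t) * wedge_norm (Suc k) (word_prod A w) powr t"
      unfolding eq x_def[symmetric] y_def[symmetric] using xy
      by (simp add: powr_mult powr_realpow[symmetric] powr_powr t_def mult.commute)
  qed
  have "continuous_on GL_tuples (\<lambda>A :: real^'d^'d^'m. pressure A (real k + t))"
  proof (rule cocycle_pressure_continuous[of "kron_index N \<kappa>" UNIV "1 / real N" GL_tuples "\<lambda>A i. kron N \<kappa> (A $ i)"])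
    show "continuous_on GL_tuples (\<lambda>A :: real^'d^'d^'m. kron N \<kappa> (A $ i) F G)" for i F G
      by (intro continuous_on_kron continuous_intros)
  next
    fix A :: "real^'d^'d^'m" assume A: "A \<in> GL_tuples"
    obtain c where c: "\<And>n. n \<ge> 1 \<Longrightarrow> - (growth_rate k A + growth_rate (Suc k) A + c) * real n \<le> ln (strip_sum k n A t)"
      using strip_sum_exponent_change[OF k, where 'm = 'm] A t by (metis atLeastAtMost_iff)
    show "\<exists>B. \<forall>n\<ge>1. exp (- B * real n) \<le> word_sum (kron_index N \<kappa>) (\<lambda>i. kron N \<kappa> (A $ i)) UNIV (1 / real N) n"
    proof (intro exI allI impI)
      fix n :: nat assume n: "n \<ge> 1"
      show "exp (- (growth_rate k A + growth_rate (Suc k) A + c) * real n)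
          \<le> word_sum (kron_index N \<kappa>) (\<lambda>i. kron N \<kappa> (A $ i)) UNIV (1 / real N) n"
        unfolding ws[OF A n] using c[OF n] strip_sum_pos[OF A k, of n t]
        by (metis exp_le_cancel_iff exp_ln)
    qed
    show "(\<lambda>n. ln (word_sum (kron_index N \<kappa>) (\<lambda>i. kron N \<kappa> (A $ i)) UNIV (1 / real N) n) / real n)
        \<longlonglongrightarrow> pressure A (real k + t)"
    proof (rule Lim_transform_eventually[OF strip_pressure_limit[OF A k t]])
      show "\<forall>\<^sub>F n in sequentially. ln (strip_sum k n A t) / real n =
          ln (word_sum (kron_index N \<kappa>) (\<lambda>i. kron N \<kappa> (A $ i)) UNIV (1 / real N) n) / real n"
        using eventually_ge_at_top[of 1] by eventually_elim (simp add: ws[OF A])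
    qed
  qed (use N in auto)
  then show ?thesis by (simp add: t_def)
qed

lemma pressure_continuous_strip:
  assumes k: "k < CARD('d)"
  shows "continuous_on ((GL_tuples :: (real^'d^'d^'m) set) \<times> {real k..real (Suc k)}) (\<lambda>(A, s). pressure A s)"
proof -
  have "continuous_on ((GL_tuples :: (real^'d^'d^'m) set) \<times> {0..1}) (\<lambda>(A, t). pressure A (real k + t))"
  proof (rule continuous_on_Times_Lipschitz)
    show "continuous_on GL_tuples (\<lambda>A :: real^'d^'d^'m. growth_rate k A + growth_rate (Suc k) A)"
      using k by (intro continuous_on_add continuous_on_growth_rate) auto
    show "growth_rate k A + growth_rate (Suc k) A \<ge> 0" for A :: "real^'d^'d^'m"
      by (simp add: growth_rate_nonneg)
    show "\<bar>pressure A (real k + s) - pressure A (real k + t)\<bar> \<le> (growth_rate k A + growth_rate (Suc k) A) * \<bar>s - t\<bar>"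
      if "A \<in> GL_tuples" "s \<in> {0..1}" "t \<in> {0..1}" for A :: "real^'d^'d^'m" and s t
      using pressure_strip_Lipschitz[OF that(1) k that(2,3)] .
    fix t e :: real assume t: "t \<in> {0..1}" and e: "e > 0"
    define N where "N = Suc (nat \<lceil>1 / e\<rceil>)"
    define b where "b = nat \<lfloor>t * real N\<rfloor>"
    have N: "real N > 1 / e" "N \<ge> 1" unfolding N_def by linarith+
    have b: "real b \<le> t * real N" "t * real N < real b + 1" using t by (auto simp: b_def)
    have "t * real N \<le> 1 * real N" using t by (intro mult_right_mono) auto
    then have bN: "b \<le> N" using b(1) by simp
    have "\<bar>t - real b / real N\<bar> = (t * real N - real b) / real N"
      using b(1) N(2) by (simp add: diff_divide_distrib[symmetric] field_simps)
    also have "\<dots> < 1 / real N" using b(2) N(2) by (intro divide_strict_right_mono) auto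
    also have "1 / real N < e" using N e by (simp add: field_simps)
    finally show "\<exists>r\<in>{0..1}. \<bar>t - r\<bar> < e \<and> continuous_on GL_tuples (\<lambda>A :: real^'d^'d^'m. pressure A (real k + r))"
      using pressure_continuous_rational[OF k bN N(2), where 'm = 'm] bN N(2)
      by (intro bexI[of _ "real b / real N"]) auto
  qed
  then have "continuous_on ((GL_tuples :: (real^'d^'d^'m) set) \<times> {real k..real (Suc k)})
      (\<lambda>z. case (fst z, snd z - real k) of (A, t) \<Rightarrow> pressure A (real k + t))"
    by (rule continuous_on_compose2) (auto intro!: continuous_intros)
  then show ?thesis by (simp add: case_prod_unfold)
qed

section \<open>The pressure above the dimension\<close>

text \<open>Here the singular value function is multiplicative, so the sum over words of length \<open>n\<close> is an \<open>n\<close>-th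
  power.\<close>

lemma pressure_above_dim:
  fixes A :: "real^'d^'d^'m"
  assumes A: "A \<in> GL_tuples" and s: "s \<ge> real CARD('d)"
  shows "pressure A s = ln (\<Sum>i\<in>UNIV. \<bar>det (A $ i)\<bar> powr (s / real CARD('d)))"
proof -
  define r where "r = s / real CARD('d)"
  define q where "q = (\<Sum>i\<in>UNIV. \<bar>det (A $ i)\<bar> powr r)"
  have q: "q > 0" unfolding q_def using A
    by (intro sum_pos) (auto simp: GL_tuples_def invertible_det_nz)
  have "(\<Sum>w\<in>words UNIV n. \<bar>det (word_prod A w)\<bar> powr r) = q ^ n" for n
  proof (induction n)
    case (Suc n)
    have "(\<Sum>w\<in>words UNIV (Suc n). \<bar>det (word_prod A w)\<bar> powr r) =
        (\<Sum>i\<in>UNIV. \<Sum>w\<in>words UNIV n. \<bar>det (A $ i)\<bar> powr r * \<bar>det (word_prod A w)\<bar> powr r)"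
      by (simp add: sum_words_Suc det_mul abs_mult powr_mult mult.commute)
    then show ?case using Suc.IH by (simp add: sum_distrib_left[symmetric] sum_distrib_right[symmetric] q_def)
  qed simp
  then have Z: "(\<Sum>w\<in>{w :: 'm list. length w = n}. svf s (word_prod A w)) = q ^ n" for n
    using s by (simp add: svf_def words_def r_def)
  have "(\<lambda>n. 1 / real n * ln (\<Sum>w\<in>{w :: 'm list. length w = n}. svf s (word_prod A w))) \<longlonglongrightarrow> ln q"
  proof (rule Lim_transform_eventually[OF tendsto_const])
    show "\<forall>\<^sub>F n in sequentially. ln q = 1 / real n * ln (\<Sum>w\<in>{w :: 'm list. length w = n}. svf s (word_prod A w))"
      using eventually_ge_at_top[of 1] by eventually_elim (simp add: Z ln_realpow q)
  qed
  then show ?thesis unfolding pressure_def q_def r_def by (rule limI)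
qed

lemma pressure_continuous_above_dim:
  "continuous_on ((GL_tuples :: (real^'d^'d^'m) set) \<times> {real CARD('d)..}) (\<lambda>(A, s). pressure A s)"
proof -
  have nz: "det (A $ i) \<noteq> 0" if "A \<in> GL_tuples" for A :: "real^'d^'d^'m" and i
    using that by (auto simp: GL_tuples_def invertible_det_nz)
  have pos: "(\<Sum>i\<in>UNIV. \<bar>det (A $ i)\<bar> powr r) > 0" if "A \<in> GL_tuples" for A :: "real^'d^'d^'m" and r
    using nz[OF that] by (intro sum_pos) auto
  have "continuous_on ((GL_tuples :: (real^'d^'d^'m) set) \<times> {real CARD('d)..})
      (\<lambda>z. ln (\<Sum>i\<in>UNIV. \<bar>det (fst z $ i)\<bar> powr (snd z / real CARD('d))))"
  proof (rule continuous_on_ln)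
    show "continuous_on ((GL_tuples :: (real^'d^'d^'m) set) \<times> {real CARD('d)..})
        (\<lambda>z. \<Sum>i\<in>UNIV. \<bar>det (fst z $ i)\<bar> powr (snd z / real CARD('d)))"
      by (intro continuous_on_sum continuous_on_powr continuous_on_rabs continuous_on_det continuous_intros)
        (use nz in auto)
    show "\<forall>z\<in>(GL_tuples :: (real^'d^'d^'m) set) \<times> {real CARD('d)..}.
        (\<Sum>i\<in>UNIV. \<bar>det (fst z $ i)\<bar> powr (snd z / real CARD('d))) \<noteq> 0"
      using pos by (metis less_irrefl mem_Times_iff)
  qed
  then show ?thesis
    by (rule continuous_on_eq) (auto simp: pressure_above_dim)
qed

section \<open>Continuity on the whole parameter space\<close>

lemma pressure_continuous_upto:
  assumes "k \<le> CARD('d)"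
  shows "continuous_on ((GL_tuples :: (real^'d^'d^'m) set) \<times> {0..real k}) (\<lambda>(A, s). pressure A s)"
  using assms
proof (induction k)
  case 0
  have "continuous_on ((GL_tuples :: (real^'d^'d^'m) set) \<times> {real 0..real (Suc 0)}) (\<lambda>(A, s). pressure A s)"
    by (rule pressure_continuous_strip) simp
  then show ?case by (rule continuous_on_subset) auto
next
  case (Suc k)
  let ?G = "GL_tuples :: (real^'d^'d^'m) set"
  have un: "?G \<times> {0..real k} \<union> ?G \<times> {real k..real (Suc k)} = ?G \<times> {0..real (Suc k)}" by auto
  have "closedin (top_of_set (?G \<times> {0..real (Suc k)})) ((?G \<times> {0..real (Suc k)}) \<inter> (UNIV \<times> {..real k}))"
    by (intro closedin_closed_Int closed_Times) auto
  moreover have "(?G \<times> {0..real (Suc k)}) \<inter> (UNIV \<times> {..real k}) = ?G \<times> {0..real k}" by auto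
  ultimately have c1: "closedin (top_of_set (?G \<times> {0..real (Suc k)})) (?G \<times> {0..real k})" by simp
  have "closedin (top_of_set (?G \<times> {0..real (Suc k)})) ((?G \<times> {0..real (Suc k)}) \<inter> (UNIV \<times> {real k..}))"
    by (intro closedin_closed_Int closed_Times) auto
  moreover have "(?G \<times> {0..real (Suc k)}) \<inter> (UNIV \<times> {real k..}) = ?G \<times> {real k..real (Suc k)}" by auto
  ultimately have c2: "closedin (top_of_set (?G \<times> {0..real (Suc k)})) (?G \<times> {real k..real (Suc k)})" by simp
  show ?case
    using continuous_on_Un_local[of "?G \<times> {0..real k}" "?G \<times> {real k..real (Suc k)}", unfolded un, OF c1 c2]
      Suc pressure_continuous_strip[of k, where 'd = 'd and 'm = 'm] by auto
qed

theorem theorem2p1: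
  shows "continuous_on ((GL_tuples :: (real^'d^'d^'m) set) \<times> {0..}) (\<lambda>(A, s). pressure A s)"
proof -
  let ?G = "GL_tuples :: (real^'d^'d^'m) set" and ?d = "real CARD('d)"
  have un: "?G \<times> {0..?d} \<union> ?G \<times> {?d..} = ?G \<times> {0..}"
    using of_nat_0_le_iff[of "CARD('d)", where 'a = real] by fastforce
  have "closedin (top_of_set (?G \<times> {0..})) ((?G \<times> {0..}) \<inter> (UNIV \<times> {..?d}))"
    by (intro closedin_closed_Int closed_Times) auto
  moreover have "(?G \<times> {0..}) \<inter> (UNIV \<times> {..?d}) = ?G \<times> {0..?d}" by auto
  ultimately have c1: "closedin (top_of_set (?G \<times> {0..})) (?G \<times> {0..?d})" by simp
  have "closedin (top_of_set (?G \<times> {0..})) ((?G \<times> {0..}) \<inter> (UNIV \<times> {?d..}))"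
    by (intro closedin_closed_Int closed_Times) auto
  moreover have "(?G \<times> {0..}) \<inter> (UNIV \<times> {?d..}) = ?G \<times> {?d..}"
    using of_nat_0_le_iff[of "CARD('d)", where 'a = real] by fastforce
  ultimately have c2: "closedin (top_of_set (?G \<times> {0..})) (?G \<times> {?d..})" by simp
  show ?thesis
    using continuous_on_Un_local[of "?G \<times> {0..?d}" "?G \<times> {?d..}", unfolded un, OF c1 c2]
      pressure_continuous_upto[of "CARD('d)", where 'd = 'd and 'm = 'm] pressure_continuous_above_dim by auto
qed

end
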